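(* Let $S$ be a discrete, weakly cancellative semigroup, let $\omega$ be a weight on $S$, and let $\mathcal{A}:=\ell^1(S,\omega)$ be unital, with identity $e_{\mathcal{A}}$. Consider the following statements: (1) $\mathcal{A}$ is pointwise Connes amenable. (2) For each $k\in S$ there exists $M\in(\mathcal{A}\hat{\otimes}\mathcal{A})^{**}=\ell^\infty(S\times S)^*$ such that: (i) $\big\langle\big(f(hk,g)\,\Omega(h,k)-f(h,kg)\,\Omega(k,g)\big)_{(g,h)\in S\times S},\,M\big\rangle=0$ for each bounded function $f:S\times S\to\mathbb{C}$ such that the map $T\in\mathcal{L}(\mathcal{A},\mathcal{A}^* )$ defined by $\langle\delta_h,T(\delta_g)\rangle=f(g,h)$ $(g,h\in S)$ satisfies condition (D) below; (ii) $\big\langle\big(f_{gh}\,\Omega(g,h)\big)_{(g,h)\in S\times S},\,M\big\rangle=\langle f,e_{\mathcal{A}}\rangle$ for each family $f=(f_g)_{g\in S}\in c_0(S)$. (3) $\mathcal{A}$ is pointwise Connes amenable at $\delta_k$ for each $k\in S$. Then $(1)\Longrightarrow(2)\Longrightarrow(3)$. Here condition (D) on $T\in\mathcal{L}(\mathcal{A},\mathcal{A}^* )$ means: $T(\mathcal{A})\subseteq\imath_{c_0(S)}(c_0(S))$, $T^*(\imath_{\mathcal{A}}(\mathcal{A}))\subseteq\imath_{c_0(S)}(c_0(S))$, and for each sequence $(k_n)$ of distinct elements of $S$ and each sequence $(g_m,h_m)$ of distinct elements of $S\times S$ such that the four repeated limits $$\lim_n\lim_m\langle\delta_{k_ng_m},T(\delta_{h_m})\rangle,\qquad\lim_n\lim_m\Omega(k_n,g_m),$$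 $$\lim_n\lim_m\langle\delta_{g_m},T(\delta_{h_mk_n})\rangle,\qquad\lim_n\lim_m\Omega(h_m,k_n)$$ all exist, at least one repeated limit in each of the two rows is zero.
   Context: A weight on a discrete semigroup $S$ is a function $\omega:S\to[1,\infty)$ with $\omega(gh)\le\omega(g)\omega(h)$; if $S$ has an identity $e_S$, it is assumed that $\omega(e_S)=1$. Put $\Omega(g,h):=\dfrac{\omega(gh)}{\omega(g)\omega(h)}$. The Beurling algebra $\ell^1(S,\omega)$ is regarded as the Banach space $\ell^1(S)$ with product $\delta_g\star_\omega\delta_h:=\Omega(g,h)\,\delta_{gh}$, extended by linearity and continuity, where $\delta_g$ is the characteristic function of $\{g\}$. The semigroup $S$ is weakly cancellative if for each $s\in S$ the maps $t\mapsto st$ and $t\mapsto ts$ are finite-to-one; in this case $\ell^1(S,\omega)$ is a dual Banach algebra with predual $c_0(S)$. The space $\ell^1(S)\hat{\otimes}\ell^1(S)$ (projective tensor product) is identified with $\ell^1(S\times S)$ via $\delta_g\otimes\delta_h\leftrightarrow\delta_{(g,h)}$; its dual is $\ell^\infty(S\times S)$ and its bidual $\ell^\infty(S\times S)^*$. $\mathcal{L}(\mathcal{A},\mathcal{A}^* )$ is the space of bounded linear maps $\mathcal{A}\to\mathcal{A}^*=\ell^\infty(S)$, and $T^*:\mathcal{A}^{**}\to\mathcal{A}^*$ is the adjoint of $T$. For a Banach space $E$, $\imath_E:E\to E^{**}$ is the canonical embedding; $\imath_{c_0(S)}(c_0(S))$ is viewed in $c_0(S)^{**}=\ell^\infty(S)=\mathcal{A}^*$.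 A Banach $\mathcal{A}$-bimodule $E$ is dual if there is a closed submodule $E_*$ of $E^*$ with $E=(E_* )^*$; a Banach algebra is a dual Banach algebra if it is dual as a Banach bimodule over itself. For a dual Banach algebra $\mathcal{A}$, a dual Banach $\mathcal{A}$-bimodule $E$ is normal if for each $x\in E$ the maps $a\mapsto a\cdot x$ and $a\mapsto x\cdot a$ from $\mathcal{A}$ to $E$ are $w^*$-$w^*$-continuous. A derivation is a bounded linear map $D:\mathcal{A}\to E$ with $D(ab)=D(a)\cdot b+a\cdot D(b)$. $\mathcal{A}$ is pointwise Connes amenable at $a_0\in\mathcal{A}$ if for every normal, dual Banach $\mathcal{A}$-bimodule $E$ and every $w^*$-$w^*$-continuous derivation $D:\mathcal{A}\to E$ there is $x\in E$ with $D(a_0)=a_0\cdot x-x\cdot a_0$. $\mathcal{A}$ is pointwise Connes amenable if this holds at each $a_0\in\mathcal{A}$. *)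

theory Defs
  imports "HOL-Analysis.Analysis"
begin

section \<open>Complex Banach spaces on a carrier\<close>

text \<open>
  Spaces are given by an explicit carrier because the spaces that occur depend on terms (a weight,
  a space of functionals). Bounded linear maps and functionals are ordinary HOL functions;
  only their values on the carrier matter. To have each functional represented exactly once,
  the elements of a dual space are required to vanish off the carrier.
\<close>

record 'a cspace =
  carr :: "'a set"
  zer :: 'a
  add :: "'a \<Rightarrow> 'a \<Rightarrow> 'a"
  scl :: "complex \<Rightarrow> 'a \<Rightarrow> 'a"
  nrm :: "'a \<Rightarrow> real"

definition sub :: "('a, 'm) cspace_scheme \<Rightarrow> 'a \<Rightarrow> 'a \<Rightarrow> 'a" where
  "sub E x y = add E x (scl E (- 1) y)"

definition converges_to :: "('a, 'm) cspace_scheme \<Rightarrow> (nat \<Rightarrow> 'a) \<Rightarrow> 'a \<Rightarrow> bool" where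
  "converges_to E X x \<longleftrightarrow> (\<lambda>n. nrm E (sub E (X n) x)) \<longlonglongrightarrow> 0"

definition linear_subspace :: "('a, 'm) cspace_scheme \<Rightarrow> 'a set \<Rightarrow> bool" where
  "linear_subspace E V \<longleftrightarrow> V \<subseteq> carr E \<and> zer E \<in> V \<and>
     (\<forall>x\<in>V. \<forall>y\<in>V. add E x y \<in> V) \<and> (\<forall>c. \<forall>x\<in>V. scl E c x \<in> V)"

definition norm_closed :: "('a, 'm) cspace_scheme \<Rightarrow> 'a set \<Rightarrow> bool" where
  "norm_closed E V \<longleftrightarrow>
     (\<forall>X. \<forall>x\<in>carr E. (\<forall>n. X n \<in> V) \<and> converges_to E X x \<longrightarrow> x \<in> V)"

locale complex_banach_space =
  fixes E :: "('a, 'm) cspace_scheme"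
  assumes zero_closed: "zer E \<in> carr E"
    and add_closed: "\<lbrakk>x \<in> carr E; y \<in> carr E\<rbrakk> \<Longrightarrow> add E x y \<in> carr E"
    and scl_closed: "x \<in> carr E \<Longrightarrow> scl E c x \<in> carr E"
    and add_assoc: "\<lbrakk>x \<in> carr E; y \<in> carr E; z \<in> carr E\<rbrakk>
                      \<Longrightarrow> add E (add E x y) z = add E x (add E y z)"
    and add_commute: "\<lbrakk>x \<in> carr E; y \<in> carr E\<rbrakk> \<Longrightarrow> add E x y = add E y x"
    and add_zero: "x \<in> carr E \<Longrightarrow> add E x (zer E) = x"
    and add_inverse: "x \<in> carr E \<Longrightarrow> add E x (scl E (- 1) x) = zer E"
    and scl_one: "x \<in> carr E \<Longrightarrow> scl E 1 x = x"
    and scl_scl: "x \<in> carr E \<Longrightarrow> scl E b (scl E c x) = scl E (b * c) x"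
    and scl_add_left: "x \<in> carr E \<Longrightarrow> scl E (b + c) x = add E (scl E b x) (scl E c x)"
    and scl_add_right: "\<lbrakk>x \<in> carr E; y \<in> carr E\<rbrakk>
                          \<Longrightarrow> scl E c (add E x y) = add E (scl E c x) (scl E c y)"
    and norm_nonneg: "x \<in> carr E \<Longrightarrow> 0 \<le> nrm E x"
    and norm_eq_zero: "x \<in> carr E \<Longrightarrow> nrm E x = 0 \<longleftrightarrow> x = zer E"
    and norm_scl: "x \<in> carr E \<Longrightarrow> nrm E (scl E c x) = cmod c * nrm E x"
    and norm_triangle: "\<lbrakk>x \<in> carr E; y \<in> carr E\<rbrakk> \<Longrightarrow> nrm E (add E x y) \<le> nrm E x + nrm E y"
    and complete: "\<lbrakk>\<And>n. X n \<in> carr E;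
                     \<forall>\<epsilon>>0. \<exists>N. \<forall>m\<ge>N. \<forall>n\<ge>N. nrm E (sub E (X m) (X n)) < \<epsilon>\<rbrakk>
                    \<Longrightarrow> \<exists>x\<in>carr E. converges_to E X x"

definition bounded_linear_map ::
    "('a, 'm) cspace_scheme \<Rightarrow> ('b, 'n) cspace_scheme \<Rightarrow> ('a \<Rightarrow> 'b) \<Rightarrow> bool" where
  "bounded_linear_map E F T \<longleftrightarrow>
     (\<forall>x\<in>carr E. T x \<in> carr F) \<and>
     (\<forall>x\<in>carr E. \<forall>y\<in>carr E. T (add E x y) = add F (T x) (T y)) \<and>
     (\<forall>c. \<forall>x\<in>carr E. T (scl E c x) = scl F c (T x)) \<and>
     (\<exists>K. \<forall>x\<in>carr E. nrm F (T x) \<le> K * nrm E x)"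

definition complex_line :: "complex cspace" where
  "complex_line = \<lparr>carr = UNIV, zer = 0, add = (+), scl = (*), nrm = cmod\<rparr>"

definition dual_space :: "('a, 'm) cspace_scheme \<Rightarrow> ('a \<Rightarrow> complex) cspace" where
  "dual_space E =
     \<lparr>carr = {\<phi>. bounded_linear_map E complex_line \<phi> \<and> (\<forall>x. x \<notin> carr E \<longrightarrow> \<phi> x = 0)},
      zer = (\<lambda>_. 0),
      add = (\<lambda>\<phi> \<psi> x. \<phi> x + \<psi> x),
      scl = (\<lambda>c \<phi> x. c * \<phi> x),
      nrm = (\<lambda>\<phi>. SUP x\<in>{x \<in> carr E. nrm E x \<le> 1}. cmod (\<phi> x))\<rparr>"

text \<open>The weak* topology on \<open>E\<close> for a space \<open>Es\<close> of functionals: the initial topology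
  for the maps \<open>x \<mapsto> \<phi> x\<close>, \<open>\<phi> \<in> Es\<close>.\<close>

definition weak_star :: "('a, 'm) cspace_scheme \<Rightarrow> ('a \<Rightarrow> complex) set \<Rightarrow> 'a topology" where
  "weak_star E Es =
     pullback_topology (carr E) (\<lambda>x. \<lambda>\<phi>\<in>Es. \<phi> x) (product_topology (\<lambda>_. euclidean) Es)"


section \<open>Dual Banach bimodules and pointwise Connes amenability\<close>

record 'a calgebra = "'a cspace" +
  mul :: "'a \<Rightarrow> 'a \<Rightarrow> 'a"

record ('a, 'e) cbimodule = "'e cspace" +
  lact :: "'a \<Rightarrow> 'e \<Rightarrow> 'e"
  ract :: "'e \<Rightarrow> 'a \<Rightarrow> 'e"

locale banach_bimodule = complex_banach_space E
  for A :: "'a calgebra" and E :: "('a, 'e) cbimodule" +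
  assumes lact_closed: "\<lbrakk>a \<in> carr A; x \<in> carr E\<rbrakk> \<Longrightarrow> lact E a x \<in> carr E"
    and ract_closed: "\<lbrakk>a \<in> carr A; x \<in> carr E\<rbrakk> \<Longrightarrow> ract E x a \<in> carr E"
    and lact_add_left: "\<lbrakk>a \<in> carr A; b \<in> carr A; x \<in> carr E\<rbrakk>
          \<Longrightarrow> lact E (add A a b) x = add E (lact E a x) (lact E b x)"
    and lact_add_right: "\<lbrakk>a \<in> carr A; x \<in> carr E; y \<in> carr E\<rbrakk>
          \<Longrightarrow> lact E a (add E x y) = add E (lact E a x) (lact E a y)"
    and lact_scl_left: "\<lbrakk>a \<in> carr A; x \<in> carr E\<rbrakk> \<Longrightarrow> lact E (scl A c a) x = scl E c (lact E a x)"
    and lact_scl_right: "\<lbrakk>a \<in> carr A; x \<in> carr E\<rbrakk> \<Longrightarrow> lact E a (scl E c x) = scl E c (lact E a x)"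
    and ract_add_left: "\<lbrakk>a \<in> carr A; x \<in> carr E; y \<in> carr E\<rbrakk>
          \<Longrightarrow> ract E (add E x y) a = add E (ract E x a) (ract E y a)"
    and ract_add_right: "\<lbrakk>a \<in> carr A; b \<in> carr A; x \<in> carr E\<rbrakk>
          \<Longrightarrow> ract E x (add A a b) = add E (ract E x a) (ract E x b)"
    and ract_scl_left: "\<lbrakk>a \<in> carr A; x \<in> carr E\<rbrakk> \<Longrightarrow> ract E (scl E c x) a = scl E c (ract E x a)"
    and ract_scl_right: "\<lbrakk>a \<in> carr A; x \<in> carr E\<rbrakk> \<Longrightarrow> ract E x (scl A c a) = scl E c (ract E x a)"
    and lact_mul: "\<lbrakk>a \<in> carr A; b \<in> carr A; x \<in> carr E\<rbrakk>
          \<Longrightarrow> lact E (mul A a b) x = lact E a (lact E b x)"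
    and ract_mul: "\<lbrakk>a \<in> carr A; b \<in> carr A; x \<in> carr E\<rbrakk>
          \<Longrightarrow> ract E x (mul A a b) = ract E (ract E x a) b"
    and lact_ract: "\<lbrakk>a \<in> carr A; b \<in> carr A; x \<in> carr E\<rbrakk>
          \<Longrightarrow> lact E a (ract E x b) = ract E (lact E a x) b"
    and actions_bounded: "\<exists>K. \<forall>a\<in>carr A. \<forall>x\<in>carr E.
          nrm E (lact E a x) \<le> K * nrm A a * nrm E x \<and>
          nrm E (ract E x a) \<le> K * nrm A a * nrm E x"

definition dual_lact :: "('a, 'e) cbimodule \<Rightarrow> 'a \<Rightarrow> ('e \<Rightarrow> complex) \<Rightarrow> ('e \<Rightarrow> complex)" where
  "dual_lact E a \<phi> = (\<lambda>x. if x \<in> carr E then \<phi> (ract E x a) else 0)"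

definition dual_ract :: "('a, 'e) cbimodule \<Rightarrow> ('e \<Rightarrow> complex) \<Rightarrow> 'a \<Rightarrow> ('e \<Rightarrow> complex)" where
  "dual_ract E \<phi> a = (\<lambda>x. if x \<in> carr E then \<phi> (lact E a x) else 0)"

text \<open>\<open>Es\<close> is a closed submodule of the dual module of \<open>E\<close>, and \<open>E = (Es)*\<close>, i.e. the canonical map
  \<open>x \<mapsto> (\<phi> \<mapsto> \<phi> x)\<close> is an isometric isomorphism of \<open>E\<close> onto the dual space of \<open>Es\<close>.\<close>

definition canonical_map :: "('e \<Rightarrow> complex) set \<Rightarrow> 'e \<Rightarrow> (('e \<Rightarrow> complex) \<Rightarrow> complex)" where
  "canonical_map Es x = (\<lambda>\<phi>. if \<phi> \<in> Es then \<phi> x else 0)"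

definition dual_banach_bimodule ::
    "'a calgebra \<Rightarrow> ('a, 'e) cbimodule \<Rightarrow> ('e \<Rightarrow> complex) set \<Rightarrow> bool" where
  "dual_banach_bimodule A E Es \<longleftrightarrow>
     banach_bimodule A E \<and>
     linear_subspace (dual_space E) Es \<and> norm_closed (dual_space E) Es \<and>
     (\<forall>a\<in>carr A. \<forall>\<phi>\<in>Es. dual_lact E a \<phi> \<in> Es \<and> dual_ract E \<phi> a \<in> Es) \<and>
     (let Es_dual = dual_space (dual_space E\<lparr>carr := Es\<rparr>) in
        bij_betw (canonical_map Es) (carr E) (carr Es_dual) \<and>
        (\<forall>x\<in>carr E. nrm Es_dual (canonical_map Es x) = nrm E x))"

definition normal_bimodule ::
    "'a calgebra \<Rightarrow> ('a \<Rightarrow> complex) set \<Rightarrow> ('a, 'e) cbimodule \<Rightarrow> ('e \<Rightarrow> complex) set \<Rightarrow> bool" where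
  "normal_bimodule A As E Es \<longleftrightarrow>
     (\<forall>x\<in>carr E. continuous_map (weak_star A As) (weak_star E Es) (\<lambda>a. lact E a x) \<and>
                 continuous_map (weak_star A As) (weak_star E Es) (\<lambda>a. ract E x a))"

definition derivation :: "'a calgebra \<Rightarrow> ('a, 'e) cbimodule \<Rightarrow> ('a \<Rightarrow> 'e) \<Rightarrow> bool" where
  "derivation A E D \<longleftrightarrow> bounded_linear_map A E D \<and>
     (\<forall>a\<in>carr A. \<forall>b\<in>carr A. D (mul A a b) = add E (ract E (D a) b) (lact E a (D b)))"

text \<open>
  Pointwise Connes amenability of a dual Banach algebra \<open>A\<close> with predual \<open>As\<close> (a set of
  functionals on \<open>A\<close>). HOL cannot quantify over types inside a formula, so the type \<open>'e\<close> in which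
  the carriers of the modules \<open>E\<close> live is a parameter; only its cardinality matters. If \<open>D\<close> is
  not inner at \<open>a\<^sub>0\<close>, this persists in the weak*-closed submodule generated by the range of \<open>D\<close>,
  which is again normal and dual, and whose cardinality is bounded in terms of \<open>A\<close>. For
  \<open>A = \<ell>\<^sup>1(S,\<omega>)\<close> a functional in its predual is determined by its values at
  \<open>D \<delta>\<^sub>g\<close>, \<open>\<delta>\<^sub>h \<cdot> D \<delta>\<^sub>g\<close>, \<open>D \<delta>\<^sub>g \<cdot> \<delta>\<^sub>k\<close> and \<open>\<delta>\<^sub>h \<cdot> D \<delta>\<^sub>g \<cdot> \<delta>\<^sub>k\<close>, so the submodule fits into
  the type \<open>('s \<times> 's \<Rightarrow> complex) \<Rightarrow> complex\<close>: the notion at this type implies the notion at every type.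
\<close>

definition pointwise_connes_amenable_at ::
    "'e itself \<Rightarrow> 'a calgebra \<Rightarrow> ('a \<Rightarrow> complex) set \<Rightarrow> 'a \<Rightarrow> bool" where
  "pointwise_connes_amenable_at TYPE('e) A As a\<^sub>0 \<longleftrightarrow>
     (\<forall>(E :: ('a, 'e) cbimodule) Es D.
        dual_banach_bimodule A E Es \<and> normal_bimodule A As E Es \<and>
        derivation A E D \<and> continuous_map (weak_star A As) (weak_star E Es) D \<longrightarrow>
        (\<exists>x\<in>carr E. D a\<^sub>0 = sub E (lact E a\<^sub>0 x) (ract E x a\<^sub>0)))"

definition pointwise_connes_amenable ::
    "'e itself \<Rightarrow> 'a calgebra \<Rightarrow> ('a \<Rightarrow> complex) set \<Rightarrow> bool" where
  "pointwise_connes_amenable TYPE('e) A As \<longleftrightarrow>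
     (\<forall>a\<^sub>0\<in>carr A. pointwise_connes_amenable_at TYPE('e) A As a\<^sub>0)"


section \<open>Beurling algebras of discrete semigroups\<close>

definition weight :: "('s::semigroup_mult \<Rightarrow> real) \<Rightarrow> bool" where
  "weight \<omega> \<longleftrightarrow> (\<forall>g. 1 \<le> \<omega> g) \<and> (\<forall>g h. \<omega> (g * h) \<le> \<omega> g * \<omega> h) \<and>
     (\<forall>e. (\<forall>g. e * g = g \<and> g * e = g) \<longrightarrow> \<omega> e = 1)"

definition Omega :: "('s::semigroup_mult \<Rightarrow> real) \<Rightarrow> 's \<Rightarrow> 's \<Rightarrow> real" where
  "Omega \<omega> g h = \<omega> (g * h) / (\<omega> g * \<omega> h)"

definition delta :: "'s \<Rightarrow> 's \<Rightarrow> complex" where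
  "delta g = indicator {g}"

definition c0 :: "('i \<Rightarrow> complex) set" where
  "c0 = {f. \<forall>\<epsilon>>0. finite {i. \<epsilon> \<le> cmod (f i)}}"

definition linf :: "('i \<Rightarrow> complex) cspace" where
  "linf = \<lparr>carr = {f. bounded (range f)}, zer = (\<lambda>_. 0), add = (\<lambda>f g i. f i + g i),
           scl = (\<lambda>c f i. c * f i), nrm = (\<lambda>f. SUP i. cmod (f i))\<rparr>"

text \<open>The product is the continuous bilinear extension of \<open>\<delta>\<^sub>g \<star> \<delta>\<^sub>h = \<Omega>(g,h) \<delta>\<^bsub>gh\<^esub>\<close>. The norm is the
  unweighted one.\<close>

definition beurling :: "('s::semigroup_mult \<Rightarrow> real) \<Rightarrow> ('s \<Rightarrow> complex) calgebra" where
  "beurling \<omega> =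
     \<lparr>carr = {a. (\<lambda>s. cmod (a s)) summable_on UNIV}, zer = (\<lambda>_. 0), add = (\<lambda>a b s. a s + b s),
      scl = (\<lambda>c a s. c * a s), nrm = (\<lambda>a. \<Sum>\<^sub>\<infinity>s. cmod (a s)),
      mul = (\<lambda>a b s. \<Sum>\<^sub>\<infinity>(g, h)\<in>{(g, h). g * h = s}. a g * b h * of_real (Omega \<omega> g h))\<rparr>"

text \<open>The (bilinear) pairing of \<open>a \<in> \<ell>\<^sup>1(S)\<close> with \<open>\<phi> \<in> \<ell>\<^sup>\<infinity>(S)\<close> identifies \<open>\<ell>\<^sup>\<infinity>(S)\<close> with the dual of
  \<open>\<ell>\<^sup>1(S)\<close>, and \<open>c\<^sub>0(S)\<close> with the predual.\<close>

definition pairing :: "('s \<Rightarrow> complex) \<Rightarrow> ('s \<Rightarrow> complex) \<Rightarrow> complex" where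
  "pairing a \<phi> = (\<Sum>\<^sub>\<infinity>s. a s * \<phi> s)"

definition beurling_predual ::
    "('s::semigroup_mult \<Rightarrow> real) \<Rightarrow> (('s \<Rightarrow> complex) \<Rightarrow> complex) set" where
  "beurling_predual \<omega> = (\<lambda>f a. if a \<in> carr (beurling \<omega>) then pairing a f else 0) ` c0"

text \<open>With \<open>A* = \<ell>\<^sup>\<infinity>(S)\<close>: the canonical embedding of \<open>A\<close> into \<open>A** = \<ell>\<^sup>\<infinity>(S)*\<close>, and the adjoint
  \<open>T* : A** \<rightarrow> A*\<close> of \<open>T : A \<rightarrow> A*\<close>, where the functional \<open>T* \<Lambda> = \<Lambda> \<circ> T\<close> on \<open>A\<close> is identified with the
  family of its values at the \<open>\<delta>\<^sub>s\<close>.\<close>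

definition bidual_embedding :: "('s \<Rightarrow> complex) \<Rightarrow> (('s \<Rightarrow> complex) \<Rightarrow> complex)" where
  "bidual_embedding a = (\<lambda>\<phi>. if \<phi> \<in> carr linf then pairing a \<phi> else 0)"

definition adjoint_map ::
    "(('s \<Rightarrow> complex) \<Rightarrow> ('s \<Rightarrow> complex)) \<Rightarrow> (('s \<Rightarrow> complex) \<Rightarrow> complex) \<Rightarrow> ('s \<Rightarrow> complex)" where
  "adjoint_map T \<Lambda> = (\<lambda>s. \<Lambda> (T (delta s)))"

definition repeated_limit :: "(nat \<Rightarrow> nat \<Rightarrow> 'a::topological_space) \<Rightarrow> 'a \<Rightarrow> bool" where
  "repeated_limit x L \<longleftrightarrow> (\<exists>l. (\<forall>n. (\<lambda>m. x n m) \<longlonglongrightarrow> l n) \<and> l \<longlonglongrightarrow> L)"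

definition condition_D ::
    "('s::semigroup_mult \<Rightarrow> real) \<Rightarrow> (('s \<Rightarrow> complex) \<Rightarrow> ('s \<Rightarrow> complex)) \<Rightarrow> bool" where
  "condition_D \<omega> T \<longleftrightarrow>
     T ` carr (beurling \<omega>) \<subseteq> c0 \<and>
     adjoint_map T ` bidual_embedding ` carr (beurling \<omega>) \<subseteq> c0 \<and>
     (\<forall>(k :: nat \<Rightarrow> 's) (gh :: nat \<Rightarrow> 's \<times> 's) L\<^sub>1 W\<^sub>1 L\<^sub>2 W\<^sub>2.
        inj k \<and> inj gh \<and>
        repeated_limit (\<lambda>n m. pairing (delta (k n * fst (gh m))) (T (delta (snd (gh m))))) L\<^sub>1 \<and>
        repeated_limit (\<lambda>n m. Omega \<omega> (k n) (fst (gh m))) W\<^sub>1 \<and>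
        repeated_limit (\<lambda>n m. pairing (delta (fst (gh m))) (T (delta (snd (gh m) * k n)))) L\<^sub>2 \<and>
        repeated_limit (\<lambda>n m. Omega \<omega> (snd (gh m)) (k n)) W\<^sub>2 \<longrightarrow>
        (L\<^sub>1 = 0 \<or> W\<^sub>1 = 0) \<and> (L\<^sub>2 = 0 \<or> W\<^sub>2 = 0))"

definition condition_2 :: "('s::semigroup_mult \<Rightarrow> real) \<Rightarrow> ('s \<Rightarrow> complex) \<Rightarrow> bool" where
  "condition_2 \<omega> e \<longleftrightarrow>
     (\<forall>k. \<exists>M \<in> carr (dual_space (linf :: ('s \<times> 's \<Rightarrow> complex) cspace)).
        (\<forall>f \<in> carr linf. \<forall>T.
           bounded_linear_map (beurling \<omega>) linf T \<and>
           (\<forall>g h. pairing (delta h) (T (delta g)) = f (g, h)) \<and> condition_D \<omega> T \<longrightarrow>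
           M (\<lambda>(g, h). f (h * k, g) * of_real (Omega \<omega> h k)
                       - f (h, k * g) * of_real (Omega \<omega> k g)) = 0) \<and>
        (\<forall>f \<in> c0. M (\<lambda>(g, h). f (g * h) * of_real (Omega \<omega> g h)) = pairing e f))"

end

theory Submission
  imports Defs "HOL-Complex_Analysis.Great_Picard"
begin

text \<open>
  Write \<open>A\<close> for the Beurling algebra and \<open>X = \<ell>\<^sup>\<infinity>(S \<times> S)\<close> for the dual of its projective tensor
  square, with the module actions \<open>(F \<cdot> a)(x \<otimes> y) = F(a x \<otimes> y)\<close> and \<open>(a \<cdot> F)(x \<otimes> y) = F(x \<otimes> y a)\<close>.
  A function \<open>f\<close> that represents an operator \<open>T\<close> as in the statement is studied through its flip
  \<open>F(g,h) = f(h,g)\<close>; the module condition on \<open>M\<close> then reads \<open>M(\<delta>\<^sub>k \<cdot> F) = M(F \<cdot> \<delta>\<^sub>k)\<close>.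

  Everything rests on one description of condition (D). Call \<open>F \<in> X\<close> weakly continuous
  (\<open>sigma_wc\<close>) if for every \<open>\<Lambda> \<in> X\<^sup>*\<close> the functions \<open>k \<mapsto> \<Lambda>(F \<cdot> \<delta>\<^sub>k)\<close> and \<open>k \<mapsto> \<Lambda>(\<delta>\<^sub>k \<cdot> F)\<close>
  vanish at infinity. These \<open>F\<close> form a closed submodule \<open>Y\<close> of \<open>X\<close>, whose dual is a normal
  dual bimodule: a functional on \<open>Y\<close> extends to \<open>X\<close> by the Hahn--Banach theorem. Condition (D)
  forces \<open>F\<close> into \<open>Y\<close> (\<open>condition_D_imp_sigma_wc\<close>). Indeed, if \<open>\<Lambda>(F \<cdot> \<delta>\<^sub>k)\<close> is not small for
  infinitely many \<open>k\<close>, a Bonferroni argument with the total variation of \<open>\<Lambda>\<close>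
  (\<open>exists_uniformly_large_values\<close>) gives distinct \<open>k\<^sub>j\<close> and points \<open>i\<^sub>m\<close> with
  \<open>\<bar>(F \<cdot> \<delta>\<^bsub>k\<^sub>j\<^esub>)(i\<^sub>m)\<bar> \<ge> \<eta>\<close> for all \<open>j \<le> m\<close>; along subsequences all the repeated limits exist, and
  the two in one row have a nonzero product. This replaces the double limit
  criterion of Grothendieck for weak compactness.

  Pointwise Connes amenability gives the functionals \<open>M\<close>. Let \<open>E \<subseteq> Y\<^sup>*\<close> be the annihilator of
  all functions \<open>f(g h) \<Omega>(g,h)\<close> with \<open>f \<in> c\<^sub>0(S)\<close>. It is a normal dual bimodule, with the
  norm closure in \<open>E\<^sup>*\<close> of the evaluations at elements of \<open>Y\<close> as predual. Since \<open>e\<close> is an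
  identity, \<open>a \<mapsto> a \<cdot> (e \<otimes> e) - (e \<otimes> e) \<cdot> a\<close> takes its values in \<open>E\<close>, so it is a weak*-continuous
  derivation into \<open>E\<close>. If \<open>x \<in> E\<close> implements it at \<open>\<delta>\<^sub>k\<close>, then \<open>e \<otimes> e - x\<close> commutes with \<open>\<delta>\<^sub>k\<close>
  on \<open>Y\<close> and agrees with \<open>e \<otimes> e\<close> on the annihilated functions; any extension to \<open>X\<close> serves as
  \<open>M\<close> (\<open>pointwise_connes_amenable_imp_condition_2\<close>).

  Conversely, let \<open>D\<close> be a weak*-continuous derivation into a normal dual bimodule \<open>E\<close>. For
  \<open>\<phi>\<close> in the predual, \<open>(g,h) \<mapsto> \<phi>(\<delta>\<^sub>g \<cdot> D \<delta>\<^sub>h)\<close> satisfies (D): a weak* cluster point \<open>z\<close> of the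
  bounded sequence \<open>\<delta>\<^bsub>g\<^sub>m\<^esub> \<cdot> D \<delta>\<^bsub>h\<^sub>m\<^esub>\<close> turns the repeated limits into limits such as
  \<open>lim\<^sub>n \<phi>(\<delta>\<^bsub>k\<^sub>n\<^esub> \<cdot> z)\<close>, which are zero by normality. So \<open>M\<close> may be applied, and
  \<open>x\<^sub>0 = \<integral> \<delta>\<^sub>g \<cdot> D \<delta>\<^sub>h dM(g,h)\<close>, a weak* integral, satisfies
  \<open>\<delta>\<^sub>k \<cdot> x\<^sub>0 - x\<^sub>0 \<cdot> \<delta>\<^sub>k = e \<cdot> D \<delta>\<^sub>k\<close> by the derivation rule. The bimodule need not be unital; the
  rest \<open>D \<delta>\<^sub>k - e \<cdot> D \<delta>\<^sub>k = D e \<cdot> \<delta>\<^sub>k\<close> is removed by subtracting \<open>D e - e \<cdot> D e\<close> from \<open>x\<^sub>0\<close>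
  (\<open>inner_at_delta\<close>).
\<close>

section \<open>Banach spaces and their duals\<close>

text \<open>The axioms see only the vector space structure and the norm. A bimodule record therefore
  inherits completeness from a space with the same operations.\<close>

lemma complex_banach_space_cong:
  assumes "complex_banach_space E" "carr F = carr E" "zer F = zer E" "add F = add E"
    "scl F = scl E" "nrm F = nrm E"
  shows "complex_banach_space F"
proof -
  have "sub F = sub E" by (simp add: fun_eq_iff sub_def assms)
  moreover have "converges_to F = converges_to E"
    by (simp add: fun_eq_iff converges_to_def assms calculation)
  ultimately have "complex_banach_space F = complex_banach_space E"
    unfolding complex_banach_space_def assms(2-) by (simp only:)
  then show ?thesis using assms(1) by simp
qed

context complex_banach_space
begin

lemma scl_zero_left: "x \<in> carr E \<Longrightarrow> scl E 0 x = zer E"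
  using norm_eq_zero norm_scl scl_closed by force

lemma norm_zero: "nrm E (zer E) = 0"
  using norm_eq_zero zero_closed by blast

lemma sub_closed: "x \<in> carr E \<Longrightarrow> y \<in> carr E \<Longrightarrow> sub E x y \<in> carr E"
  by (simp add: add_closed scl_closed sub_def)

lemma norm_sub_commute:
  assumes "x \<in> carr E" "y \<in> carr E"
  shows "nrm E (sub E x y) = nrm E (sub E y x)"
proof -
  have "sub E y x = scl E (- 1) (sub E x y)"
    using assms by (simp add: sub_def scl_add_right scl_closed scl_scl scl_one add_commute)
  then show ?thesis
    using norm_scl[OF sub_closed[OF assms], of "-1"] by simp
qed

lemma functional_zero:
  assumes "\<phi> \<in> carr (dual_space E)" shows "\<phi> (zer E) = 0"
proof -
  have "\<phi> (scl E 0 (zer E)) = 0 * \<phi> (zer E)"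
    using assms zero_closed by (auto simp: dual_space_def bounded_linear_map_def complex_line_def)
  then show ?thesis by (simp add: scl_zero_left zero_closed)
qed

lemma functional_add:
  assumes "\<phi> \<in> carr (dual_space E)" "x \<in> carr E" "y \<in> carr E"
  shows "\<phi> (add E x y) = \<phi> x + \<phi> y"
  using assms by (auto simp: dual_space_def bounded_linear_map_def complex_line_def)

lemma functional_scl:
  assumes "\<phi> \<in> carr (dual_space E)" "x \<in> carr E"
  shows "\<phi> (scl E c x) = c * \<phi> x"
  using assms by (auto simp: dual_space_def bounded_linear_map_def complex_line_def)

lemma functional_sub:
  assumes "\<phi> \<in> carr (dual_space E)" "x \<in> carr E" "y \<in> carr E"
  shows "\<phi> (sub E x y) = \<phi> x - \<phi> y"
  using assms by (simp add: sub_def functional_add functional_scl scl_closed)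

lemma functional_off:
  assumes "\<phi> \<in> carr (dual_space E)" "x \<notin> carr E" shows "\<phi> x = 0"
  using assms by (auto simp: dual_space_def)

lemma functionalI:
  assumes "\<And>x y. \<lbrakk>x \<in> carr E; y \<in> carr E\<rbrakk> \<Longrightarrow> \<phi> (add E x y) = \<phi> x + \<phi> y"
    and "\<And>c x. x \<in> carr E \<Longrightarrow> \<phi> (scl E c x) = c * \<phi> x"
    and "\<And>x. x \<in> carr E \<Longrightarrow> cmod (\<phi> x) \<le> K * nrm E x"
    and "\<And>x. x \<notin> carr E \<Longrightarrow> \<phi> x = 0"
  shows "\<phi> \<in> carr (dual_space E)"
proof -
  have "\<exists>K. \<forall>x\<in>carr E. cmod (\<phi> x) \<le> K * nrm E x" using assms(3) by blast
  then show ?thesis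
    using assms by (simp add: dual_space_def bounded_linear_map_def complex_line_def)
qed

lemma functional_bounded:
  assumes "\<phi> \<in> carr (dual_space E)"
  shows "\<exists>K. \<forall>x\<in>carr E. cmod (\<phi> x) \<le> K * nrm E x"
  using assms by (simp add: dual_space_def bounded_linear_map_def complex_line_def)

lemma dual_norm_bdd:
  assumes "\<phi> \<in> carr (dual_space E)"
  shows "bdd_above ((\<lambda>x. cmod (\<phi> x)) ` {x \<in> carr E. nrm E x \<le> 1})"
proof -
  obtain K where K: "\<And>x. x \<in> carr E \<Longrightarrow> cmod (\<phi> x) \<le> K * nrm E x"
    using functional_bounded[OF assms] by blast
  show ?thesis
  proof (rule bdd_aboveI2)
    fix x assume x: "x \<in> {x \<in> carr E. nrm E x \<le> 1}"
    have "cmod (\<phi> x) \<le> K * nrm E x" using K x by auto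
    also have "\<dots> \<le> \<bar>K\<bar> * 1"
      using x norm_nonneg by (intro mult_mono) auto
    finally show "cmod (\<phi> x) \<le> \<bar>K\<bar>" by simp
  qed
qed

lemma dual_norm_nonneg:
  assumes "\<phi> \<in> carr (dual_space E)" shows "0 \<le> nrm (dual_space E) \<phi>"
proof -
  have "cmod (\<phi> (zer E)) \<le> (SUP x\<in>{x \<in> carr E. nrm E x \<le> 1}. cmod (\<phi> x))"
    using zero_closed norm_zero by (intro cSUP_upper[OF _ dual_norm_bdd[OF assms]]) auto
  then show ?thesis by (simp add: dual_space_def functional_zero[OF assms])
qed

lemma functional_le:
  assumes "\<phi> \<in> carr (dual_space E)" "x \<in> carr E"
  shows "cmod (\<phi> x) \<le> nrm (dual_space E) \<phi> * nrm E x"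
proof (cases "nrm E x = 0")
  case True
  then show ?thesis using assms functional_zero[OF assms(1)] norm_eq_zero[OF assms(2)] norm_zero by simp
next
  case False
  then have pos: "nrm E x > 0" using norm_nonneg[OF assms(2)] by simp
  define y where "y = scl E (of_real (1 / nrm E x)) x"
  have y: "y \<in> carr E" "nrm E y = 1"
    using assms(2) pos by (auto simp: y_def scl_closed norm_scl norm_divide)
  have "cmod (\<phi> y) \<le> nrm (dual_space E) \<phi>"
    using y by (auto simp: dual_space_def intro!: cSUP_upper[OF _ dual_norm_bdd[OF assms(1)]])
  then show ?thesis
    using pos by (simp add: y_def functional_scl[OF assms] norm_mult norm_divide field_simps)
qed

lemma dual_norm_le:
  assumes "\<And>x. x \<in> carr E \<Longrightarrow> cmod (\<phi> x) \<le> K * nrm E x" "0 \<le> K"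
  shows "nrm (dual_space E) \<phi> \<le> K"
proof -
  have "(SUP x\<in>{x \<in> carr E. nrm E x \<le> 1}. cmod (\<phi> x)) \<le> K"
  proof (rule cSUP_least)
    show "{x \<in> carr E. nrm E x \<le> 1} \<noteq> {}" using zero_closed norm_zero by force
    fix x assume x: "x \<in> {x \<in> carr E. nrm E x \<le> 1}"
    have "cmod (\<phi> x) \<le> K * nrm E x" using assms x by auto
    also have "\<dots> \<le> K * 1" using x assms(2) by (intro mult_left_mono) auto
    finally show "cmod (\<phi> x) \<le> K" by simp
  qed
  then show ?thesis by (simp add: dual_space_def)
qed

lemma dual_space_sub: "sub (dual_space E) \<phi> \<psi> = (\<lambda>x. \<phi> x - \<psi> x)"
  by (simp add: sub_def dual_space_def)

lemma dual_space_add: "add (dual_space E) \<phi> \<psi> = (\<lambda>x. \<phi> x + \<psi> x)"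
  by (simp add: dual_space_def)

lemma dual_space_scl: "scl (dual_space E) c \<phi> = (\<lambda>x. c * \<phi> x)"
  by (simp add: dual_space_def)

lemma dual_space_zer: "zer (dual_space E) = (\<lambda>x. 0)"
  by (simp add: dual_space_def)

lemma dual_add_closed:
  assumes "\<phi> \<in> carr (dual_space E)" "\<psi> \<in> carr (dual_space E)"
  shows "(\<lambda>x. \<phi> x + \<psi> x) \<in> carr (dual_space E)"
    "nrm (dual_space E) (\<lambda>x. \<phi> x + \<psi> x) \<le> nrm (dual_space E) \<phi> + nrm (dual_space E) \<psi>"
proof -
  let ?K = "nrm (dual_space E) \<phi> + nrm (dual_space E) \<psi>"
  have le: "cmod (\<phi> x + \<psi> x) \<le> ?K * nrm E x" if "x \<in> carr E" for x
    using norm_triangle_ineq[of "\<phi> x" "\<psi> x"] functional_le[OF assms(1) that]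
      functional_le[OF assms(2) that] by (simp add: algebra_simps)
  show "(\<lambda>x. \<phi> x + \<psi> x) \<in> carr (dual_space E)"
    using assms le by (intro functionalI[where K = ?K])
      (auto simp: functional_add functional_scl functional_off algebra_simps)
  show "nrm (dual_space E) (\<lambda>x. \<phi> x + \<psi> x) \<le> ?K"
    using le assms by (intro dual_norm_le) (auto simp: dual_norm_nonneg)
qed

lemma dual_scl_closed:
  assumes "\<phi> \<in> carr (dual_space E)"
  shows "(\<lambda>x. c * \<phi> x) \<in> carr (dual_space E)"
    "nrm (dual_space E) (\<lambda>x. c * \<phi> x) \<le> cmod c * nrm (dual_space E) \<phi>"
proof -
  let ?K = "cmod c * nrm (dual_space E) \<phi>"
  have le: "cmod (c * \<phi> x) \<le> ?K * nrm E x" if "x \<in> carr E" for x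
    using mult_left_mono[OF functional_le[OF assms that], of "cmod c"]
    by (simp add: norm_mult algebra_simps)
  show "(\<lambda>x. c * \<phi> x) \<in> carr (dual_space E)"
    using assms le by (intro functionalI[where K = ?K])
      (auto simp: functional_add functional_scl functional_off algebra_simps)
  show "nrm (dual_space E) (\<lambda>x. c * \<phi> x) \<le> ?K"
    using le assms by (intro dual_norm_le) (auto simp: dual_norm_nonneg)
qed

text \<open>A Cauchy sequence in the dual norm converges uniformly on balls, so its pointwise limit is
  again bounded and linear, and is the limit in norm.\<close>

lemma dual_complete:
  assumes X: "\<And>n. X n \<in> carr (dual_space E)"
    and Cauchy: "\<forall>\<epsilon>>0. \<exists>N. \<forall>m\<ge>N. \<forall>n\<ge>N. nrm (dual_space E) (\<lambda>x. X m x - X n x) < \<epsilon>"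
  shows "\<exists>\<phi>\<in>carr (dual_space E). (\<lambda>n. nrm (dual_space E) (\<lambda>x. X n x - \<phi> x)) \<longlonglongrightarrow> 0"
proof -
  have diff: "(\<lambda>x. X m x - X n x) \<in> carr (dual_space E)" for m n
    using dual_add_closed(1)[OF X dual_scl_closed(1)[OF X, of "-1"]] by simp
  have uni: "\<exists>N. \<forall>m\<ge>N. \<forall>n\<ge>N. \<forall>x\<in>carr E. cmod (X m x - X n x) \<le> \<epsilon> * nrm E x" if "\<epsilon> > 0" for \<epsilon>
  proof -
    obtain N where N: "\<And>m n. m \<ge> N \<Longrightarrow> n \<ge> N \<Longrightarrow> nrm (dual_space E) (\<lambda>x. X m x - X n x) < \<epsilon>"
      using Cauchy \<open>\<epsilon> > 0\<close> by blast
    have "cmod (X m x - X n x) \<le> \<epsilon> * nrm E x" if "m \<ge> N" "n \<ge> N" "x \<in> carr E" for m n x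
      using functional_le[OF diff that(3), of m n]
        mult_right_mono[OF less_imp_le[OF N[OF that(1,2)]] norm_nonneg[OF that(3)]] by simp
    then show ?thesis by blast
  qed
  have conv: "convergent (\<lambda>n. X n x)" for x
  proof (cases "x \<in> carr E")
    case True
    have "Cauchy (\<lambda>n. X n x)"
    proof (rule metric_CauchyI)
      fix e :: real assume "e > 0"
      then have "e / (1 + nrm E x) > 0" using norm_nonneg[OF True] by simp
      from uni[OF this] obtain N where
        N: "\<And>m n. m \<ge> N \<Longrightarrow> n \<ge> N \<Longrightarrow> cmod (X m x - X n x) \<le> e / (1 + nrm E x) * nrm E x"
        using True by blast
      have "e / (1 + nrm E x) * nrm E x < e"
        using norm_nonneg[OF True] \<open>e > 0\<close> by (simp add: field_simps)
      then show "\<exists>M. \<forall>m\<ge>M. \<forall>n\<ge>M. dist (X m x) (X n x) < e"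
        using N by (metis dist_norm le_less_trans)
    qed
    then show ?thesis by (simp add: Cauchy_convergent_iff)
  next
    case False
    then show ?thesis using functional_off[OF X] by (simp add: convergent_const)
  qed
  define \<phi> where "\<phi> x = lim (\<lambda>n. X n x)" for x
  have lim: "(\<lambda>n. X n x) \<longlonglongrightarrow> \<phi> x" for x
    using conv by (simp add: \<phi>_def convergent_LIMSEQ_iff)
  have near: "\<exists>N. \<forall>m\<ge>N. \<forall>x\<in>carr E. cmod (X m x - \<phi> x) \<le> \<epsilon> * nrm E x" if pos: "\<epsilon> > 0" for \<epsilon>
  proof -
    obtain N where N: "\<And>m n x. m \<ge> N \<Longrightarrow> n \<ge> N \<Longrightarrow> x \<in> carr E \<Longrightarrow> cmod (X m x - X n x) \<le> \<epsilon> * nrm E x"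
      using uni[OF pos] by blast
    have "cmod (X m x - \<phi> x) \<le> \<epsilon> * nrm E x" if "m \<ge> N" "x \<in> carr E" for m x
    proof (rule Lim_bounded)
      show "(\<lambda>n. cmod (X m x - X n x)) \<longlonglongrightarrow> cmod (X m x - \<phi> x)"
        by (intro tendsto_intros lim)
      show "\<forall>n\<ge>N. cmod (X m x - X n x) \<le> \<epsilon> * nrm E x" using N that by blast
    qed
    then show ?thesis by blast
  qed
  have \<phi>_in: "\<phi> \<in> carr (dual_space E)"
  proof -
    obtain N where N: "\<And>x. x \<in> carr E \<Longrightarrow> cmod (X N x - \<phi> x) \<le> 1 * nrm E x"
      using near[of 1] by auto
    show ?thesis
    proof (rule functionalI)
      fix x y assume xy: "x \<in> carr E" "y \<in> carr E"
      have "(\<lambda>n. X n (add E x y)) \<longlonglongrightarrow> \<phi> x + \<phi> y"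
        using tendsto_add[OF lim lim] by (simp add: functional_add[OF X xy])
      then show "\<phi> (add E x y) = \<phi> x + \<phi> y" using lim LIMSEQ_unique by blast
    next
      fix c x assume x: "x \<in> carr E"
      have "(\<lambda>n. X n (scl E c x)) \<longlonglongrightarrow> c * \<phi> x"
        using tendsto_mult[OF tendsto_const lim] by (simp add: functional_scl[OF X x])
      then show "\<phi> (scl E c x) = c * \<phi> x" using lim LIMSEQ_unique by blast
    next
      fix x assume x: "x \<in> carr E"
      have "cmod (\<phi> x) \<le> cmod (X N x - \<phi> x) + cmod (X N x)"
        by (metis add.commute norm_minus_commute norm_triangle_sub)
      also have "\<dots> \<le> (1 + nrm (dual_space E) (X N)) * nrm E x"
        using N[OF x] functional_le[OF X x, of N] by (simp add: algebra_simps)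
      finally show "cmod (\<phi> x) \<le> (1 + nrm (dual_space E) (X N)) * nrm E x" .
    next
      fix x assume "x \<notin> carr E"
      then have "(\<lambda>n. X n x) = (\<lambda>n. 0)" using functional_off[OF X] by auto
      then show "\<phi> x = 0" using lim[of x] by (simp add: LIMSEQ_const_iff)
    qed
  qed
  have diff': "(\<lambda>x. X n x - \<phi> x) \<in> carr (dual_space E)" for n
    using dual_add_closed(1)[OF X dual_scl_closed(1)[OF \<phi>_in, of "-1"]] by simp
  have "(\<lambda>n. nrm (dual_space E) (\<lambda>x. X n x - \<phi> x)) \<longlonglongrightarrow> 0"
  proof (rule LIMSEQ_I)
    fix r :: real assume "r > 0"
    then obtain N where N: "\<And>m x. m \<ge> N \<Longrightarrow> x \<in> carr E \<Longrightarrow> cmod (X m x - \<phi> x) \<le> (r/2) * nrm E x"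
      using near[of "r/2"] by auto
    have "nrm (dual_space E) (\<lambda>x. X n x - \<phi> x) \<le> r/2" if "n \<ge> N" for n
      using N[OF that] \<open>r > 0\<close> by (intro dual_norm_le) auto
    then show "\<exists>no. \<forall>n\<ge>no. norm (nrm (dual_space E) (\<lambda>x. X n x - \<phi> x) - 0) < r"
      using dual_norm_nonneg[OF diff'] \<open>r > 0\<close> by (intro exI[of _ N]) fastforce
  qed
  then show ?thesis using \<phi>_in by blast
qed

lemma dual_space_banach: "complex_banach_space (dual_space E)"
proof
  show "zer (dual_space E) \<in> carr (dual_space E)"
    by (auto simp: dual_space_zer intro: functionalI[where K = 0])
next
  fix \<phi> c assume \<phi>: "\<phi> \<in> carr (dual_space E)"
  show "nrm (dual_space E) \<phi> = 0 \<longleftrightarrow> \<phi> = zer (dual_space E)"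
  proof
    assume "nrm (dual_space E) \<phi> = 0"
    then have "\<phi> x = 0" for x
      using functional_le[OF \<phi>, of x] functional_off[OF \<phi>, of x] by (cases "x \<in> carr E") auto
    then show "\<phi> = zer (dual_space E)" by (auto simp: dual_space_zer)
  next
    assume "\<phi> = zer (dual_space E)"
    then have "nrm (dual_space E) \<phi> \<le> 0"
      by (intro dual_norm_le) (auto simp: dual_space_zer)
    then show "nrm (dual_space E) \<phi> = 0" using dual_norm_nonneg[OF \<phi>] by simp
  qed
  have "cmod c * nrm (dual_space E) \<phi> \<le> nrm (dual_space E) (\<lambda>x. c * \<phi> x)"
  proof (cases "c = 0")
    case True
    then show ?thesis using dual_norm_nonneg[OF dual_scl_closed(1)[OF \<phi>, of c]] by simp
  next
    case False
    have "nrm (dual_space E) (\<lambda>x. inverse c * (c * \<phi> x))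
        \<le> cmod (inverse c) * nrm (dual_space E) (\<lambda>x. c * \<phi> x)"
      by (intro dual_scl_closed(2) dual_scl_closed(1) \<phi>)
    moreover have "(\<lambda>x. inverse c * (c * \<phi> x)) = \<phi>" using False by (simp add: fun_eq_iff)
    ultimately show ?thesis using False by (simp add: norm_inverse norm_divide field_simps)
  qed
  then show "nrm (dual_space E) (scl (dual_space E) c \<phi>) = cmod c * nrm (dual_space E) \<phi>"
    using dual_scl_closed(2)[OF \<phi>, of c] by (simp add: dual_space_scl)
next
  fix X :: "nat \<Rightarrow> 'a \<Rightarrow> complex"
  assume "\<And>n. X n \<in> carr (dual_space E)"
    "\<forall>\<epsilon>>0. \<exists>N. \<forall>m\<ge>N. \<forall>n\<ge>N. nrm (dual_space E) (sub (dual_space E) (X m) (X n)) < \<epsilon>"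
  then show "\<exists>x\<in>carr (dual_space E). converges_to (dual_space E) X x"
    using dual_complete[of X] by (simp add: converges_to_def dual_space_sub)
qed (auto simp: dual_space_add dual_space_scl dual_space_zer dual_add_closed dual_scl_closed
      dual_norm_nonneg algebra_simps)

lemma closed_subspace_banach:
  assumes V: "linear_subspace E V" and closed: "norm_closed E V"
  shows "complex_banach_space (E\<lparr>carr := V\<rparr>)"
proof -
  have sub: "x \<in> V \<Longrightarrow> x \<in> carr E" for x using V by (auto simp: linear_subspace_def)
  have [simp]: "sub (E\<lparr>carr := V\<rparr>) = sub E" by (simp add: fun_eq_iff sub_def)
  show ?thesis
  proof
    fix X :: "nat \<Rightarrow> 'a"
    assume X: "\<And>n. X n \<in> carr (E\<lparr>carr := V\<rparr>)"
      and "\<forall>\<epsilon>>0. \<exists>N. \<forall>m\<ge>N. \<forall>n\<ge>N. nrm (E\<lparr>carr := V\<rparr>) (sub (E\<lparr>carr := V\<rparr>) (X m) (X n)) < \<epsilon>"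
    then obtain x where x: "x \<in> carr E" "converges_to E X x"
      using complete[of X] sub by auto
    then have "x \<in> V" using closed X by (auto simp: norm_closed_def)
    then show "\<exists>x\<in>carr (E\<lparr>carr := V\<rparr>). converges_to (E\<lparr>carr := V\<rparr>) X x"
      using x by (auto simp: converges_to_def)
  next
    fix x y assume "x \<in> carr (E\<lparr>carr := V\<rparr>)" "y \<in> carr (E\<lparr>carr := V\<rparr>)"
    then show "add (E\<lparr>carr := V\<rparr>) x y = add (E\<lparr>carr := V\<rparr>) y x"
      using sub by (simp add: add_commute)
  qed (use V sub in \<open>auto simp: linear_subspace_def add_assoc add_zero add_inverse scl_one
      scl_scl scl_add_left scl_add_right norm_nonneg norm_eq_zero norm_scl norm_triangle\<close>)
qed

end


section \<open>Bounded functions on a set\<close>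

lemma linf_iff: "f \<in> carr linf \<longleftrightarrow> (\<exists>K. \<forall>i. cmod (f i) \<le> K)"
  by (auto simp: linf_def bounded_iff)

lemma linfI: "(\<And>i. cmod (f i) \<le> K) \<Longrightarrow> f \<in> carr linf"
  by (auto simp: linf_iff)

lemma linf_le:
  assumes "f \<in> carr linf" shows "cmod (f i) \<le> nrm linf f"
proof -
  have "bdd_above (range (\<lambda>i. cmod (f i)))" using assms by (auto simp: linf_iff bdd_above_def)
  then show ?thesis by (auto simp: linf_def intro: cSUP_upper)
qed

lemma linf_norm_le: "(\<And>i. cmod (f i) \<le> K) \<Longrightarrow> nrm linf f \<le> K"
  by (auto simp: linf_def intro: cSUP_least)

lemma linf_norm_nonneg: "f \<in> carr linf \<Longrightarrow> 0 \<le> nrm linf f"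
  using linf_le[of f] norm_ge_zero order_trans by blast

lemma linf_simps:
  "zer linf = (\<lambda>_. 0)" "add linf f g = (\<lambda>i. f i + g i)" "scl linf c f = (\<lambda>i. c * f i)"
  "sub linf f g = (\<lambda>i. f i - g i)"
  by (simp_all add: linf_def sub_def)

lemma linf_zero: "(\<lambda>_. 0) \<in> carr linf"
  by (auto intro: linfI)

lemma linf_add:
  assumes "f \<in> carr linf" "g \<in> carr linf"
  shows "(\<lambda>i. f i + g i) \<in> carr linf" "nrm linf (\<lambda>i. f i + g i) \<le> nrm linf f + nrm linf g"
proof -
  have "cmod (f i + g i) \<le> nrm linf f + nrm linf g" for i
    using norm_triangle_ineq[of "f i" "g i"] linf_le[OF assms(1), of i] linf_le[OF assms(2), of i]
    by simp
  then show "(\<lambda>i. f i + g i) \<in> carr linf" "nrm linf (\<lambda>i. f i + g i) \<le> nrm linf f + nrm linf g"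
    by (auto intro: linfI linf_norm_le)
qed

lemma linf_scl:
  assumes "f \<in> carr linf"
  shows "(\<lambda>i. c * f i) \<in> carr linf" "nrm linf (\<lambda>i. c * f i) = cmod c * nrm linf f"
proof -
  have le: "(\<lambda>i. c * f i) \<in> carr linf \<and> nrm linf (\<lambda>i. c * f i) \<le> cmod c * nrm linf f"
    if "f \<in> carr linf" for c and f :: "'a \<Rightarrow> complex"
  proof -
    have "cmod (c * f i) \<le> cmod c * nrm linf f" for i
      using mult_left_mono[OF linf_le[OF that, of i], of "cmod c"] by (simp add: norm_mult)
    then show ?thesis by (auto intro: linfI linf_norm_le)
  qed
  show in_linf: "(\<lambda>i. c * f i) \<in> carr linf" using le assms by blast
  show "nrm linf (\<lambda>i. c * f i) = cmod c * nrm linf f"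
  proof (cases "c = 0")
    case True
    then show ?thesis using linf_norm_le[of "\<lambda>i. c * f i" 0] linf_norm_nonneg[OF in_linf] by simp
  next
    case False
    have "nrm linf (\<lambda>i. inverse c * (c * f i)) \<le> cmod (inverse c) * nrm linf (\<lambda>i. c * f i)"
      using le[OF in_linf, of "inverse c"] by blast
    moreover have "(\<lambda>i. inverse c * (c * f i)) = f" using False by (simp add: fun_eq_iff)
    ultimately show ?thesis
      using False le[OF assms, of c] by (simp add: norm_inverse norm_divide field_simps)
  qed
qed

lemma linf_diff:
  assumes "f \<in> carr linf" "g \<in> carr linf"
  shows "(\<lambda>i. f i - g i) \<in> carr linf"
  using linf_add(1)[OF assms(1) linf_scl(1)[OF assms(2), of "-1"]] by simp

lemma linf_complete:
  fixes X :: "nat \<Rightarrow> 'i \<Rightarrow> complex"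
  assumes X: "\<And>n. X n \<in> carr linf"
    and Cauchy: "\<forall>\<epsilon>>0. \<exists>N. \<forall>m\<ge>N. \<forall>n\<ge>N. nrm linf (\<lambda>i. X m i - X n i) < \<epsilon>"
  shows "\<exists>f\<in>carr linf. (\<lambda>n. nrm linf (\<lambda>i. X n i - f i)) \<longlonglongrightarrow> 0"
proof -
  have uni: "\<exists>N. \<forall>m\<ge>N. \<forall>n\<ge>N. \<forall>i. cmod (X m i - X n i) < \<epsilon>" if "\<epsilon> > 0" for \<epsilon>
  proof -
    obtain N where N: "\<And>m n. m \<ge> N \<Longrightarrow> n \<ge> N \<Longrightarrow> nrm linf (\<lambda>i. X m i - X n i) < \<epsilon>"
      using Cauchy \<open>\<epsilon> > 0\<close> by blast
    have "cmod (X m i - X n i) < \<epsilon>" if "m \<ge> N" "n \<ge> N" for m n i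
      using linf_le[OF linf_diff[OF X[of m] X[of n]], of i] N[OF that] by simp
    then show ?thesis by blast
  qed
  have "Cauchy (\<lambda>n. X n i)" for i
  proof (rule CauchyI)
    fix e :: real assume "0 < e"
    then show "\<exists>M. \<forall>m\<ge>M. \<forall>n\<ge>M. norm (X m i - X n i) < e" using uni by blast
  qed
  then have lim: "(\<lambda>n. X n i) \<longlonglongrightarrow> lim (\<lambda>n. X n i)" for i
    by (simp add: Cauchy_convergent_iff convergent_LIMSEQ_iff)
  define f where "f i = lim (\<lambda>n. X n i)" for i
  have near: "\<exists>N. \<forall>m\<ge>N. \<forall>i. cmod (X m i - f i) \<le> \<epsilon>" if "\<epsilon> > 0" for \<epsilon>
  proof -
    obtain N where N: "\<forall>m\<ge>N. \<forall>n\<ge>N. \<forall>i. cmod (X m i - X n i) < \<epsilon>"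
      using uni[OF \<open>\<epsilon> > 0\<close>] by blast
    have "cmod (X m i - f i) \<le> \<epsilon>" if "m \<ge> N" for m i
    proof (rule Lim_bounded)
      show "(\<lambda>n. cmod (X m i - X n i)) \<longlonglongrightarrow> cmod (X m i - f i)"
        using lim by (auto simp: f_def intro!: tendsto_intros)
      show "\<forall>n\<ge>N. cmod (X m i - X n i) \<le> \<epsilon>" using N that by (simp add: less_imp_le)
    qed
    then show ?thesis by blast
  qed
  obtain N where N: "\<And>i. cmod (X N i - f i) \<le> 1" using near[of 1] by auto
  have f: "f \<in> carr linf"
  proof (rule linfI)
    fix i
    show "cmod (f i) \<le> 1 + nrm linf (X N)"
      using N[of i] linf_le[OF X, of N i] norm_triangle_sub[of "f i" "X N i"]
      by (simp add: norm_minus_commute)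
  qed
  have "(\<lambda>n. nrm linf (\<lambda>i. X n i - f i)) \<longlonglongrightarrow> 0"
  proof (rule LIMSEQ_I)
    fix r :: real assume "r > 0"
    then obtain N where N: "\<And>m i. m \<ge> N \<Longrightarrow> cmod (X m i - f i) \<le> r/2"
      using near[of "r/2"] by auto
    have "norm (nrm linf (\<lambda>i. X n i - f i) - 0) < r" if "n \<ge> N" for n
      using linf_norm_le[of "\<lambda>i. X n i - f i", OF N[OF that]] linf_norm_nonneg[OF linf_diff[OF X f], of n]
        \<open>r > 0\<close> by simp
    then show "\<exists>no. \<forall>n\<ge>no. norm (nrm linf (\<lambda>i. X n i - f i) - 0) < r" by blast
  qed
  then show ?thesis using f by blast
qed

lemma linf_banach: "complex_banach_space (linf :: ('i \<Rightarrow> complex) cspace)"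
proof
  fix f :: "'i \<Rightarrow> complex" assume f: "f \<in> carr linf"
  show "nrm linf f = 0 \<longleftrightarrow> f = zer linf"
  proof
    assume "nrm linf f = 0"
    then show "f = zer linf" using linf_le[OF f] by (auto simp: linf_simps)
  next
    assume "f = zer linf"
    then show "nrm linf f = 0"
      using linf_norm_le[of f 0] linf_norm_nonneg[OF f] by (simp add: linf_simps)
  qed
next
  fix X :: "nat \<Rightarrow> 'i \<Rightarrow> complex"
  assume "\<And>n. X n \<in> carr linf"
    "\<forall>\<epsilon>>0. \<exists>N. \<forall>m\<ge>N. \<forall>n\<ge>N. nrm linf (sub linf (X m) (X n)) < \<epsilon>"
  then show "\<exists>x\<in>carr linf. converges_to linf X x"
    using linf_complete[of X] by (simp add: converges_to_def linf_simps)
qed (auto simp: linf_simps linf_add linf_scl linf_zero linf_norm_nonneg algebra_simps)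

interpretation linf: complex_banach_space "linf :: ('i \<Rightarrow> complex) cspace"
  by (rule linf_banach)


section \<open>The Hahn--Banach theorem for bounded functions\<close>

text \<open>The unimodular factor that makes the value of a functional real and nonnegative.\<close>

lemma phase: "\<exists>c. cmod c = 1 \<and> c * z = of_real (cmod z)"
  by (cases "z = 0") (auto intro: exI[of _ 1] exI[of _ "of_real (cmod z) / z"] simp: norm_divide)

lemma le_cINF_add_cINF:
  fixes f :: "'a \<Rightarrow> real" and g :: "'b \<Rightarrow> real"
  assumes "A \<noteq> {}" "B \<noteq> {}" "\<And>x y. \<lbrakk>x \<in> A; y \<in> B\<rbrakk> \<Longrightarrow> c \<le> f x + g y"
  shows "c \<le> (INF x\<in>A. f x) + (INF y\<in>B. g y)"
proof -
  have "c - f x \<le> (INF y\<in>B. g y)" if "x \<in> A" for x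
    using assms(3)[OF that] by (intro cINF_greatest assms(2)) (simp add: diff_le_eq add.commute)
  then have "c - (INF y\<in>B. g y) \<le> f x" if "x \<in> A" for x
    using that by (force simp: diff_le_eq add.commute)
  then have "c - (INF y\<in>B. g y) \<le> (INF x\<in>A. f x)"
    by (intro cINF_greatest assms(1))
  then show ?thesis by simp
qed

text \<open>The theorem is proved with minimal sublinear functionals: by Zorn's lemma there is a minimal one
  below a given one, and a minimal one is linear.
  Equality in the homogeneity condition follows by applying the inequality to \<open>1 / t\<close>.\<close>

definition sublinear :: "(('i \<Rightarrow> complex) \<Rightarrow> real) \<Rightarrow> bool" where
  "sublinear q \<longleftrightarrow>
     (\<forall>f\<in>carr linf. \<forall>g\<in>carr linf. q (\<lambda>i. f i + g i) \<le> q f + q g) \<and>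
     (\<forall>f\<in>carr linf. \<forall>t>0. q (\<lambda>i. of_real t * f i) \<le> t * q f)"

lemma sublinear_add:
  "\<lbrakk>sublinear q; f \<in> carr linf; g \<in> carr linf\<rbrakk> \<Longrightarrow> q (\<lambda>i. f i + g i) \<le> q f + q g"
  by (simp add: sublinear_def)

lemma sublinear_scl:
  assumes "sublinear q" "f \<in> carr linf" "t > 0"
  shows "q (\<lambda>i. of_real t * f i) = t * q f"
proof (rule antisym)
  show "q (\<lambda>i. of_real t * f i) \<le> t * q f" using assms by (simp add: sublinear_def)
  have "q (\<lambda>i. of_real (inverse t) * (of_real t * f i)) \<le> inverse t * q (\<lambda>i. of_real t * f i)"
    using assms linf_scl(1)[OF assms(2), of "of_real t"] by (simp add: sublinear_def del: of_real_inverse)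
  moreover have "(\<lambda>i. of_real (inverse t) * (of_real t * f i)) = f"
    using \<open>t > 0\<close> by (simp add: fun_eq_iff)
  ultimately show "t * q f \<le> q (\<lambda>i. of_real t * f i)" using \<open>t > 0\<close> by (simp add: field_simps)
qed

lemma sublinear_zero:
  assumes "sublinear q" shows "q (\<lambda>i. 0) = 0"
  using sublinear_scl[OF assms linf_zero, of 2] by simp

lemma sublinear_lower:
  assumes "sublinear q" "f \<in> carr linf" shows "- q (\<lambda>i. - f i) \<le> q f"
  using sublinear_add[OF assms, of "\<lambda>i. - f i"] sublinear_zero[OF assms(1)]
    linf_scl(1)[OF assms(2), of "-1"] by simp

text \<open>For \<open>q, r\<close> in a chain the smaller of the two bounds the infimum at \<open>f + g\<close> by \<open>q f + r g\<close>;
  this is what makes the pointwise infimum subadditive.\<close>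

lemma chain_Inf_sublinear:
  assumes C: "C \<noteq> {}" "\<And>q. q \<in> C \<Longrightarrow> sublinear q"
    and bdd: "\<And>f. f \<in> carr linf \<Longrightarrow> bdd_below ((\<lambda>q. q f) ` C)"
    and chain: "\<And>q r. \<lbrakk>q \<in> C; r \<in> C\<rbrakk> \<Longrightarrow> (\<forall>f. q f \<le> r f) \<or> (\<forall>f. r f \<le> q f)"
  shows "sublinear (\<lambda>f. INF q\<in>C. q f)"
  unfolding sublinear_def
proof (intro conjI ballI allI impI)
  fix f g :: "'a \<Rightarrow> complex" assume f: "f \<in> carr linf" and g: "g \<in> carr linf"
  have "(INF q\<in>C. q (\<lambda>i. f i + g i)) \<le> q f + r g" if q: "q \<in> C" and r: "r \<in> C" for q r
  proof -
    obtain u where u: "u \<in> C" "u f \<le> q f" "u g \<le> r g"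
      using chain[OF q r] q r by blast
    have "(INF q\<in>C. q (\<lambda>i. f i + g i)) \<le> u (\<lambda>i. f i + g i)"
      using u(1) by (intro cINF_lower bdd linf_add f g)
    then show ?thesis using sublinear_add[OF C(2)[OF u(1)] f g] u by linarith
  qed
  then show "(INF q\<in>C. q (\<lambda>i. f i + g i)) \<le> (INF q\<in>C. q f) + (INF q\<in>C. q g)"
    using C(1) by (intro le_cINF_add_cINF) auto
next
  fix f :: "'a \<Rightarrow> complex" and t :: real assume f: "f \<in> carr linf" and "t > 0"
  have "(INF q\<in>C. q (\<lambda>i. of_real t * f i)) / t \<le> q f" if "q \<in> C" for q
  proof -
    have "(INF q\<in>C. q (\<lambda>i. of_real t * f i)) \<le> q (\<lambda>i. of_real t * f i)"
      using that by (intro cINF_lower bdd linf_scl f)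
    then show ?thesis using sublinear_scl[OF C(2)[OF that] f \<open>t > 0\<close>] \<open>t > 0\<close> by (simp add: field_simps)
  qed
  then have "(INF q\<in>C. q (\<lambda>i. of_real t * f i)) / t \<le> (INF q\<in>C. q f)"
    using C(1) by (intro cINF_greatest) auto
  then show "(INF q\<in>C. q (\<lambda>i. of_real t * f i)) \<le> t * (INF q\<in>C. q f)"
    using \<open>t > 0\<close> by (simp add: field_simps)
qed

lemma exists_minimal_sublinear:
  assumes p: "sublinear p"
  shows "\<exists>q. sublinear q \<and> (\<forall>f\<in>carr linf. q f \<le> p f) \<and>
    (\<forall>r. sublinear r \<and> (\<forall>f\<in>carr linf. r f \<le> q f) \<longrightarrow> (\<forall>f\<in>carr linf. r f = q f))"
proof -
  define A where "A = {q. sublinear q \<and> (\<forall>f\<in>carr linf. q f \<le> p f) \<and> (\<forall>f. f \<notin> carr linf \<longrightarrow> q f = 0)}"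
  define P :: "(('a \<Rightarrow> complex) \<Rightarrow> real) \<Rightarrow> (('a \<Rightarrow> complex) \<Rightarrow> real) \<Rightarrow> bool"
    where "P q r \<longleftrightarrow> (\<forall>f. r f \<le> q f)" for q r
  define cut where "cut q f = (if f \<in> carr linf then q f else 0)"
    for q :: "('a \<Rightarrow> complex) \<Rightarrow> real" and f
  have cut_sublinear: "sublinear (cut q)" if "sublinear q" for q
    using that by (auto simp: sublinear_def cut_def linf_add linf_scl)
  \<comment> \<open>Functionals are set to zero off the space, so that the pointwise order is antisymmetric.\<close>
  have "\<exists>m\<in>A. \<forall>a\<in>A. P m a \<longrightarrow> a = m"
  proof (rule predicate_Zorn)
    show "partial_order_on A (relation_of P A)"
      by (rule partial_order_on_relation_ofI) (auto simp: P_def fun_eq_iff intro: order_trans antisym)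
  next
    fix C assume C: "C \<in> Chains (relation_of P A)"
    then have CA: "C \<subseteq> A" and chain: "\<And>q r. q \<in> C \<Longrightarrow> r \<in> C \<Longrightarrow> P q r \<or> P r q"
      by (auto simp: Chains_def relation_of_def)
    show "\<exists>u\<in>A. \<forall>a\<in>C. P a u"
    proof (cases "C = {}")
      case True
      have "cut p \<in> A" using cut_sublinear[OF p] by (auto simp: A_def cut_def)
      then show ?thesis using True by blast
    next
      case False
      define u where "u = cut (\<lambda>f. INF q\<in>C. q f)"
      have bdd: "bdd_below ((\<lambda>q. q f) ` C)" if f: "f \<in> carr linf" for f
      proof (rule bdd_belowI2)
        fix q assume "q \<in> C"
        then have q: "sublinear q" "\<And>f. f \<in> carr linf \<Longrightarrow> q f \<le> p f" using CA by (auto simp: A_def)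
        show "- p (\<lambda>i. - f i) \<le> q f"
          using sublinear_lower[OF q(1) f] q(2)[of "\<lambda>i. - f i"] linf_scl(1)[OF f, of "-1"] by simp
      qed
      have "sublinear u"
        unfolding u_def using False CA chain bdd
        by (intro cut_sublinear chain_Inf_sublinear) (auto simp: A_def P_def)
      moreover have low: "u f \<le> q f" if "q \<in> C" for q f
      proof (cases "f \<in> carr linf")
        case True
        then show ?thesis using that bdd by (auto simp: u_def cut_def intro: cINF_lower)
      next
        case False
        then show ?thesis using that CA by (auto simp: u_def cut_def A_def)
      qed
      moreover have "u f \<le> p f" if "f \<in> carr linf" for f
      proof -
        obtain q where "q \<in> C" using False by blast
        then show ?thesis using low[of q f] CA that by (force simp: A_def)
      qed
      ultimately have "u \<in> A" by (auto simp: A_def u_def cut_def)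
      then show ?thesis using low by (auto simp: P_def)
    qed
  qed
  then obtain m where m: "m \<in> A" "\<And>a. a \<in> A \<Longrightarrow> P m a \<Longrightarrow> a = m" by blast
  have "r f = m f" if r: "sublinear r" "\<forall>f\<in>carr linf. r f \<le> m f" and f: "f \<in> carr linf" for r f
  proof -
    have "cut r \<in> A" "P m (cut r)"
      using m(1) r cut_sublinear[OF r(1)] by (force simp: A_def cut_def P_def)+
    then have "cut r = m" using m(2) by blast
    then show ?thesis using f by (metis cut_def)
  qed
  then show ?thesis using m(1) by (auto simp: A_def)
qed

text \<open>Lowering \<open>q\<close> in the direction \<open>g\<close> gives the sublinear functional
  \<open>r x = inf\<^bsub>t \<ge> 0\<^esub> (q (x + t g) - t q g) \<le> q x\<close>. Minimality gives \<open>r = q\<close>, and the term with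
  \<open>t = 1\<close> is the missing inequality \<open>q f + q g \<le> q (f + g)\<close>.\<close>

lemma minimal_sublinear_additive:
  assumes q: "sublinear q"
    and minimal: "\<And>r f. \<lbrakk>sublinear r; \<forall>f\<in>carr linf. r f \<le> q f; f \<in> carr linf\<rbrakk> \<Longrightarrow> r f = q f"
    and f: "f \<in> carr linf" and g: "g \<in> carr linf"
  shows "q (\<lambda>i. f i + g i) = q f + q g"
proof (rule antisym)
  show "q (\<lambda>i. f i + g i) \<le> q f + q g" by (rule sublinear_add[OF q f g])
  define s where "s t x = q (\<lambda>i. x i + of_real t * g i) - t * q g" for t x
  define r where "r x = (INF t\<in>{0..}. s t x)" for x
  have tg: "(\<lambda>i. of_real t * g i) \<in> carr linf" for t :: real by (rule linf_scl(1)[OF g])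
  have s_low: "- q (\<lambda>i. - x i) \<le> s t x" if "x \<in> carr linf" "t \<ge> 0" for t x
  proof -
    have "q (\<lambda>i. of_real t * g i) = t * q g"
      using sublinear_scl[OF q g, of t] sublinear_zero[OF q] \<open>t \<ge> 0\<close> by (cases "t = 0") auto
    moreover have "q (\<lambda>i. (x i + of_real t * g i) + (- x i)) \<le> q (\<lambda>i. x i + of_real t * g i) + q (\<lambda>i. - x i)"
      using that linf_scl(1)[OF that(1), of "-1"] by (intro sublinear_add[OF q] linf_add tg) simp_all
    ultimately show ?thesis by (simp add: s_def)
  qed
  have r_le: "r x \<le> s t x" if "x \<in> carr linf" "t \<ge> 0" for t x
    unfolding r_def using that s_low[OF that(1)] by (intro cINF_lower bdd_belowI2) auto
  have "sublinear r"
    unfolding sublinear_def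
  proof (intro conjI ballI allI impI)
    fix x y :: "'a \<Rightarrow> complex" assume x: "x \<in> carr linf" and y: "y \<in> carr linf"
    have "r (\<lambda>i. x i + y i) \<le> s t x + s u y" if "t \<ge> 0" "u \<ge> 0" for t u
    proof -
      have "r (\<lambda>i. x i + y i) \<le> s (t + u) (\<lambda>i. x i + y i)" using that by (intro r_le linf_add x y) auto
      moreover have "q (\<lambda>i. (x i + of_real t * g i) + (y i + of_real u * g i))
          \<le> q (\<lambda>i. x i + of_real t * g i) + q (\<lambda>i. y i + of_real u * g i)"
        by (intro sublinear_add[OF q] linf_add x y tg)
      moreover have "(\<lambda>i. (x i + of_real t * g i) + (y i + of_real u * g i))
          = (\<lambda>i. (x i + y i) + of_real (t + u) * g i)" by (simp add: fun_eq_iff algebra_simps)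
      ultimately show ?thesis by (simp add: s_def algebra_simps)
    qed
    then show "r (\<lambda>i. x i + y i) \<le> r x + r y"
      unfolding r_def[of x] r_def[of y] by (intro le_cINF_add_cINF) auto
  next
    fix x :: "'a \<Rightarrow> complex" and u :: real assume x: "x \<in> carr linf" and u: "u > 0"
    have "r (\<lambda>i. of_real u * x i) / u \<le> s t x" if "t \<ge> 0" for t
    proof -
      have "r (\<lambda>i. of_real u * x i) \<le> s (u * t) (\<lambda>i. of_real u * x i)"
        using that u by (intro r_le linf_scl x) auto
      moreover have "q (\<lambda>i. of_real u * (x i + of_real t * g i)) = u * q (\<lambda>i. x i + of_real t * g i)"
        by (intro sublinear_scl[OF q] linf_add x tg u)
      moreover have "(\<lambda>i. of_real u * (x i + of_real t * g i)) = (\<lambda>i. of_real u * x i + of_real (u * t) * g i)"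
        by (simp add: fun_eq_iff algebra_simps)
      ultimately show ?thesis using u by (simp add: s_def field_simps)
    qed
    then have "r (\<lambda>i. of_real u * x i) / u \<le> r x"
      unfolding r_def[of x] by (intro cINF_greatest) auto
    then show "r (\<lambda>i. of_real u * x i) \<le> u * r x" using u by (simp add: field_simps)
  qed
  moreover have "\<forall>x\<in>carr linf. r x \<le> q x" using r_le[of _ 0] by (simp add: s_def)
  ultimately have "r f = q f" using minimal f by blast
  then show "q f + q g \<le> q (\<lambda>i. f i + g i)" using r_le[OF f, of 1] by (simp add: s_def)
qed

text \<open>Start with \<open>p x = inf\<^bsub>v \<in> V\<^esub> (K \<parallel>x - v\<parallel> + Re (\<mu> v))\<close>, which lies below both \<open>K \<parallel>x\<parallel>\<close> and,
  on \<open>V\<close>, below \<open>Re \<mu>\<close>. A minimal sublinear \<open>q \<le> p\<close> is real linear, and an additive \<open>q\<close> below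
  \<open>Re \<mu>\<close> on a subspace equals \<open>Re \<mu>\<close> there; \<open>q\<close> is then the real part of the extension.\<close>

theorem Hahn_Banach_linf:
  fixes V :: "('i \<Rightarrow> complex) set"
  assumes V: "linear_subspace linf V"
    and \<mu>: "\<mu> \<in> carr (dual_space (linf\<lparr>carr := V\<rparr>))"
  shows "\<exists>\<Lambda>\<in>carr (dual_space linf). \<forall>v\<in>V. \<Lambda> v = \<mu> v"
proof -
  have VI: "(\<lambda>_. 0) \<in> V" "V \<subseteq> carr linf"
    and V_add: "\<And>x y. x \<in> V \<Longrightarrow> y \<in> V \<Longrightarrow> (\<lambda>i. x i + y i) \<in> V"
    and V_scl: "\<And>c x. x \<in> V \<Longrightarrow> (\<lambda>i. c * x i) \<in> V"
    using V by (auto simp: linear_subspace_def linf_simps)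
  have \<mu>_add: "\<And>x y. x \<in> V \<Longrightarrow> y \<in> V \<Longrightarrow> \<mu> (\<lambda>i. x i + y i) = \<mu> x + \<mu> y"
    and \<mu>_scl: "\<And>c x. x \<in> V \<Longrightarrow> \<mu> (\<lambda>i. c * x i) = c * \<mu> x"
    using \<mu> by (auto simp: dual_space_def bounded_linear_map_def complex_line_def linf_simps)
  obtain K0 where K0: "\<And>v. v \<in> V \<Longrightarrow> cmod (\<mu> v) \<le> K0 * nrm linf v"
  proof -
    have "\<exists>K. \<forall>v\<in>V. cmod (\<mu> v) \<le> K * nrm linf v"
      using \<mu> by (simp add: dual_space_def bounded_linear_map_def complex_line_def)
    then show ?thesis using that by blast
  qed
  define K where "K = \<bar>K0\<bar>"
  have K: "cmod (\<mu> v) \<le> K * nrm linf v" if "v \<in> V" for v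
  proof -
    have "K0 * nrm linf v \<le> K * nrm linf v"
      using linf_norm_nonneg[of v] that VI by (intro mult_right_mono) (auto simp: K_def)
    then show ?thesis using K0[OF that] by linarith
  qed
  have K_nonneg: "K \<ge> 0" by (simp add: K_def)
  define s where "s v x = K * nrm linf (\<lambda>i. x i - v i) + Re (\<mu> v)" for v x :: "'i \<Rightarrow> complex"
  define p where "p x = (INF v\<in>V. s v x)" for x
  have s_low: "- K * nrm linf x \<le> s v x" if "x \<in> carr linf" "v \<in> V" for x v
  proof -
    have v: "v \<in> carr linf" using that VI by auto
    have "nrm linf (\<lambda>i. (-1) * (x i - v i) + x i) \<le> nrm linf (\<lambda>i. (-1) * (x i - v i)) + nrm linf x"
      by (intro linf_add(2) linf_scl linf_diff that v)
    also have "nrm linf (\<lambda>i. (-1) * (x i - v i)) = nrm linf (\<lambda>i. x i - v i)"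
      using linf_scl(2)[OF linf_diff[OF that(1) v], of "-1"] by simp
    finally have "nrm linf v \<le> nrm linf (\<lambda>i. x i - v i) + nrm linf x" by simp
    then have "K * nrm linf v \<le> K * nrm linf (\<lambda>i. x i - v i) + K * nrm linf x"
      using K_nonneg by (metis distrib_left mult_left_mono)
    then show ?thesis using K[OF that(2)] abs_Re_le_cmod[of "\<mu> v"] by (simp add: s_def)
  qed
  have p_le: "p x \<le> s v x" if "x \<in> carr linf" "v \<in> V" for x v
    unfolding p_def using that s_low[OF that(1)] by (intro cINF_lower bdd_belowI2) auto
  have V_ne: "V \<noteq> {}" using VI by blast
  have "sublinear p"
    unfolding sublinear_def
  proof (intro conjI ballI allI impI)
    fix x y :: "'i \<Rightarrow> complex" assume x: "x \<in> carr linf" and y: "y \<in> carr linf"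
    have "p (\<lambda>i. x i + y i) \<le> s v x + s w y" if "v \<in> V" "w \<in> V" for v w
    proof -
      have "p (\<lambda>i. x i + y i) \<le> s (\<lambda>i. v i + w i) (\<lambda>i. x i + y i)"
        using that by (intro p_le linf_add V_add x y)
      moreover have "nrm linf (\<lambda>i. (x i - v i) + (y i - w i))
          \<le> nrm linf (\<lambda>i. x i - v i) + nrm linf (\<lambda>i. y i - w i)"
        using that VI by (intro linf_add(2) linf_diff x y) auto
      moreover have "(\<lambda>i. (x i - v i) + (y i - w i)) = (\<lambda>i. (x i + y i) - (v i + w i))"
        by (simp add: fun_eq_iff)
      ultimately show ?thesis
        using mult_left_mono[of "nrm linf (\<lambda>i. (x i - v i) + (y i - w i))" _ K] K_nonneg \<mu>_add[OF that]
        by (fastforce simp: s_def distrib_left)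
    qed
    then show "p (\<lambda>i. x i + y i) \<le> p x + p y"
      using V_ne unfolding p_def[of x] p_def[of y] by (intro le_cINF_add_cINF) auto
  next
    fix x :: "'i \<Rightarrow> complex" and t :: real assume x: "x \<in> carr linf" and t: "t > 0"
    have "p (\<lambda>i. of_real t * x i) / t \<le> s v x" if "v \<in> V" for v
    proof -
      have "p (\<lambda>i. of_real t * x i) \<le> s (\<lambda>i. of_real t * v i) (\<lambda>i. of_real t * x i)"
        using that by (intro p_le linf_scl V_scl x)
      moreover have "nrm linf (\<lambda>i. of_real t * (x i - v i)) = t * nrm linf (\<lambda>i. x i - v i)"
        using linf_scl(2)[OF linf_diff[OF x], of v "of_real t"] that VI t by auto
      ultimately show ?thesis
        using t \<mu>_scl[OF that, of "of_real t"] by (simp add: s_def right_diff_distrib pos_divide_le_eq algebra_simps)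
    qed
    then have "p (\<lambda>i. of_real t * x i) / t \<le> p x"
      using V_ne unfolding p_def[of x] by (intro cINF_greatest) auto
    then show "p (\<lambda>i. of_real t * x i) \<le> t * p x" using t by (simp add: field_simps)
  qed
  then obtain q where q: "sublinear q" "\<And>f. f \<in> carr linf \<Longrightarrow> q f \<le> p f"
    and minimal: "\<And>r f. \<lbrakk>sublinear r; \<forall>f\<in>carr linf. r f \<le> q f; f \<in> carr linf\<rbrakk> \<Longrightarrow> r f = q f"
    using exists_minimal_sublinear[of p] by blast
  have q_add: "q (\<lambda>i. f i + g i) = q f + q g" if "f \<in> carr linf" "g \<in> carr linf" for f g
    by (rule minimal_sublinear_additive[OF q(1) _ that]) (rule minimal)
  have q_minus: "q (\<lambda>i. - f i) = - q f" if "f \<in> carr linf" for f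
    using q_add[OF that, of "\<lambda>i. - f i"] linf_scl(1)[OF that, of "-1"] sublinear_zero[OF q(1)] by simp
  have q_scl: "q (\<lambda>i. of_real t * f i) = t * q f" if f: "f \<in> carr linf" for t :: real and f
  proof (cases t "0::real" rule: linorder_cases)
    case less
    have "q (\<lambda>i. of_real (- t) * f i) = (- t) * q f" using less by (intro sublinear_scl[OF q(1) f]) simp
    moreover have "q (\<lambda>i. - (of_real (- t) * f i)) = - q (\<lambda>i. of_real (- t) * f i)"
      by (rule q_minus) (rule linf_scl[OF f])
    ultimately show ?thesis by simp
  next
    case equal
    then show ?thesis using sublinear_zero[OF q(1)] by simp
  next
    case greater
    then show ?thesis by (rule sublinear_scl[OF q(1) f])
  qed
  have q_norm: "q f \<le> K * nrm linf f" if "f \<in> carr linf" for f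
    using q(2)[OF that] p_le[OF that VI(1)] \<mu>_scl[OF VI(1), of 0] by (simp add: s_def)
  have q_V: "q v = Re (\<mu> v)" if v: "v \<in> V" for v
  proof -
    have le: "q v \<le> Re (\<mu> v)" if "v \<in> V" for v
    proof -
      have "v \<in> carr linf" using that VI by auto
      then show ?thesis using q(2)[of v] p_le[of v v] that
        by (simp add: s_def linf.norm_zero[unfolded linf_simps])
    qed
    have "v \<in> carr linf" using v VI by auto
    then show ?thesis
      using le[OF v] le[OF V_scl[OF v, of "-1"]] q_minus[of v] \<mu>_scl[OF v, of "-1"] by simp
  qed
  define \<Lambda> where "\<Lambda> f = (if f \<in> carr linf then Complex (q f) (- q (\<lambda>i. \<i> * f i)) else 0)" for f
  have \<Lambda>_add: "\<Lambda> (\<lambda>i. f i + g i) = \<Lambda> f + \<Lambda> g" if "f \<in> carr linf" "g \<in> carr linf" for f g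
  proof -
    have "(\<lambda>i. \<i> * (f i + g i)) = (\<lambda>i. \<i> * f i + \<i> * g i)" by (simp add: algebra_simps)
    then show ?thesis using that by (simp add: \<Lambda>_def q_add linf_add linf_scl complex_add)
  qed
  have \<Lambda>_scl: "\<Lambda> (\<lambda>i. c * f i) = c * \<Lambda> f" if f: "f \<in> carr linf" for c f
  proof -
    have eq: "q (\<lambda>i. c * f i) = Re c * q f + Im c * q (\<lambda>i. \<i> * f i)" if f: "f \<in> carr linf" for c f
    proof -
      have "(\<lambda>i. c * f i) = (\<lambda>i. of_real (Re c) * f i + of_real (Im c) * (\<i> * f i))"
        by (subst complex_eq[of c]) (simp add: algebra_simps)
      then show ?thesis using f by (simp add: q_add q_scl linf_scl)
    qed
    have "q (\<lambda>i. \<i> * (c * f i)) = q (\<lambda>i. (\<i> * c) * f i)" by (simp add: mult.assoc)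
    then show ?thesis
      using f eq[OF f, of c] eq[OF f, of "\<i> * c"] by (simp add: \<Lambda>_def linf_scl complex_eq_iff)
  qed
  have \<Lambda>_norm: "cmod (\<Lambda> f) \<le> K * nrm linf f" if f: "f \<in> carr linf" for f
  proof -
    obtain c where c: "cmod c = 1" "c * \<Lambda> f = of_real (cmod (\<Lambda> f))"
      using phase by blast
    have "Re (\<Lambda> (\<lambda>i. c * f i)) = cmod (\<Lambda> f)" using c by (simp add: \<Lambda>_scl[OF f])
    then have "cmod (\<Lambda> f) = q (\<lambda>i. c * f i)" using f by (simp add: \<Lambda>_def linf_scl)
    then show ?thesis using q_norm[OF linf_scl(1)[OF f, of c]] c by (simp add: linf_scl(2)[OF f])
  qed
  have "\<Lambda> \<in> carr (dual_space linf)"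
    using \<Lambda>_add \<Lambda>_scl \<Lambda>_norm
    by (intro linf.functionalI[where K = K]) (auto simp: linf_simps \<Lambda>_def)
  moreover have "\<Lambda> v = \<mu> v" if v: "v \<in> V" for v
    using v VI q_V[OF v] q_V[OF V_scl[OF v, of \<i>]] \<mu>_scl[OF v, of \<i>]
    by (auto simp: \<Lambda>_def complex_eq_iff)
  ultimately show ?thesis by blast
qed


text \<open>Used in place of weak* compactness: applied to the values of a bounded sequence in a dual
  space, such a functional produces a weak* cluster point.\<close>

lemma exists_limit_functional:
  "\<exists>\<Theta> \<in> carr (dual_space (linf :: (nat \<Rightarrow> complex) cspace)).
     \<forall>x l. x \<longlonglongrightarrow> l \<longrightarrow> \<Theta> x = l"
proof -
  define V :: "(nat \<Rightarrow> complex) set" where "V = {x. convergent x}"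
  define \<mu> where "\<mu> x = (if x \<in> V then lim x else 0)" for x :: "nat \<Rightarrow> complex"
  have V_linf: "V \<subseteq> carr linf"
    by (auto simp: V_def linf_def convergent_def dest: convergent_imp_bounded)
  have V: "linear_subspace linf V"
    using V_linf by (simp add: linear_subspace_def linf_simps V_def convergent_add convergent_mult convergent_const)
  have lim_le: "cmod (lim x) \<le> nrm linf x" if "x \<in> V" for x
  proof (rule Lim_bounded)
    show "(\<lambda>n. cmod (x n)) \<longlonglongrightarrow> cmod (lim x)"
      using that by (intro tendsto_norm) (simp add: V_def convergent_LIMSEQ_iff)
    have "x \<in> carr linf" using that V_linf by blast
    from linf_le[OF this] show "\<forall>n\<ge>0. cmod (x n) \<le> nrm linf x" by blast
  qed
  have "\<exists>K. \<forall>x\<in>V. cmod (\<mu> x) \<le> K * nrm linf x"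
    using lim_le by (intro exI[of _ 1]) (auto simp: \<mu>_def)
  moreover have "\<mu> (\<lambda>i. x i + y i) = \<mu> x + \<mu> y" if xy: "x \<in> V" "y \<in> V" for x y
  proof -
    have "x \<longlonglongrightarrow> lim x" "y \<longlonglongrightarrow> lim y" using xy by (simp_all add: V_def convergent_LIMSEQ_iff)
    from limI[OF tendsto_add[OF this]] show ?thesis
      using xy by (simp add: \<mu>_def V_def convergent_add)
  qed
  moreover have "\<mu> (\<lambda>i. c * x i) = c * \<mu> x" if x: "x \<in> V" for c x
  proof -
    have "x \<longlonglongrightarrow> lim x" using x by (simp add: V_def convergent_LIMSEQ_iff)
    from limI[OF tendsto_mult[OF tendsto_const this]] show ?thesis
      using x by (simp add: \<mu>_def V_def convergent_mult convergent_const)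
  qed
  ultimately have "\<mu> \<in> carr (dual_space (linf\<lparr>carr := V\<rparr>))"
    using V by (auto simp: dual_space_def bounded_linear_map_def complex_line_def linf_simps
        linear_subspace_def \<mu>_def)
  then obtain \<Theta> where "\<Theta> \<in> carr (dual_space linf)" "\<forall>x\<in>V. \<Theta> x = \<mu> x"
    using Hahn_Banach_linf[OF V] by blast
  then show ?thesis
    by (intro bexI[of _ \<Theta>]) (auto simp: \<mu>_def V_def convergentI limI)
qed

section \<open>A functional that does not vanish along a sequence\<close>

text \<open>The total variation of the finitely additive complex measure that \<open>\<Lambda>\<close> represents.\<close>

definition total_variation :: "(('i \<Rightarrow> complex) \<Rightarrow> complex) \<Rightarrow> 'i set \<Rightarrow> real" where
  "total_variation \<Lambda> A = (SUP g\<in>{g. \<forall>i. cmod (g i) \<le> indicator A i}. cmod (\<Lambda> g))"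

context
  fixes \<Lambda> :: "('i \<Rightarrow> complex) \<Rightarrow> complex"
  assumes \<Lambda>: "\<Lambda> \<in> carr (dual_space linf)"
begin

lemma under_indicator:
  assumes "\<And>i. cmod (g i) \<le> indicator A i"
  shows "g \<in> carr linf" "nrm linf g \<le> 1"
proof -
  have "cmod (g i) \<le> 1" for i using assms[of i] by (cases "i \<in> A") auto
  then show "g \<in> carr linf" "nrm linf g \<le> 1" by (auto intro: linfI linf_norm_le)
qed

lemma variation_le_norm:
  assumes "\<And>i. cmod (g i) \<le> indicator A i"
  shows "cmod (\<Lambda> g) \<le> nrm (dual_space linf) \<Lambda>"
  using linf.functional_le[OF \<Lambda> under_indicator(1)[OF assms]]
    mult_left_mono[OF under_indicator(2)[OF assms] linf.dual_norm_nonneg[OF \<Lambda>]] by simp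

lemma le_total_variation:
  assumes "\<And>i. cmod (g i) \<le> indicator A i" shows "cmod (\<Lambda> g) \<le> total_variation \<Lambda> A"
  unfolding total_variation_def using assms variation_le_norm by (intro cSUP_upper bdd_aboveI2) auto

lemma total_variation_least:
  assumes "\<And>g. (\<And>i. cmod (g i) \<le> indicator A i) \<Longrightarrow> cmod (\<Lambda> g) \<le> K"
  shows "total_variation \<Lambda> A \<le> K"
  unfolding total_variation_def using assms by (intro cSUP_least) (auto intro!: exI[of _ "\<lambda>_. 0"])

lemma total_variation_bounded: "total_variation \<Lambda> A \<le> nrm (dual_space linf) \<Lambda>"
  by (intro total_variation_least variation_le_norm)

lemma total_variation_nonneg: "0 \<le> total_variation \<Lambda> A"
  using order_trans[OF norm_ge_zero le_total_variation[of "\<lambda>_. 0" A]] by simp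

lemma total_variation_subadditive:
  assumes "A \<subseteq> B \<union> C"
  shows "total_variation \<Lambda> A \<le> total_variation \<Lambda> B + total_variation \<Lambda> C"
proof (rule total_variation_least)
  fix g assume g: "\<And>i. cmod (g i) \<le> indicator A i"
  define b where "b i = (if i \<in> B then g i else 0)" for i
  define c where "c i = (if i \<in> B then 0 else g i)" for i
  have b: "cmod (b i) \<le> indicator B i" and c: "cmod (c i) \<le> indicator C i" for i
    using g[of i] assms by (cases "i \<in> A"; auto simp: b_def c_def)+
  have "g = (\<lambda>i. b i + c i)" by (auto simp: b_def c_def)
  then have "\<Lambda> g = \<Lambda> b + \<Lambda> c"
    using linf.functional_add[OF \<Lambda> under_indicator(1)[OF b] under_indicator(1)[OF c]]
    by (simp add: linf_simps)
  then show "cmod (\<Lambda> g) \<le> total_variation \<Lambda> B + total_variation \<Lambda> C"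
    using norm_triangle_ineq[of "\<Lambda> b" "\<Lambda> c"] le_total_variation[OF b] le_total_variation[OF c] by simp
qed

text \<open>Two functions under disjoint indicators may be multiplied by phases that align their values
  before they are added.\<close>

lemma total_variation_superadditive:
  assumes "A \<inter> B = {}"
  shows "total_variation \<Lambda> A + total_variation \<Lambda> B \<le> total_variation \<Lambda> (A \<union> B)"
proof -
  have le: "cmod (\<Lambda> a) + cmod (\<Lambda> b) \<le> total_variation \<Lambda> (A \<union> B)"
    if a: "\<And>i. cmod (a i) \<le> indicator A i" and b: "\<And>i. cmod (b i) \<le> indicator B i" for a b
  proof -
    obtain phase where phase: "\<And>z. cmod (phase z) = 1" "\<And>z. phase z * z = of_real (cmod z)"
      using phase by metis
    define g where "g i = phase (\<Lambda> a) * a i + phase (\<Lambda> b) * b i" for i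
    have "a \<in> carr linf" "b \<in> carr linf" using under_indicator(1) a b by blast+
    then have "\<Lambda> g = phase (\<Lambda> a) * \<Lambda> a + phase (\<Lambda> b) * \<Lambda> b"
      using linf.functional_add[OF \<Lambda>, of "\<lambda>i. phase (\<Lambda> a) * a i" "\<lambda>i. phase (\<Lambda> b) * b i"]
        linf.functional_scl[OF \<Lambda>, of a "phase (\<Lambda> a)"] linf.functional_scl[OF \<Lambda>, of b "phase (\<Lambda> b)"]
      by (simp add: linf_simps linf_scl g_def[abs_def])
    then have "\<Lambda> g = of_real (cmod (\<Lambda> a) + cmod (\<Lambda> b))" by (simp add: phase(2))
    then have "cmod (\<Lambda> g) = cmod (\<Lambda> a) + cmod (\<Lambda> b)" by (simp only: norm_of_real) simp
    moreover have "cmod (g i) \<le> indicator (A \<union> B) i" for i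
      using a[of i] b[of i] assms
      by (cases "i \<in> A"; cases "i \<in> B") (auto simp: g_def norm_mult phase(1))
    ultimately show ?thesis using le_total_variation[of g "A \<union> B"] by simp
  qed
  have "cmod (\<Lambda> a) + total_variation \<Lambda> B \<le> total_variation \<Lambda> (A \<union> B)"
    if a: "\<And>i. cmod (a i) \<le> indicator A i" for a
  proof -
    have "total_variation \<Lambda> B \<le> total_variation \<Lambda> (A \<union> B) - cmod (\<Lambda> a)"
    proof (rule total_variation_least)
      fix b :: "'i \<Rightarrow> complex" assume "\<And>i. cmod (b i) \<le> indicator B i"
      from le[OF a this] show "cmod (\<Lambda> b) \<le> total_variation \<Lambda> (A \<union> B) - cmod (\<Lambda> a)" by simp
    qed
    then show ?thesis by simp
  qed
  then have "total_variation \<Lambda> A \<le> total_variation \<Lambda> (A \<union> B) - total_variation \<Lambda> B"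
    by (intro total_variation_least) (simp add: le_diff_eq)
  then show ?thesis by simp
qed

lemma total_variation_empty: "total_variation \<Lambda> {} = 0"
proof (rule antisym)
  show "total_variation \<Lambda> {} \<le> 0"
  proof (rule total_variation_least)
    fix g :: "'i \<Rightarrow> complex" assume "\<And>i. cmod (g i) \<le> indicator {} i"
    then have "g = (\<lambda>_. 0)" by (simp add: fun_eq_iff)
    then show "cmod (\<Lambda> g) \<le> 0" using linf.functional_zero[OF \<Lambda>] by (simp add: linf_simps)
  qed
qed (rule total_variation_nonneg)

text \<open>Sets of mass at least \<open>\<delta>\<close> with small pairwise intersections are almost disjoint: each set
  contributes at least \<open>\<delta> - r \<eta>\<close> beyond the union of its predecessors.\<close>

lemma Bonferroni_total_variation:
  fixes r :: nat and \<eta> :: real and B :: "nat \<Rightarrow> 'i set"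
  assumes "\<And>j. j < r \<Longrightarrow> \<delta> \<le> total_variation \<Lambda> (B j)"
    and "\<And>i j. \<lbrakk>i < j; j < r\<rbrakk> \<Longrightarrow> total_variation \<Lambda> (B i \<inter> B j) \<le> \<eta>" and "0 \<le> \<eta>"
  shows "r * (\<delta> - r * \<eta>) \<le> total_variation \<Lambda> (\<Union>j<r. B j)"
proof -
  have overlap: "total_variation \<Lambda> (B j \<inter> (\<Union>i<m. B i)) \<le> m * \<eta>" if "m \<le> j" "j < r" for m j :: nat
    using that
  proof (induction m)
    case 0
    then show ?case by (simp add: total_variation_empty)
  next
    case (Suc m)
    have "total_variation \<Lambda> (B j \<inter> (\<Union>i<Suc m. B i))
        \<le> total_variation \<Lambda> (B m \<inter> B j) + total_variation \<Lambda> (B j \<inter> (\<Union>i<m. B i))"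
      by (rule total_variation_subadditive) (auto simp: lessThan_Suc)
    then show ?case using Suc assms(2)[of m j] by (simp add: algebra_simps)
  qed
  have "m * (\<delta> - r * \<eta>) \<le> total_variation \<Lambda> (\<Union>j<m. B j)" if "m \<le> r" for m :: nat
    using that
  proof (induction m)
    case 0
    then show ?case using total_variation_nonneg by simp
  next
    case (Suc m)
    let ?U = "\<Union>j<m. B j"
    have "\<delta> \<le> total_variation \<Lambda> (B m \<inter> ?U) + total_variation \<Lambda> (B m - ?U)"
      using assms(1)[of m] Suc.prems total_variation_subadditive[of "B m" "B m \<inter> ?U" "B m - ?U"] by force
    moreover have "total_variation \<Lambda> (B m \<inter> ?U) \<le> r * \<eta>"
      using overlap[of m m] Suc.prems mult_right_mono[of m r \<eta>] \<open>0 \<le> \<eta>\<close> by simp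
    moreover have "total_variation \<Lambda> ?U + total_variation \<Lambda> (B m - ?U) \<le> total_variation \<Lambda> (?U \<union> (B m - ?U))"
      by (rule total_variation_superadditive) auto
    moreover have "?U \<union> (B m - ?U) = (\<Union>j<Suc m. B j)" by (auto simp: lessThan_Suc)
    ultimately show ?case using Suc by (simp add: algebra_simps)
  qed
  then show ?thesis by blast
qed

text \<open>Infinitely many sets of mass at least \<open>\<delta>\<close> in a space of finite mass cannot have pairwise
  intersections whose masses all tend to zero, since \<open>r\<close> of them would have a union of
  mass at least \<open>r \<delta> / 2\<close>, which for large \<open>r\<close> exceeds the total mass.\<close>

lemma exists_heavy_set:
  assumes N: "infinite N" and "\<delta> > 0" and B: "\<And>n. n \<in> N \<Longrightarrow> \<delta> \<le> total_variation \<Lambda> (B n)"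
  shows "\<exists>m\<in>N. \<exists>N'\<subseteq>N. infinite N' \<and> m \<notin> N' \<and> (\<exists>\<delta>'>0. \<forall>n\<in>N'. \<delta>' \<le> total_variation \<Lambda> (B m \<inter> B n))"
proof (rule ccontr)
  assume contra: "\<not> ?thesis"
  have small: "finite {n\<in>N. \<eta> \<le> total_variation \<Lambda> (B m \<inter> B n)}" if "m \<in> N" "\<eta> > 0" for m \<eta>
  proof (rule ccontr)
    define N' where "N' = {n\<in>N. \<eta> \<le> total_variation \<Lambda> (B m \<inter> B n)} - {m}"
    assume "infinite {n\<in>N. \<eta> \<le> total_variation \<Lambda> (B m \<inter> B n)}"
    then have N': "infinite N'" by (simp add: N'_def)
    have "\<exists>\<delta>'>0. \<forall>n\<in>N'. \<delta>' \<le> total_variation \<Lambda> (B m \<inter> B n)"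
      using that(2) by (intro exI[of _ \<eta>]) (auto simp: N'_def)
    moreover have "N' \<subseteq> N" "m \<notin> N'" by (auto simp: N'_def)
    ultimately show False using contra that(1) N' by blast
  qed
  let ?C = "nrm (dual_space linf) \<Lambda>"
  obtain r :: nat where r: "?C < r * (\<delta> / 2)"
    using reals_Archimedean3[of "\<delta> / 2"] \<open>\<delta> > 0\<close> by auto
  have "r > 0"
    using r linf.dual_norm_nonneg[OF \<Lambda>] by (cases r) auto
  \<comment> \<open>With this bound for the overlaps the lower bound \<open>r * (\<delta> - r * \<eta>)\<close> becomes \<open>r * \<delta> / 2\<close>.\<close>
  define \<eta> where "\<eta> = \<delta> / (2 * r)"
  have \<eta>: "\<eta> > 0" using \<open>\<delta> > 0\<close> \<open>r > 0\<close> by (simp add: \<eta>_def)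
  have ex_n: "\<exists>n. \<forall>j<m. n j \<in> N \<and> (\<forall>i<j. total_variation \<Lambda> (B (n i) \<inter> B (n j)) \<le> \<eta>)" for m :: nat
  proof (induction m)
    case 0
    then show ?case by simp
  next
    case (Suc m)
    then obtain n where n: "\<And>j. j < m \<Longrightarrow> n j \<in> N"
      "\<And>i j. j < m \<Longrightarrow> i < j \<Longrightarrow> total_variation \<Lambda> (B (n i) \<inter> B (n j)) \<le> \<eta>" by blast
    have "finite (\<Union>i<m. {k\<in>N. \<eta> \<le> total_variation \<Lambda> (B (n i) \<inter> B k)})"
      using small n \<eta> by auto
    then obtain k where "k \<in> N" "k \<notin> (\<Union>i<m. {k\<in>N. \<eta> \<le> total_variation \<Lambda> (B (n i) \<inter> B k)})"
      using N by (meson finite_subset subsetI)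
    then show ?case
      using n by (intro exI[of _ "n(m := k)"]) (auto simp: less_Suc_eq not_le less_imp_le)
  qed
  obtain n where n: "\<And>j. j < r \<Longrightarrow> n j \<in> N"
    "\<And>i j. j < r \<Longrightarrow> i < j \<Longrightarrow> total_variation \<Lambda> (B (n i) \<inter> B (n j)) \<le> \<eta>"
    using ex_n[of r] by blast
  have "r * (\<delta> - r * \<eta>) \<le> total_variation \<Lambda> (\<Union>j<r. B (n j))"
    using n B \<eta> by (intro Bonferroni_total_variation[of r \<delta> "\<lambda>j. B (n j)"]) auto
  also have "\<dots> \<le> ?C" by (rule total_variation_bounded)
  finally show False using r \<open>r > 0\<close> by (simp add: \<eta>_def)
qed

text \<open>Iterating the previous lemma on the intersections found so far. The lower bounds for the masses
  may shrink from step to step, but each of them is positive, so no intersection is empty.\<close>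

lemma exists_subsequence_finite_intersections:
  fixes B :: "nat \<Rightarrow> 'i set"
  assumes "\<delta> > 0" "\<And>n. \<delta> \<le> total_variation \<Lambda> (B n)"
  shows "\<exists>n :: nat \<Rightarrow> nat. inj n \<and> (\<forall>m. (\<Inter>j\<le>m. B (n j)) \<noteq> {})"
proof -
  define good where "good s \<longleftrightarrow> infinite (fst s) \<and>
    (\<exists>\<delta>>0. \<forall>n\<in>fst s. \<delta> \<le> total_variation \<Lambda> (snd s \<inter> B n))" for s :: "nat set \<times> 'i set"
  define step where "step s m s' \<longleftrightarrow> m \<in> fst s \<and> fst s' \<subseteq> fst s \<and> m \<notin> fst s' \<and>
    snd s' = snd s \<inter> B m \<and> good s'" for s m s'
  have ex_step: "\<exists>m s'. step s m s'" if s_good: "good s" for s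
  proof -
    obtain N P where s: "s = (N, P)" by (cases s)
    obtain \<delta> where "infinite N" "\<delta> > 0" "\<And>n. n \<in> N \<Longrightarrow> \<delta> \<le> total_variation \<Lambda> (P \<inter> B n)"
      using s_good by (auto simp: good_def s)
    from exists_heavy_set[of N \<delta> "\<lambda>n. P \<inter> B n", OF this]
    obtain m N' \<delta>' where mN: "m \<in> N" "N' \<subseteq> N" "infinite N'" "m \<notin> N'" "\<delta>' > 0"
      "\<And>n. n \<in> N' \<Longrightarrow> \<delta>' \<le> total_variation \<Lambda> ((P \<inter> B m) \<inter> (P \<inter> B n))" by blast
    have "(P \<inter> B m) \<inter> (P \<inter> B n) = (P \<inter> B m) \<inter> B n" for n by auto
    then have "step s m (N', P \<inter> B m)"
      using mN by (auto simp: step_def good_def s)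
    then show ?thesis by blast
  qed
  \<comment> \<open>The first component of a state is the set of indices still available, the second one the intersection of the chosen sets.\<close>
  define next_state where "next_state s = (SOME s'. \<exists>m. step s m s')" for s
  define state where "state j = (next_state ^^ j) (UNIV, UNIV)" for j
  have "good (state j)" for j
  proof (induction j)
    case 0
    then show ?case using assms by (auto simp: state_def good_def)
  next
    case (Suc j)
    then obtain m s' where "step (state j) m s'" using ex_step by blast
    then have "\<exists>m. step (state j) m (next_state (state j))"
      unfolding next_state_def by (intro someI[of "\<lambda>s'. \<exists>m. step (state j) m s'"] exI)
    then show ?case by (auto simp: state_def step_def)
  qed
  then have "\<exists>m. step (state j) m (state (Suc j))" for j
    using ex_step[of "state j"] someI_ex[of "\<lambda>s'. \<exists>m. step (state j) m s'"]
    by (auto simp: state_def next_state_def)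
  then obtain n where n: "\<And>j. step (state j) (n j) (state (Suc j))" by metis
  have dec: "fst (state (j + d)) \<subseteq> fst (state j)" for j d
  proof (induction d)
    case (Suc d)
    then show ?case using n[of "j + d"] by (auto simp: step_def)
  qed simp
  have n_in: "n j \<in> fst (state j)" and n_out: "n j \<notin> fst (state (Suc j))" for j
    using n[of j] by (auto simp: step_def)
  have "n i \<noteq> n j" if "i < j" for i j
    using n_in[of j] n_out[of i] dec[of "Suc i" "j - Suc i"] that by auto
  then have "inj n" by (metis injI linorder_neqE_nat)
  moreover have "(\<Inter>j\<le>m. B (n j)) \<noteq> {}" for m
  proof
    have P: "snd (state (Suc m)) = (\<Inter>j\<le>m. B (n j))" for m
    proof (induction m)
      case 0
      show ?case using n[of 0] by (auto simp: step_def state_def)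
    next
      case (Suc m)
      have "snd (state (Suc (Suc m))) = snd (state (Suc m)) \<inter> B (n (Suc m))"
        using n[of "Suc m"] by (auto simp: step_def)
      then show ?case using Suc by (auto simp: atMost_Suc)
    qed
    assume empty: "(\<Inter>j\<le>m. B (n j)) = {}"
    have "good (state (Suc m))" using \<open>\<And>j. good (state j)\<close> .
    then obtain \<delta> k where "\<delta> > 0" "\<delta> \<le> total_variation \<Lambda> ({} \<inter> B k)"
      using P[of m] empty unfolding good_def by (metis ex_in_conv finite.emptyI)
    then show False by (simp add: total_variation_empty)
  qed
  ultimately show ?thesis by blast
qed

text \<open>The elementary substitute for weak compactness. If \<open>\<Lambda> (x k)\<close> is not small for infinitely many
  \<open>k\<close>, then neither is the mass of \<open>{i. \<eta> \<le> \<bar>x k i\<bar>}\<close>, and infinitely many of these sets have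
  the finite intersection property.\<close>

theorem exists_uniformly_large_values:
  fixes x :: "'s \<Rightarrow> 'i \<Rightarrow> complex"
  assumes bound: "\<And>k i. cmod (x k i) \<le> K"
    and not_c0: "(\<lambda>k. \<Lambda> (x k)) \<notin> c0"
  shows "\<exists>\<eta>>0. \<exists>k :: nat \<Rightarrow> 's. \<exists>i :: nat \<Rightarrow> 'i. inj k \<and> (\<forall>m. \<forall>j\<le>m. \<eta> \<le> cmod (x (k j) (i m)))"
proof -
  obtain \<epsilon> where \<epsilon>: "\<epsilon> > 0" "infinite {k. \<epsilon> \<le> cmod (\<Lambda> (x k))}"
    using not_c0 unfolding c0_def by blast
  obtain k :: "nat \<Rightarrow> 's" where k: "inj k" "range k \<subseteq> {k. \<epsilon> \<le> cmod (\<Lambda> (x k))}"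
    using infinite_countable_subset[OF \<epsilon>(2)] by blast
  have x: "x k \<in> carr linf" for k using bound by (auto intro: linfI)
  define C where "C = nrm (dual_space linf) \<Lambda> + 1"
  have C: "C > 0" "nrm (dual_space linf) \<Lambda> \<le> C"
    using linf.dual_norm_nonneg[OF \<Lambda>] by (auto simp: C_def)
  \<comment> \<open>The values of \<open>x k\<close> below \<open>\<eta>\<close> contribute at most \<open>\<epsilon> / 2\<close> to \<open>\<Lambda> (x k)\<close>.\<close>
  define \<eta> where "\<eta> = \<epsilon> / (2 * C)"
  have \<eta>: "\<eta> > 0" using \<epsilon> C by (simp add: \<eta>_def)
  define K' where "K' = \<bar>K\<bar> + 1"
  have K': "K' > 0" "\<And>k i. cmod (x k i) \<le> K'"
    using order_trans[OF bound, of "K'"] by (auto simp: K'_def)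
  define B where "B n = {i. \<eta> \<le> cmod (x (k n) i)}" for n
  have "\<epsilon> / (2 * K') \<le> total_variation \<Lambda> (B n)" for n
  proof -
    define u where "u i = (if i \<in> B n then x (k n) i else 0)" for i
    define v where "v i = (if i \<in> B n then 0 else x (k n) i)" for i
    have u: "u \<in> carr linf"
      using K'(2)[of "k n"] K'(1) by (intro linfI[of _ K']) (auto simp: u_def)
    have v_le: "cmod (v i) \<le> \<eta>" for i using \<eta> by (auto simp: v_def B_def)
    have v: "v \<in> carr linf" "nrm linf v \<le> \<eta>" using v_le by (auto intro: linfI linf_norm_le)
    have "cmod (\<Lambda> v) \<le> C * \<eta>"
      using linf.functional_le[OF \<Lambda> v(1)] mult_mono[OF C(2) v(2)] C(1) linf_norm_nonneg[OF v(1)] by simp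
    also have "\<dots> = \<epsilon> / 2" using C by (simp add: \<eta>_def)
    finally have v_small: "cmod (\<Lambda> v) \<le> \<epsilon> / 2" .
    have "x (k n) = (\<lambda>i. u i + v i)" by (auto simp: u_def v_def)
    then have "\<Lambda> (x (k n)) = \<Lambda> u + \<Lambda> v"
      using linf.functional_add[OF \<Lambda> u v(1)] by (simp add: linf_simps)
    moreover have "\<epsilon> \<le> cmod (\<Lambda> (x (k n)))" using k(2) by auto
    ultimately have u_large: "\<epsilon> / 2 \<le> cmod (\<Lambda> u)"
      using v_small norm_triangle_ineq[of "\<Lambda> u" "\<Lambda> v"] by simp
    have "cmod (of_real (1 / K') * u i) \<le> indicator (B n) i" for i
      using K'(1) K'(2)[of "k n" i] by (auto simp: u_def norm_mult norm_divide)
    from le_total_variation[OF this]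
    have "cmod (\<Lambda> u) / K' \<le> total_variation \<Lambda> (B n)"
      using K'(1) linf.functional_scl[OF \<Lambda> u, of "of_real (1 / K')"]
      by (simp add: linf_simps norm_mult norm_divide)
    moreover have "\<epsilon> / (2 * K') \<le> cmod (\<Lambda> u) / K'"
      using u_large K'(1) by (simp add: field_simps)
    ultimately show ?thesis by linarith
  qed
  then obtain n :: "nat \<Rightarrow> nat" where n: "inj n" "\<And>m. (\<Inter>j\<le>m. B (n j)) \<noteq> {}"
    using exists_subsequence_finite_intersections[of "\<epsilon> / (2 * K')" B] \<epsilon>(1) K'(1) by auto
  then have "\<forall>m. \<exists>i. i \<in> (\<Inter>j\<le>m. B (n j))" by blast
  then obtain i where "\<And>m. i m \<in> (\<Inter>j\<le>m. B (n j))" by metis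
  then have "\<forall>m. \<forall>j\<le>m. \<eta> \<le> cmod (x (k (n j)) (i m))" by (auto simp: B_def)
  moreover have "inj (k \<circ> n)" using k(1) n(1) by (rule inj_compose)
  ultimately show ?thesis using \<eta> by (intro exI[of _ \<eta>] conjI exI[of _ "k \<circ> n"] exI[of _ i]) auto
qed

end

section \<open>Subsequences\<close>

lemma constant_or_injective_subsequence:
  fixes f :: "nat \<Rightarrow> 'b"
  obtains r :: "nat \<Rightarrow> nat" where "strict_mono r" "(\<exists>c. \<forall>n. f (r n) = c) \<or> inj (f \<circ> r)"
proof (cases "\<exists>c. infinite {n. f n = c}")
  case True
  then obtain c where c: "infinite {n. f n = c}" by blast
  then show ?thesis
    using that[of "enumerate {n. f n = c}"] strict_mono_enumerate[OF c] enumerate_in_set[OF c] by auto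
next
  case False
  have "\<exists>n>m. \<forall>i\<le>m. f n \<noteq> f i" for m
  proof -
    have "finite (\<Union>i\<le>m. {n. f n = f i})" using False by auto
    then have "finite ((\<Union>i\<le>m. {n. f n = f i}) \<union> {..m})" by simp
    from ex_new_if_finite[OF infinite_UNIV_nat this]
    obtain n where "n \<notin> (\<Union>i\<le>m. {n. f n = f i}) \<union> {..m}" by blast
    then show ?thesis by (intro exI[of _ n]) auto
  qed
  then obtain nxt where nxt: "\<And>m. nxt m > m" "\<And>m i. i \<le> m \<Longrightarrow> f (nxt m) \<noteq> f i" by metis
  define r where "r j = (nxt ^^ j) 0" for j
  have r: "strict_mono r" using nxt(1) by (intro strict_mono_Suc_iff[THEN iffD2]) (simp add: r_def)
  have "f (r i) \<noteq> f (r j)" if ij: "i < j" for i j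
  proof -
    obtain d where d: "j = Suc d" using ij by (cases j) auto
    then have "r i \<le> r d" using ij r by (simp add: strict_mono_less_eq)
    then show ?thesis using nxt(2)[of "r i" "r d"] by (simp add: d r_def)
  qed
  then have "inj (f \<circ> r)" by (metis comp_apply injI linorder_neqE_nat)
  then show ?thesis using that r by blast
qed

lemma repeated_limit_subsequences:
  fixes u :: "nat \<Rightarrow> nat \<Rightarrow> 'b::{real_normed_vector,heine_borel}"
  assumes bound: "\<And>n m. norm (u n m) \<le> K"
  obtains p q :: "nat \<Rightarrow> nat" and L where "strict_mono p" "strict_mono q" "repeated_limit (\<lambda>n m. u (p n) (q m)) L"
proof -
  obtain q where q: "strict_mono q" "\<And>n. \<exists>l. (\<lambda>m. u n (q m)) \<longlonglongrightarrow> l"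
    using function_convergent_subsequence[of "UNIV :: nat set" "\<lambda>m n. u n m" K] bound by auto
  then obtain l where l: "\<And>n. (\<lambda>m. u n (q m)) \<longlonglongrightarrow> l n" by metis
  have "norm (l n) \<le> K" for n
    using bound by (intro Lim_bounded[OF tendsto_norm[OF l]]) auto
  then have "bounded (range l)" by (auto simp: bounded_iff)
  then obtain L p where "strict_mono p" "(l \<circ> p) \<longlonglongrightarrow> L"
    using bounded_imp_convergent_subsequence by blast
  then have "repeated_limit (\<lambda>n m. u (p n) (q m)) L"
    unfolding repeated_limit_def using l by (intro exI[of _ "l \<circ> p"]) simp
  then show ?thesis using that \<open>strict_mono p\<close> q(1) by blast
qed


section \<open>Weak* topologies\<close>

lemma topspace_weak_star: "topspace (weak_star E Es) = carr E"
  by (auto simp: weak_star_def topspace_pullback_topology)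

lemma continuous_map_weak_star_functional:
  assumes "\<phi> \<in> Es" shows "continuous_map (weak_star E Es) euclidean \<phi>"
proof -
  have "continuous_map (product_topology (\<lambda>_. euclidean) Es) euclidean (\<lambda>v. v \<phi>)"
    using continuous_map_product_projection[OF assms, of "\<lambda>_. euclidean"] by simp
  then have "continuous_map (weak_star E Es) euclidean ((\<lambda>v. v \<phi>) \<circ> (\<lambda>x. \<lambda>\<phi>\<in>Es. \<phi> x))"
    unfolding weak_star_def by (rule continuous_map_pullback)
  then show ?thesis by (simp add: o_def assms)
qed

lemma continuous_map_into_weak_star:
  assumes "\<And>x. x \<in> topspace T \<Longrightarrow> B x \<in> carr E"
    and "\<And>\<phi>. \<phi> \<in> Es \<Longrightarrow> continuous_map T euclidean (\<lambda>x. \<phi> (B x))"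
  shows "continuous_map T (weak_star E Es) B"
  unfolding weak_star_def
proof (rule continuous_map_pullback')
  show "continuous_map T (product_topology (\<lambda>_. euclidean) Es) ((\<lambda>x. \<lambda>\<phi>\<in>Es. \<phi> x) \<circ> B)"
    using assms(2) by (auto simp: continuous_map_componentwise)
  show "topspace T \<subseteq> B -` carr E" using assms(1) by auto
qed

lemma limitin_weak_star:
  assumes "\<And>n. X n \<in> carr E" "x \<in> carr E"
    and "\<And>\<phi>. \<phi> \<in> Es \<Longrightarrow> (\<lambda>n. \<phi> (X n)) \<longlonglongrightarrow> \<phi> x"
  shows "limitin (weak_star E Es) X x sequentially"
  unfolding limitin_def
proof (intro conjI allI impI)
  show "x \<in> topspace (weak_star E Es)" using assms(2) by (simp add: topspace_weak_star)
  fix U assume U: "openin (weak_star E Es) U \<and> x \<in> U"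
  then obtain V where V: "openin (product_topology (\<lambda>_. euclidean) Es) V"
    "U = (\<lambda>x. \<lambda>\<phi>\<in>Es. \<phi> x) -` V \<inter> carr E"
    by (auto simp: weak_star_def openin_pullback_topology)
  have "limitin (product_topology (\<lambda>_. euclidean) Es) (\<lambda>n. \<lambda>\<phi>\<in>Es. \<phi> (X n)) (\<lambda>\<phi>\<in>Es. \<phi> x) sequentially"
    using assms(3) by (auto simp: limitin_componentwise)
  then have "\<forall>\<^sub>F n in sequentially. (\<lambda>\<phi>\<in>Es. \<phi> (X n)) \<in> V"
    using U V by (auto simp: limitin_def)
  then show "\<forall>\<^sub>F n in sequentially. X n \<in> U"
    by (rule eventually_mono) (use assms(1) V in auto)
qed


section \<open>Functions vanishing at infinity\<close>

lemma c0_finite: "f \<in> c0 \<Longrightarrow> \<epsilon> > 0 \<Longrightarrow> finite {i. \<epsilon> \<le> cmod (f i)}"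
  by (simp add: c0_def)

lemma c0_subset_linf: "c0 \<subseteq> carr linf"
proof
  fix f :: "'a \<Rightarrow> complex" assume "f \<in> c0"
  then have fin: "finite {i. 1 \<le> cmod (f i)}" using c0_finite by force
  show "f \<in> carr linf"
  proof (rule linfI)
    fix i
    show "cmod (f i) \<le> Max (insert 1 ((\<lambda>i. cmod (f i)) ` {i. 1 \<le> cmod (f i)}))"
    proof (cases "1 \<le> cmod (f i)")
      case True
      then show ?thesis using fin by (intro Max_ge) auto
    next
      case False
      have "1 \<le> Max (insert 1 ((\<lambda>i. cmod (f i)) ` {i. 1 \<le> cmod (f i)}))"
        using fin by (intro Max_ge) auto
      then show ?thesis using False by simp
    qed
  qed
qed

lemma c0_uniform_limit:
  assumes "\<And>\<epsilon>. \<epsilon> > 0 \<Longrightarrow> \<exists>g\<in>c0. \<forall>i. cmod (f i - g i) \<le> \<epsilon>"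
  shows "f \<in> c0"
  unfolding c0_def
proof (intro CollectI allI impI)
  fix \<epsilon> :: real assume "\<epsilon> > 0"
  then obtain g where g: "g \<in> c0" "\<And>i. cmod (f i - g i) \<le> \<epsilon>/2" using assms[of "\<epsilon>/2"] by auto
  have "\<epsilon>/2 \<le> cmod (g i)" if "\<epsilon> \<le> cmod (f i)" for i
    using g(2)[of i] that norm_triangle_sub[of "f i" "g i"] by simp
  then have "{i. \<epsilon> \<le> cmod (f i)} \<subseteq> {i. \<epsilon>/2 \<le> cmod (g i)}" by auto
  then show "finite {i. \<epsilon> \<le> cmod (f i)}"
    using c0_finite[OF g(1), of "\<epsilon>/2"] \<open>\<epsilon> > 0\<close> finite_subset by auto
qed

lemma c0_comp:
  assumes f: "f \<in> c0" and fibres: "\<And>u. finite {k. \<sigma> k = u}"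
    and le: "\<And>k. cmod (g k) \<le> cmod (f (\<sigma> k))"
  shows "g \<in> c0"
  unfolding c0_def
proof (intro CollectI allI impI)
  fix \<epsilon> :: real assume "\<epsilon> > 0"
  have "{k. \<epsilon> \<le> cmod (g k)} \<subseteq> (\<Union>u\<in>{i. \<epsilon> \<le> cmod (f i)}. {k. \<sigma> k = u})"
    using le order_trans by fastforce
  moreover have "finite \<dots>" using c0_finite[OF f \<open>\<epsilon> > 0\<close>] fibres by blast
  ultimately show "finite {k. \<epsilon> \<le> cmod (g k)}" by (rule finite_subset)
qed

lemma c0_add:
  assumes "f \<in> c0" "g \<in> c0" shows "(\<lambda>i. f i + g i) \<in> c0"
  unfolding c0_def
proof (intro CollectI allI impI)
  fix \<epsilon> :: real assume "\<epsilon> > 0"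
  have "{i. \<epsilon> \<le> cmod (f i + g i)} \<subseteq> {i. \<epsilon>/2 \<le> cmod (f i)} \<union> {i. \<epsilon>/2 \<le> cmod (g i)}"
  proof
    fix i assume "i \<in> {i. \<epsilon> \<le> cmod (f i + g i)}"
    then show "i \<in> {i. \<epsilon>/2 \<le> cmod (f i)} \<union> {i. \<epsilon>/2 \<le> cmod (g i)}"
      using norm_triangle_ineq[of "f i" "g i"] by auto
  qed
  then show "finite {i. \<epsilon> \<le> cmod (f i + g i)}"
    using c0_finite[OF assms(1), of "\<epsilon>/2"] c0_finite[OF assms(2), of "\<epsilon>/2"] \<open>\<epsilon> > 0\<close>
    by (meson finite_UnI finite_subset half_gt_zero)
qed

lemma c0_scl:
  assumes "f \<in> c0" shows "(\<lambda>i. c * f i) \<in> c0"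
proof (cases "c = 0")
  case True
  then show ?thesis by (simp add: c0_def)
next
  case False
  show ?thesis
    unfolding c0_def
  proof (intro CollectI allI impI)
    fix \<epsilon> :: real assume "\<epsilon> > 0"
    have "{i. \<epsilon> \<le> cmod (c * f i)} = {i. \<epsilon> / cmod c \<le> cmod (f i)}"
      using False by (auto simp: norm_mult field_simps)
    then show "finite {i. \<epsilon> \<le> cmod (c * f i)}"
      using c0_finite[OF assms, of "\<epsilon> / cmod c"] False \<open>\<epsilon> > 0\<close> by simp
  qed
qed

lemma c0_inj_tendsto:
  assumes "f \<in> c0" "inj k" shows "(\<lambda>n. f (k n)) \<longlonglongrightarrow> 0"
proof (rule LIMSEQ_I)
  fix r :: real assume "r > 0"
  have "finite (k -` {i. r \<le> cmod (f i)})"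
    using c0_finite[OF assms(1) \<open>r > 0\<close>] assms(2) by (rule finite_vimageI)
  then obtain N where "\<And>n. n \<in> k -` {i. r \<le> cmod (f i)} \<Longrightarrow> n < N"
    using finite_nat_set_iff_bounded by metis
  then show "\<exists>no. \<forall>n\<ge>no. norm (f (k n) - 0) < r"
    by (intro exI[of _ N]) (auto simp: not_le[symmetric])
qed

text \<open>Vanishing at infinity can be tested on injective sequences, which is the form in which weak*
  continuity provides it.\<close>

lemma c0_if_tendsto:
  assumes "\<And>k. inj k \<Longrightarrow> (\<lambda>n. f (k n)) \<longlonglongrightarrow> 0" shows "f \<in> c0"
  unfolding c0_def
proof (intro CollectI allI impI)
  fix \<epsilon> :: real assume "\<epsilon> > 0"
  show "finite {i. \<epsilon> \<le> cmod (f i)}"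
  proof (rule ccontr)
    assume "infinite {i. \<epsilon> \<le> cmod (f i)}"
    from infinite_countable_subset[OF this]
    obtain k :: "nat \<Rightarrow> 'a" where k: "inj k" "range k \<subseteq> {i. \<epsilon> \<le> cmod (f i)}" by blast
    obtain N where "\<And>n. n \<ge> N \<Longrightarrow> norm (f (k n) - 0) < \<epsilon>"
      using LIMSEQ_D[OF assms[OF k(1)] \<open>\<epsilon> > 0\<close>] by blast
    then have "cmod (f (k N)) < \<epsilon>" by simp
    moreover have "k N \<in> {i. \<epsilon> \<le> cmod (f i)}" using k(2) by blast
    ultimately show False by simp
  qed
qed


section \<open>Absolutely summable functions\<close>

abbreviation ell1 :: "('s \<Rightarrow> complex) \<Rightarrow> bool" where
  "ell1 a \<equiv> (\<lambda>s. cmod (a s)) summable_on UNIV"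

abbreviation norm1 :: "('s \<Rightarrow> complex) \<Rightarrow> real" where
  "norm1 a \<equiv> \<Sum>\<^sub>\<infinity>s. cmod (a s)"

lemma beurling_simps:
  "carr (beurling \<omega>) = {a. ell1 a}" "zer (beurling \<omega>) = (\<lambda>_. 0)"
  "add (beurling \<omega>) a b = (\<lambda>s. a s + b s)" "scl (beurling \<omega>) c a = (\<lambda>s. c * a s)"
  "nrm (beurling \<omega>) a = norm1 a"
  by (simp_all add: beurling_def)

lemma ell1_comparison: "ell1 a \<Longrightarrow> (\<And>s. cmod (b s) \<le> cmod (a s)) \<Longrightarrow> ell1 b"
  by (rule Infinite_Sum.abs_summable_on_comparison_test)

lemma ell1_scl: "ell1 a \<Longrightarrow> ell1 (\<lambda>s. c * a s)"
  by (simp add: norm_mult summable_on_cmult_right)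

lemma ell1_finite_support: "finite F \<Longrightarrow> (\<And>s. s \<notin> F \<Longrightarrow> a s = 0) \<Longrightarrow> ell1 a"
  by (rule finite_nonzero_values_imp_summable_on) (rule finite_subset[of _ F], auto)

lemma ell1_delta: "ell1 (delta g)"
  by (rule ell1_finite_support[of "{g}"]) (auto simp: delta_def)

lemma norm1_nonneg: "0 \<le> norm1 a"
  by (simp add: infsum_nonneg)

lemma norm1_delta: "norm1 (delta g) = 1"
proof -
  have "norm1 (delta g) = (\<Sum>\<^sub>\<infinity>s\<in>{g}. cmod (delta g s))"
    by (rule infsum_cong_neutral) (auto simp: delta_def)
  then show ?thesis by (simp add: delta_def)
qed

lemma pairing_abs_summable:
  assumes "ell1 a" "f \<in> carr linf" shows "(\<lambda>s. norm (a s * f s)) summable_on UNIV"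
proof -
  have "ell1 (\<lambda>s. of_real (nrm linf f) * a s)" by (rule ell1_scl[OF assms(1)])
  then show ?thesis
    by (rule ell1_comparison)
      (use linf_le[OF assms(2)] linf_norm_nonneg[OF assms(2)] in
        \<open>simp add: norm_mult mult.commute[of "cmod (a _)"] mult_right_mono\<close>)
qed

lemma pairing_summable: "ell1 a \<Longrightarrow> f \<in> carr linf \<Longrightarrow> (\<lambda>s. a s * f s) summable_on UNIV"
  by (rule Infinite_Sum.abs_summable_summable[OF pairing_abs_summable])

lemma pairing_le:
  assumes a: "ell1 a" and K: "\<And>s. cmod (f s) \<le> K"
  shows "cmod (pairing a f) \<le> norm1 a * K"
proof -
  have "cmod (pairing a f) \<le> (\<Sum>\<^sub>\<infinity>s. cmod (a s * f s))"
    unfolding pairing_def using K by (intro norm_infsum_bound pairing_abs_summable a) (auto intro: linfI)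
  also have "\<dots> \<le> (\<Sum>\<^sub>\<infinity>s. cmod (a s) * K)"
    using pairing_abs_summable[OF a linfI[of f, OF K]] K
    by (intro infsum_mono summable_on_cmult_left a) (auto simp: norm_mult intro: mult_left_mono)
  also have "\<dots> = norm1 a * K" by (rule infsum_cmult_left) (use a in auto)
  finally show ?thesis .
qed

lemma pairing_delta: "pairing (delta g) f = f g"
proof -
  have "pairing (delta g) f = (\<Sum>\<^sub>\<infinity>s\<in>{g}. delta g s * f s)"
    unfolding pairing_def by (rule infsum_cong_neutral) (auto simp: delta_def)
  then show ?thesis by (simp add: delta_def)
qed

lemma pairing_add_left:
  "\<lbrakk>ell1 a; ell1 b; f \<in> carr linf\<rbrakk> \<Longrightarrow> pairing (\<lambda>s. a s + b s) f = pairing a f + pairing b f"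
  by (simp add: pairing_def distrib_right infsum_add pairing_summable)

lemma pairing_scl_left: "pairing (\<lambda>s. c * a s) f = c * pairing a f"
  by (simp add: pairing_def mult.assoc infsum_cmult_right')

lemma pairing_add_right:
  "\<lbrakk>ell1 a; f \<in> carr linf; g \<in> carr linf\<rbrakk> \<Longrightarrow> pairing a (\<lambda>s. f s + g s) = pairing a f + pairing a g"
  by (simp add: pairing_def distrib_left infsum_add pairing_summable)

lemma pairing_scl_right: "pairing a (\<lambda>s. c * f s) = c * pairing a f"
  by (simp add: pairing_def mult.left_commute infsum_cmult_right')

text \<open>Finitely supported functions are dense in \<open>\<ell>\<^sup>1\<close>, so a bounded functional is determined by its
  values at the point masses.\<close>

lemma pairing_functional:
  assumes add: "\<And>a b. \<lbrakk>ell1 a; ell1 b\<rbrakk> \<Longrightarrow> \<theta> (\<lambda>s. a s + b s) = \<theta> a + \<theta> b"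
    and scl: "\<And>c a. ell1 a \<Longrightarrow> \<theta> (\<lambda>s. c * a s) = c * \<theta> a"
    and bound: "\<And>a. ell1 a \<Longrightarrow> cmod (\<theta> a) \<le> K * norm1 a"
    and a: "ell1 a"
  shows "\<theta> a = pairing a (\<lambda>s. \<theta> (delta s))"
proof -
  have zero: "\<theta> (\<lambda>s. 0) = 0" using scl[of "\<lambda>s. 0" 0] by simp
  have fin: "\<theta> (\<lambda>s. if s \<in> F then a s else 0) = (\<Sum>s\<in>F. a s * \<theta> (delta s))" if "finite F" for F
    using that
  proof (induction F rule: finite_induct)
    case empty
    then show ?case using zero by simp
  next
    case (insert g F)
    have "(\<lambda>s. if s \<in> insert g F then a s else 0)
        = (\<lambda>s. a g * delta g s + (if s \<in> F then a s else 0))"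
      using insert.hyps by (auto simp: delta_def indicator_def fun_eq_iff)
    moreover have "ell1 (\<lambda>s. if s \<in> F then a s else 0)"
      by (rule ell1_comparison[OF a]) auto
    ultimately show ?case
      using insert add[OF ell1_scl[OF ell1_delta]] scl[OF ell1_delta] by simp
  qed
  have lim: "((\<lambda>F. K * (norm1 a - (\<Sum>s\<in>F. cmod (a s)))) \<longlongrightarrow> 0) (finite_subsets_at_top UNIV)"
    by (rule tendsto_eq_intros infsum_tendsto[OF a] refl)+ simp
  have "((\<lambda>s. a s * \<theta> (delta s)) has_sum \<theta> a) UNIV"
    unfolding has_sum_def
  proof (rule LIM_zero_cancel[OF Lim_null_comparison[OF _ lim]])
    show "\<forall>\<^sub>F F in finite_subsets_at_top UNIV.
        norm ((\<Sum>s\<in>F. a s * \<theta> (delta s)) - \<theta> a) \<le> K * (norm1 a - (\<Sum>s\<in>F. cmod (a s)))"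
    proof (rule eventually_finite_subsets_at_top_weakI)
      fix F :: "'a set" assume F: "finite F"
      let ?b = "\<lambda>s. if s \<in> F then a s else 0" and ?c = "\<lambda>s. if s \<in> F then 0 else a s"
      have b: "ell1 ?b" and c: "ell1 ?c" by (rule ell1_comparison[OF a]; simp)+
      have "(\<lambda>s. ?b s + ?c s) = a" by (simp add: fun_eq_iff)
      then have "\<theta> a = \<theta> ?b + \<theta> ?c" using add[OF b c] by simp
      then have "norm ((\<Sum>s\<in>F. a s * \<theta> (delta s)) - \<theta> a) \<le> K * norm1 ?c"
        using bound[OF c] fin[OF F] by simp
      moreover have "norm1 a = norm1 ?b + norm1 ?c"
        by (subst infsum_add[OF b c, symmetric]) (rule infsum_cong, simp)
      moreover have "norm1 ?b = (\<Sum>s\<in>F. cmod (a s))"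
      proof -
        have "norm1 ?b = (\<Sum>\<^sub>\<infinity>s\<in>F. cmod (a s))" by (rule infsum_cong_neutral) auto
        then show ?thesis using F by simp
      qed
      ultimately show "norm ((\<Sum>s\<in>F. a s * \<theta> (delta s)) - \<theta> a) \<le> K * (norm1 a - (\<Sum>s\<in>F. cmod (a s)))"
        by simp
    qed
  qed
  then show ?thesis by (simp add: pairing_def infsumI)
qed

lemma tensor_abs_summable:
  assumes "ell1 a" "ell1 b"
  shows "(\<lambda>x. norm (case x of (g, h) \<Rightarrow> a g * b h)) summable_on UNIV \<times> UNIV"
  unfolding Infinite_Sum.abs_summable_on_Sigma_iff
  using assms by (auto simp: norm_mult summable_on_cmult_right infsum_cmult_right' infsum_nonneg
      summable_on_cmult_left)

lemma tensor_weighted_abs_summable: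
  assumes "ell1 a" "ell1 b" "\<And>g h. cmod (c g h) \<le> K"
  shows "(\<lambda>x. norm (case x of (g, h) \<Rightarrow> a g * b h * c g h)) summable_on UNIV \<times> UNIV"
proof -
  have "(\<lambda>x. norm (case x of (g, h) \<Rightarrow> (of_real K * a g) * b h)) summable_on UNIV \<times> UNIV"
    by (intro tensor_abs_summable ell1_scl assms)
  moreover have "0 \<le> K" using assms(3) norm_ge_zero order_trans by blast
  moreover have "cmod (a g) * cmod (b h) * cmod (c g h) \<le> K * cmod (a g) * cmod (b h)" for g h
    using mult_left_mono[OF assms(3), of "cmod (a g) * cmod (b h)"] by (simp add: mult_ac)
  ultimately show ?thesis
    by (elim Infinite_Sum.abs_summable_on_comparison_test) (auto simp: norm_mult)
qed

lemma pairing_pairing: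
  assumes "ell1 a" "ell1 b" "\<And>g h. cmod (c g h) \<le> K"
  shows "pairing a (\<lambda>g. pairing b (c g)) = (\<Sum>\<^sub>\<infinity>(g, h)\<in>UNIV\<times>UNIV. a g * b h * c g h)"
proof -
  have "(\<lambda>(g, h). a g * b h * c g h) summable_on UNIV \<times> UNIV"
    using tensor_weighted_abs_summable[OF assms] by (rule abs_summable_summable)
  from infsum_Sigma'_banach[OF this] show ?thesis
    by (simp add: pairing_def mult.assoc infsum_cmult_right')
qed

lemma pairing_swap:
  assumes "ell1 a" "ell1 b" "\<And>g h. cmod (c g h) \<le> K"
  shows "pairing a (\<lambda>g. pairing b (\<lambda>h. c g h)) = pairing b (\<lambda>h. pairing a (\<lambda>g. c g h))"
proof -
  have "(\<lambda>(g, h). a g * b h * c g h) summable_on UNIV \<times> UNIV"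
    using tensor_weighted_abs_summable[OF assms] by (rule abs_summable_summable)
  from infsum_swap_banach[OF this] have
    "(\<Sum>\<^sub>\<infinity>g. \<Sum>\<^sub>\<infinity>h. a g * (b h * c g h)) = (\<Sum>\<^sub>\<infinity>h. \<Sum>\<^sub>\<infinity>g. b h * (a g * c g h))"
    by (simp add: mult_ac)
  then show ?thesis by (simp only: pairing_def infsum_cmult_right')
qed


section \<open>Beurling algebras\<close>

locale weighted_weakly_cancellative_semigroup =
  fixes \<omega> :: "'s::semigroup_mult \<Rightarrow> real"
  assumes weight: "weight \<omega>"
    and left_fibres: "finite {t :: 's. s * t = u}"
    and right_fibres: "finite {t :: 's. t * s = u}"
begin

abbreviation \<Omega> :: "'s \<Rightarrow> 's \<Rightarrow> complex" where
  "\<Omega> g h \<equiv> complex_of_real (Omega \<omega> g h)"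

abbreviation conv (infixl "\<star>" 70) where
  "a \<star> b \<equiv> mul (beurling \<omega>) a b"

lemma weight_pos: "0 < \<omega> g"
  using weight unfolding weight_def by (meson less_le_trans zero_less_one)

lemma Omega_nonneg: "0 \<le> Omega \<omega> g h"
  by (simp add: Omega_def less_imp_le weight_pos)

lemma Omega_le_one: "Omega \<omega> g h \<le> 1"
  using weight weight_pos by (simp add: Omega_def weight_def)

lemma norm_Omega: "cmod (\<Omega> g h) \<le> 1"
  using Omega_nonneg Omega_le_one by simp

lemma norm_Omega_mult: "cmod z \<le> K \<Longrightarrow> cmod (z * \<Omega> g h) \<le> K"
  using mult_mono[OF _ norm_Omega, of "cmod z" K g h] order_trans[OF norm_ge_zero, of z K]
  by (simp add: norm_mult)

lemma Omega_cocycle: "\<Omega> g h * \<Omega> (g * h) k = \<Omega> g (h * k) * \<Omega> h k"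
proof -
  have "Omega \<omega> g h * Omega \<omega> (g * h) k = Omega \<omega> g (h * k) * Omega \<omega> h k"
    using weight_pos[of g] weight_pos[of h] weight_pos[of k] weight_pos[of "g * h"] weight_pos[of "h * k"]
    by (simp add: Omega_def mult.assoc field_simps)
  then show ?thesis by (metis of_real_mult)
qed

text \<open>The convolution product is defined by sums over the fibres of the multiplication; this bijection
  turns the sum over all fibres into a sum over all pairs.\<close>

lemma bij_fibres:
  "bij_betw (\<lambda>p. (fst p * snd p, p)) (UNIV \<times> UNIV) (Sigma UNIV (\<lambda>s. {(g, h :: 's). g * h = s}))"
  by (auto simp: bij_betw_def inj_on_def image_def)

lemma
  assumes a: "ell1 a" and b: "ell1 b"
  shows ell1_conv: "ell1 (a \<star> b)"
    and pairing_conv: "f \<in> carr linf \<Longrightarrow>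
      pairing (a \<star> b) f = pairing a (\<lambda>g. pairing b (\<lambda>h. f (g * h) * \<Omega> g h))"
proof -
  define fib where "fib = (\<lambda>s. {(g, h :: 's). g * h = s})"
  define c where "c = (\<lambda>p. a (fst p) * b (snd p) * \<Omega> (fst p) (snd p))"
  have conv: "(a \<star> b) s = infsum c (fib s)" for s
    by (simp add: beurling_def fib_def c_def case_prod_unfold)
  have c_summable: "(\<lambda>x. norm (c (snd x))) summable_on Sigma UNIV fib"
  proof -
    have "(\<lambda>p. norm (c p)) summable_on UNIV \<times> UNIV"
      using tensor_weighted_abs_summable[OF a b norm_Omega] by (simp add: c_def case_prod_unfold)
    then show ?thesis
      using summable_on_reindex_bij_betw[OF bij_fibres, of "\<lambda>x. norm (c (snd x))"]
      by (simp add: fib_def)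
  qed
  then have abs: "(\<lambda>p. norm (c p)) summable_on fib s"
      "(\<lambda>s. norm (infsum (\<lambda>p. norm (c p)) (fib s))) summable_on UNIV" for s
    using Infinite_Sum.abs_summable_on_Sigma_iff[of "\<lambda>x. c (snd x)" UNIV fib] by simp_all
  show "ell1 (a \<star> b)"
    by (rule Infinite_Sum.abs_summable_on_comparison_test[OF abs(2)])
      (use norm_infsum_bound[OF abs(1)] in \<open>simp add: conv infsum_nonneg\<close>)
  assume f: "f \<in> carr linf"
  have "(\<lambda>x. norm (of_real (nrm linf f) * c (snd x))) summable_on Sigma UNIV fib"
    using c_summable by (simp add: norm_mult summable_on_cmult_right)
  then have "(\<lambda>x. norm (f (fst x) * c (snd x))) summable_on Sigma UNIV fib"
    by (rule Infinite_Sum.abs_summable_on_comparison_test)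
      (use linf_le[OF f] linf_norm_nonneg[OF f] in \<open>simp add: norm_mult mult_right_mono\<close>)
  then have sum: "(\<lambda>(s, p). f s * c p) summable_on Sigma UNIV fib"
    unfolding case_prod_unfold by (rule Infinite_Sum.abs_summable_summable)
  have "pairing (a \<star> b) f = (\<Sum>\<^sub>\<infinity>s. \<Sum>\<^sub>\<infinity>p\<in>fib s. f s * c p)"
    by (simp add: pairing_def conv infsum_cmult_right' mult.commute[of "infsum c _"])
  also have "\<dots> = (\<Sum>\<^sub>\<infinity>(s, p)\<in>Sigma UNIV fib. f s * c p)"
    by (rule infsum_Sigma'_banach[OF sum])
  also have "\<dots> = (\<Sum>\<^sub>\<infinity>p\<in>UNIV \<times> UNIV. f (fst p * snd p) * c p)"
    using infsum_reindex_bij_betw[OF bij_fibres, of "\<lambda>(s, p). f s * c p"] by (simp add: fib_def)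
  also have "\<dots> = (\<Sum>\<^sub>\<infinity>(g, h)\<in>UNIV \<times> UNIV. a g * b h * (f (g * h) * \<Omega> g h))"
    by (simp add: c_def case_prod_unfold mult_ac)
  also have "\<dots> = pairing a (\<lambda>g. pairing b (\<lambda>h. f (g * h) * \<Omega> g h))"
    using norm_Omega_mult[OF linf_le[OF f]] by (intro pairing_pairing[symmetric] a b)
  finally show "pairing (a \<star> b) f = pairing a (\<lambda>g. pairing b (\<lambda>h. f (g * h) * \<Omega> g h))" .
qed

lemma delta_in_linf: "delta s \<in> carr linf"
  by (rule linfI[of _ 1]) (simp add: delta_def indicator_def)

lemma pairing_delta_right: "pairing a (delta s) = a s"
proof -
  have "pairing a (delta s) = (\<Sum>\<^sub>\<infinity>t\<in>{s}. a t * delta s t)"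
    unfolding pairing_def by (rule infsum_cong_neutral) (auto simp: delta_def)
  then show ?thesis by (simp add: delta_def)
qed

lemma conv_delta: "delta g \<star> delta h = (\<lambda>s. \<Omega> g h * delta (g * h) s)"
proof
  fix s
  have "(delta g \<star> delta h) s = pairing (delta g \<star> delta h) (delta s)"
    by (simp add: pairing_delta_right)
  also have "\<dots> = delta s (g * h) * \<Omega> g h"
    by (simp add: pairing_conv ell1_delta delta_in_linf pairing_delta)
  finally show "(delta g \<star> delta h) s = \<Omega> g h * delta (g * h) s"
    by (auto simp: delta_def indicator_def)
qed

text \<open>The predual of the algebra consists of the functionals whose values at the \<open>\<delta>\<^sub>s\<close> vanish
  at infinity.\<close>

lemma weak_star_continuous_functional:
  assumes \<theta>: "\<And>a. ell1 a \<Longrightarrow> \<theta> a = pairing a f" and f: "f \<in> c0"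
  shows "continuous_map (weak_star (beurling \<omega>) (beurling_predual \<omega>)) euclidean \<theta>"
proof (rule continuous_map_eq[OF continuous_map_weak_star_functional])
  show "(\<lambda>a. if a \<in> carr (beurling \<omega>) then pairing a f else 0) \<in> beurling_predual \<omega>"
    using f by (simp add: beurling_predual_def)
qed (simp add: topspace_weak_star \<theta> beurling_simps)

text \<open>The point masses at distinct elements tend to zero weak*.\<close>

lemma weak_star_continuous_imp_c0:
  assumes \<theta>: "continuous_map (weak_star (beurling \<omega>) (beurling_predual \<omega>)) euclidean \<theta>"
    and zero: "\<theta> (\<lambda>_. 0) = 0"
  shows "(\<lambda>s. \<theta> (delta s)) \<in> c0"
proof (rule c0_if_tendsto)
  fix k :: "nat \<Rightarrow> 's" assume k: "inj k"
  have "limitin (weak_star (beurling \<omega>) (beurling_predual \<omega>)) (\<lambda>n. delta (k n)) (\<lambda>_. 0) sequentially"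
  proof (rule limitin_weak_star)
    fix \<phi> assume "\<phi> \<in> beurling_predual \<omega>"
    then obtain f where f: "f \<in> c0" "\<phi> = (\<lambda>a. if a \<in> carr (beurling \<omega>) then pairing a f else 0)"
      by (auto simp: beurling_predual_def)
    have "\<phi> (\<lambda>_. 0) = 0" by (simp add: f(2) pairing_def)
    then show "(\<lambda>n. \<phi> (delta (k n))) \<longlonglongrightarrow> \<phi> (\<lambda>_. 0)"
      using c0_inj_tendsto[OF f(1) k] by (simp add: f(2) beurling_simps ell1_delta pairing_delta)
  qed (simp_all add: beurling_simps ell1_delta)
  from continuous_map_limit[OF \<theta> this] show "(\<lambda>n. \<theta> (delta (k n))) \<longlonglongrightarrow> 0"
    by (simp add: zero o_def)
qed


section \<open>Orbits of functions vanishing at infinity\<close>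

text \<open>The hypothesis on the fibres is what weak cancellativity provides. If the conclusion failed,
  all \<open>\<tau> s\<^sub>m k\<^sub>j\<close> with \<open>j \<le> m\<close> would lie in a finite set, for suitable points and distinct \<open>k\<^sub>j\<close>. Finiteness of the fibres in the first argument, for \<open>j = 0\<close>, leaves only finitely
  many \<open>s\<^sub>m\<close>, so one of them occurs infinitely often, and finiteness of the fibres in the second
  argument contradicts that the \<open>k\<^sub>j\<close> are distinct.\<close>

lemma c0_orbit:
  fixes \<tau> :: "'s \<Rightarrow> 's \<Rightarrow> 's" and \<sigma> :: "'i \<Rightarrow> 's"
  assumes f: "f \<in> c0" and w: "\<And>k i. cmod (w k i) \<le> 1"
    and fibres: "\<And>s u. finite {k. \<tau> s k = u}" "\<And>k u. finite {s. \<tau> s k = u}"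
    and \<Lambda>: "\<Lambda> \<in> carr (dual_space linf)"
  shows "(\<lambda>k. \<Lambda> (\<lambda>i. f (\<tau> (\<sigma> i) k) * w k i)) \<in> c0"
proof (rule ccontr)
  assume contra: "(\<lambda>k. \<Lambda> (\<lambda>i. f (\<tau> (\<sigma> i) k) * w k i)) \<notin> c0"
  have f_linf: "f \<in> carr linf" using f c0_subset_linf by blast
  have le: "cmod (f (\<tau> (\<sigma> i) k) * w k i) \<le> cmod (f (\<tau> (\<sigma> i) k))" for i k
    using mult_left_mono[OF w, of "cmod (f (\<tau> (\<sigma> i) k))" k i] by (simp add: norm_mult)
  obtain \<eta> and k :: "nat \<Rightarrow> 's" and i where \<eta>: "\<eta> > 0" and k: "inj k"
    and large: "\<And>m j. j \<le> m \<Longrightarrow> \<eta> \<le> cmod (f (\<tau> (\<sigma> (i m)) (k j)) * w (k j) (i m))"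
    using exists_uniformly_large_values[OF \<Lambda> _ contra, of "nrm linf f"] order_trans[OF le linf_le[OF f_linf]]
    by blast
  define Z where "Z = {s. \<eta> \<le> cmod (f s)}"
  have Z: "finite Z" using c0_finite[OF f \<eta>] by (simp add: Z_def)
  have in_Z: "\<tau> (\<sigma> (i m)) (k j) \<in> Z" if "j \<le> m" for m j
    using order_trans[OF large[OF that] le] by (simp add: Z_def)
  obtain r :: "nat \<Rightarrow> nat" where r: "strict_mono r"
    "(\<exists>c. \<forall>n. \<sigma> (i (r n)) = c) \<or> inj ((\<lambda>n. \<sigma> (i n)) \<circ> r)"
    using constant_or_injective_subsequence[of "\<lambda>n. \<sigma> (i n)"] by blast
  have "finite (\<Union>u\<in>Z. {s. \<tau> s (k 0) = u})" using Z fibres by blast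
  moreover have "range ((\<lambda>n. \<sigma> (i n)) \<circ> r) \<subseteq> (\<Union>u\<in>Z. {s. \<tau> s (k 0) = u})"
    using in_Z[of 0] by auto
  ultimately have "\<not> inj ((\<lambda>n. \<sigma> (i n)) \<circ> r)"
    using finite_subset range_inj_infinite by blast
  then obtain c where c: "\<And>n. \<sigma> (i (r n)) = c" using r by blast
  have "range k \<subseteq> (\<Union>u\<in>Z. {k. \<tau> c k = u})"
    using in_Z[OF strict_mono_imp_increasing[OF r(1)]] c by auto
  moreover have "finite (\<Union>u\<in>Z. {k. \<tau> c k = u})" using Z fibres by blast
  ultimately show False using finite_subset range_inj_infinite[OF k] by blast
qed

lemma pairing_in_dual:
  assumes "ell1 a" shows "(\<lambda>f. if f \<in> carr linf then pairing a f else 0) \<in> carr (dual_space linf)"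
  using assms pairing_le[OF assms linf_le]
  by (intro linf.functionalI[where K = "norm1 a"])
    (auto simp: linf_simps linf_add linf_scl pairing_add_right pairing_scl_right)

text \<open>This makes \<open>c\<^sub>0(S)\<close> a submodule of the dual of the algebra.\<close>

lemma c0_translates:
  assumes a: "ell1 a" and f: "f \<in> c0"
  shows "(\<lambda>k. pairing a (\<lambda>s. f (s * k) * \<Omega> s k)) \<in> c0"
    and "(\<lambda>k. pairing a (\<lambda>s. f (k * s) * \<Omega> k s)) \<in> c0"
proof -
  have f_linf: "f \<in> carr linf" using f c0_subset_linf by blast
  have linf1: "(\<lambda>s. f (s * k) * \<Omega> s k) \<in> carr linf" and linf2: "(\<lambda>s. f (k * s) * \<Omega> k s) \<in> carr linf" for k
    by (rule linfI, rule norm_Omega_mult, rule linf_le[OF f_linf])+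
  let ?\<Lambda> = "\<lambda>f :: 's \<Rightarrow> complex. if f \<in> carr linf then pairing a f else 0"
  have "(\<lambda>k. ?\<Lambda> (\<lambda>s. f (id s * k) * \<Omega> s k)) \<in> c0"
    using left_fibres right_fibres by (intro c0_orbit f norm_Omega pairing_in_dual a)
  then show "(\<lambda>k. pairing a (\<lambda>s. f (s * k) * \<Omega> s k)) \<in> c0" by (simp add: linf1)
  have "(\<lambda>k. ?\<Lambda> (\<lambda>s. f (k * id s) * \<Omega> k s)) \<in> c0"
    using left_fibres right_fibres
    by (intro c0_orbit[where \<tau> = "\<lambda>s k. k * s"] f norm_Omega pairing_in_dual a)
  then show "(\<lambda>k. pairing a (\<lambda>s. f (k * s) * \<Omega> k s)) \<in> c0" by (simp add: linf2)
qed


section \<open>The bimodule of bounded functions on the square\<close>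

text \<open>The bimodule structure on the dual of the projective tensor square, where \<open>F\<close> is the functional
  with the value \<open>F (g, h)\<close> at \<open>\<delta>\<^sub>g \<otimes> \<delta>\<^sub>h\<close>: \<open>ract2 F a\<close> sends \<open>x \<otimes> y\<close> to \<open>F (a x \<otimes> y)\<close>,
  and \<open>lact2 a F\<close> sends it to \<open>F (x \<otimes> y a)\<close>.\<close>

definition ract2 :: "('s \<times> 's \<Rightarrow> complex) \<Rightarrow> ('s \<Rightarrow> complex) \<Rightarrow> ('s \<times> 's \<Rightarrow> complex)" where
  "ract2 F a = (\<lambda>(g, h). pairing a (\<lambda>k. F (k * g, h) * \<Omega> k g))"

definition lact2 :: "('s \<Rightarrow> complex) \<Rightarrow> ('s \<times> 's \<Rightarrow> complex) \<Rightarrow> ('s \<times> 's \<Rightarrow> complex)" where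
  "lact2 a F = (\<lambda>(g, h). pairing a (\<lambda>k. F (g, h * k) * \<Omega> h k))"

lemma act_kernel_le:
  assumes "F \<in> carr linf"
  shows "cmod (F p * \<Omega> g h) \<le> nrm linf F"
  by (rule norm_Omega_mult) (rule linf_le[OF assms])

lemma row_linf:
  assumes "F \<in> carr linf"
  shows "(\<lambda>k. F (k * g, h) * \<Omega> k g) \<in> carr linf" "(\<lambda>k. F (g, h * k) * \<Omega> h k) \<in> carr linf"
  by (rule linfI, rule act_kernel_le[OF assms])+

lemma act_closed:
  assumes a: "ell1 a" and F: "F \<in> carr linf"
  shows "ract2 F a \<in> carr linf" "lact2 a F \<in> carr linf"
    "nrm linf (ract2 F a) \<le> norm1 a * nrm linf F" "nrm linf (lact2 a F) \<le> norm1 a * nrm linf F"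
proof -
  have "cmod (ract2 F a p) \<le> norm1 a * nrm linf F" "cmod (lact2 a F p) \<le> norm1 a * nrm linf F" for p
    by (auto simp: ract2_def lact2_def split: prod.split intro!: pairing_le a act_kernel_le F)
  then show "ract2 F a \<in> carr linf" "lact2 a F \<in> carr linf"
    "nrm linf (ract2 F a) \<le> norm1 a * nrm linf F" "nrm linf (lact2 a F) \<le> norm1 a * nrm linf F"
    by (blast intro: linfI linf_norm_le)+
qed

lemma act_delta:
  "ract2 F (delta k) = (\<lambda>(g, h). F (k * g, h) * \<Omega> k g)"
  "lact2 (delta k) F = (\<lambda>(g, h). F (g, h * k) * \<Omega> h k)"
  by (simp_all add: ract2_def lact2_def pairing_delta)

lemma act_add_algebra:
  assumes "ell1 a" "ell1 b" "F \<in> carr linf"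
  shows "ract2 F (\<lambda>s. a s + b s) = (\<lambda>p. ract2 F a p + ract2 F b p)"
    "lact2 (\<lambda>s. a s + b s) F = (\<lambda>p. lact2 a F p + lact2 b F p)"
  using assms by (simp_all add: fun_eq_iff ract2_def lact2_def pairing_add_left row_linf)

lemma act_scl_algebra:
  "ract2 F (\<lambda>s. c * a s) = (\<lambda>p. c * ract2 F a p)" "lact2 (\<lambda>s. c * a s) F = (\<lambda>p. c * lact2 a F p)"
  by (auto simp: ract2_def lact2_def pairing_scl_left)

lemma act_add:
  assumes "ell1 a" "F \<in> carr linf" "G \<in> carr linf"
  shows "ract2 (\<lambda>p. F p + G p) a = (\<lambda>p. ract2 F a p + ract2 G a p)"
    "lact2 a (\<lambda>p. F p + G p) = (\<lambda>p. lact2 a F p + lact2 a G p)"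
  using assms by (simp_all add: fun_eq_iff ract2_def lact2_def distrib_right pairing_add_right row_linf)

lemma act_scl:
  "ract2 (\<lambda>p. c * F p) a = (\<lambda>p. c * ract2 F a p)" "lact2 a (\<lambda>p. c * F p) = (\<lambda>p. c * lact2 a F p)"
  by (auto simp: ract2_def lact2_def mult.assoc pairing_scl_right)

lemma ract2_conv:
  assumes a: "ell1 a" and b: "ell1 b" and F: "F \<in> carr linf"
  shows "ract2 F (a \<star> b) = ract2 (ract2 F a) b"
proof
  fix p :: "'s \<times> 's"
  obtain g h where p: "p = (g, h)" by (cases p)
  have "ract2 F (a \<star> b) p = pairing a (\<lambda>u. pairing b (\<lambda>v. F (u * v * g, h) * \<Omega> (u * v) g * \<Omega> u v))"
    using a b F by (simp add: p ract2_def pairing_conv row_linf)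
  also have "\<dots> = pairing a (\<lambda>u. pairing b (\<lambda>v. \<Omega> v g * (F (u * (v * g), h) * \<Omega> u (v * g))))"
  proof -
    have "F (u * v * g, h) * \<Omega> (u * v) g * \<Omega> u v = F (u * (v * g), h) * (\<Omega> u v * \<Omega> (u * v) g)" for u v
      by (simp add: mult_ac)
    then have "F (u * v * g, h) * \<Omega> (u * v) g * \<Omega> u v = \<Omega> v g * (F (u * (v * g), h) * \<Omega> u (v * g))" for u v
      unfolding Omega_cocycle by (simp add: mult_ac)
    then show ?thesis by (simp only:)
  qed
  also have "\<dots> = pairing b (\<lambda>v. pairing a (\<lambda>u. \<Omega> v g * (F (u * (v * g), h) * \<Omega> u (v * g))))"
    by (intro pairing_swap[of _ _ _ "nrm linf F"] a b)
      (subst mult.commute, intro norm_Omega_mult linf_le F)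
  also have "\<dots> = ract2 (ract2 F a) b p"
    by (simp add: p ract2_def pairing_scl_right mult.commute)
  finally show "ract2 F (a \<star> b) p = ract2 (ract2 F a) b p" .
qed

lemma lact2_conv:
  assumes a: "ell1 a" and b: "ell1 b" and F: "F \<in> carr linf"
  shows "lact2 (a \<star> b) F = lact2 a (lact2 b F)"
proof
  fix p :: "'s \<times> 's"
  obtain g h where p: "p = (g, h)" by (cases p)
  have "lact2 (a \<star> b) F p = pairing a (\<lambda>u. pairing b (\<lambda>v. F (g, h * (u * v)) * \<Omega> h (u * v) * \<Omega> u v))"
    using a b F by (simp add: p lact2_def pairing_conv row_linf)
  also have "\<dots> = pairing a (\<lambda>u. pairing b (\<lambda>v. \<Omega> h u * (F (g, h * u * v) * \<Omega> (h * u) v)))"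
  proof -
    have "F (g, h * (u * v)) * \<Omega> h (u * v) * \<Omega> u v = F (g, h * u * v) * (\<Omega> h (u * v) * \<Omega> u v)" for u v
      by (simp add: mult_ac)
    then have "F (g, h * (u * v)) * \<Omega> h (u * v) * \<Omega> u v = \<Omega> h u * (F (g, h * u * v) * \<Omega> (h * u) v)" for u v
      unfolding Omega_cocycle[symmetric] by (simp add: mult_ac)
    then show ?thesis by (simp only:)
  qed
  also have "\<dots> = lact2 a (lact2 b F) p"
    by (simp add: p lact2_def pairing_scl_right mult.commute)
  finally show "lact2 (a \<star> b) F p = lact2 a (lact2 b F) p" .
qed

lemma lact2_ract2:
  assumes a: "ell1 a" and b: "ell1 b" and F: "F \<in> carr linf"
  shows "lact2 a (ract2 F b) = ract2 (lact2 a F) b"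
proof
  fix p :: "'s \<times> 's"
  obtain g h where p: "p = (g, h)" by (cases p)
  have "lact2 a (ract2 F b) p = pairing a (\<lambda>k. pairing b (\<lambda>j. \<Omega> h k * (F (j * g, h * k) * \<Omega> j g)))"
    by (simp add: p lact2_def ract2_def pairing_scl_right mult.commute)
  also have "\<dots> = pairing b (\<lambda>j. pairing a (\<lambda>k. \<Omega> h k * (F (j * g, h * k) * \<Omega> j g)))"
    by (intro pairing_swap[of _ _ _ "nrm linf F"] a b)
      (subst mult.commute, intro norm_Omega_mult linf_le F)
  also have "\<dots> = pairing b (\<lambda>j. \<Omega> j g * pairing a (\<lambda>k. F (j * g, h * k) * \<Omega> h k))"
    by (simp add: mult_ac flip: pairing_scl_right)
  also have "\<dots> = ract2 (lact2 a F) b p"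
    by (simp add: p lact2_def ract2_def mult.commute)
  finally show "lact2 a (ract2 F b) p = ract2 (lact2 a F) b p" .
qed

lemma orbit_functional:
  assumes \<Lambda>: "\<Lambda> \<in> carr (dual_space linf)" and F: "F \<in> carr linf" and a: "ell1 a"
  shows "\<Lambda> (ract2 F a) = pairing a (\<lambda>k. \<Lambda> (ract2 F (delta k)))"
    "\<Lambda> (lact2 a F) = pairing a (\<lambda>k. \<Lambda> (lact2 (delta k) F))"
proof -
  have bound: "cmod (\<Lambda> G) \<le> nrm (dual_space linf) \<Lambda> * nrm linf F * norm1 a"
    if "ell1 a" "G \<in> carr linf" "nrm linf G \<le> norm1 a * nrm linf F" for G a
    using order_trans[OF linf.functional_le[OF \<Lambda> that(2)]
        mult_left_mono[OF that(3) linf.dual_norm_nonneg[OF \<Lambda>]]] by (simp add: mult_ac)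
  note [simp] = linf.functional_add[OF \<Lambda>, unfolded linf_simps] linf.functional_scl[OF \<Lambda>, unfolded linf_simps]
  show "\<Lambda> (ract2 F a) = pairing a (\<lambda>k. \<Lambda> (ract2 F (delta k)))"
    by (rule pairing_functional[of "\<lambda>a. \<Lambda> (ract2 F a)", OF _ _ bound a])
      (use F in \<open>auto simp: act_add_algebra act_scl_algebra act_closed\<close>)
  show "\<Lambda> (lact2 a F) = pairing a (\<lambda>k. \<Lambda> (lact2 (delta k) F))"
    by (rule pairing_functional[of "\<lambda>a. \<Lambda> (lact2 a F)", OF _ _ bound a])
      (use F in \<open>auto simp: act_add_algebra act_scl_algebra act_closed\<close>)
qed

lemma act_dual:
  assumes \<Lambda>: "\<Lambda> \<in> carr (dual_space linf)" and a: "ell1 a"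
  shows "(\<lambda>F. if F \<in> carr linf then \<Lambda> (ract2 F a) else 0) \<in> carr (dual_space linf)"
    "(\<lambda>F. if F \<in> carr linf then \<Lambda> (lact2 a F) else 0) \<in> carr (dual_space linf)"
proof -
  have bound: "cmod (\<Lambda> G) \<le> (nrm (dual_space linf) \<Lambda> * norm1 a) * nrm linf F"
    if "G \<in> carr linf" "nrm linf G \<le> norm1 a * nrm linf F" for F G :: "'s \<times> 's \<Rightarrow> complex"
    using order_trans[OF linf.functional_le[OF \<Lambda> that(1)]
        mult_left_mono[OF that(2) linf.dual_norm_nonneg[OF \<Lambda>]]] by (simp add: mult_ac)
  note [simp] = linf.functional_add[OF \<Lambda>, unfolded linf_simps] linf.functional_scl[OF \<Lambda>, unfolded linf_simps]
  show "(\<lambda>F. if F \<in> carr linf then \<Lambda> (ract2 F a) else 0) \<in> carr (dual_space linf)"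
    "(\<lambda>F. if F \<in> carr linf then \<Lambda> (lact2 a F) else 0) \<in> carr (dual_space linf)"
    using a bound by (auto intro!: linf.functionalI[where K = "nrm (dual_space linf) \<Lambda> * norm1 a"]
        simp: linf_simps linf_add linf_scl act_add act_scl act_closed)
qed


section \<open>Functions with weakly continuous orbits\<close>

text \<open>By \<open>orbit_functional\<close> these are the \<open>F\<close> for which \<open>a \<mapsto> F \<cdot> a\<close> and \<open>a \<mapsto> a \<cdot> F\<close> are
  continuous from the weak* topology of the algebra to the weak topology of the bounded functions.\<close>

definition sigma_wc :: "('s \<times> 's \<Rightarrow> complex) set" where
  "sigma_wc = {F \<in> carr linf. \<forall>\<Lambda>\<in>carr (dual_space linf).
     (\<lambda>k. \<Lambda> (ract2 F (delta k))) \<in> c0 \<and> (\<lambda>k. \<Lambda> (lact2 (delta k) F)) \<in> c0}"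

lemma sigma_wcD:
  assumes "F \<in> sigma_wc"
  shows "F \<in> carr linf"
    and "\<Lambda> \<in> carr (dual_space linf) \<Longrightarrow> (\<lambda>k. \<Lambda> (ract2 F (delta k))) \<in> c0"
    and "\<Lambda> \<in> carr (dual_space linf) \<Longrightarrow> (\<lambda>k. \<Lambda> (lact2 (delta k) F)) \<in> c0"
  using assms by (auto simp: sigma_wc_def)

lemma sigma_wc_subspace: "linear_subspace linf sigma_wc"
proof -
  have "(\<lambda>p. F p + G p) \<in> sigma_wc" if "F \<in> sigma_wc" "G \<in> sigma_wc" for F G
    using sigma_wcD[OF that(1)] sigma_wcD[OF that(2)]
    by (auto simp: sigma_wc_def linf_add act_add ell1_delta act_closed c0_add
        linf.functional_add[unfolded linf_simps])
  moreover have "(\<lambda>p. c * F p) \<in> sigma_wc" if "F \<in> sigma_wc" for F c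
    using sigma_wcD[OF that]
    by (auto simp: sigma_wc_def linf_scl act_scl ell1_delta act_closed c0_scl
        linf.functional_scl[unfolded linf_simps])
  moreover have "(\<lambda>p. 0) \<in> sigma_wc"
    by (auto simp: sigma_wc_def linf_zero c0_def act_delta case_prod_unfold
        linf.functional_zero[unfolded linf_simps])
  ultimately show ?thesis
    by (auto simp: linear_subspace_def linf_simps sigma_wcD)
qed

lemma sigma_wc_closed: "norm_closed linf sigma_wc"
  unfolding norm_closed_def
proof (intro allI ballI impI)
  fix X :: "nat \<Rightarrow> 's \<times> 's \<Rightarrow> complex" and F
  assume F: "F \<in> carr linf" and "(\<forall>n. X n \<in> sigma_wc) \<and> converges_to linf X F"
  then have X: "\<And>n. X n \<in> sigma_wc" and lim: "(\<lambda>n. nrm linf (\<lambda>p. F p - X n p)) \<longlonglongrightarrow> 0"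
    using linf.norm_sub_commute[OF sigma_wcD(1) F] by (auto simp: converges_to_def linf_simps)
  have "(\<lambda>k. \<Lambda> (ract2 F (delta k))) \<in> c0 \<and> (\<lambda>k. \<Lambda> (lact2 (delta k) F)) \<in> c0"
    if \<Lambda>: "\<Lambda> \<in> carr (dual_space linf)" for \<Lambda>
  proof -
    let ?C = "nrm (dual_space linf) \<Lambda>"
    have near: "\<exists>n. ?C * nrm linf (\<lambda>p. F p - X n p) \<le> \<epsilon>" if "\<epsilon> > 0" for \<epsilon>
    proof -
      have "(\<lambda>n. ?C * nrm linf (\<lambda>p. F p - X n p)) \<longlonglongrightarrow> 0"
        using tendsto_mult_right_zero[OF lim] .
      then have "\<forall>\<^sub>F n in sequentially. ?C * nrm linf (\<lambda>p. F p - X n p) < \<epsilon>"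
        using that by (rule order_tendstoD)
      then show ?thesis by (meson eventually_happens' less_imp_le sequentially_bot)
    qed
    have diff: "(\<lambda>p. F p - X n p) \<in> carr linf" for n using F sigma_wcD(1)[OF X] by (rule linf_diff)
    have le: "cmod (\<Lambda> (ract2 (\<lambda>p. F p - X n p) (delta k))) \<le> ?C * nrm linf (\<lambda>p. F p - X n p)"
      "cmod (\<Lambda> (lact2 (delta k) (\<lambda>p. F p - X n p))) \<le> ?C * nrm linf (\<lambda>p. F p - X n p)" for n k
      using order_trans[OF linf.functional_le[OF \<Lambda>] mult_left_mono[OF _ linf.dual_norm_nonneg[OF \<Lambda>]]]
        act_closed[OF ell1_delta[of k] diff[of n]] by (simp_all add: norm1_delta)
    have "ract2 (\<lambda>p. F p - X n p) (delta k) = (\<lambda>p. ract2 F (delta k) p - ract2 (X n) (delta k) p)"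
      "lact2 (delta k) (\<lambda>p. F p - X n p) = (\<lambda>p. lact2 (delta k) F p - lact2 (delta k) (X n) p)" for k n
      by (auto simp: act_delta algebra_simps)
    then have le: "cmod (\<Lambda> (ract2 F (delta k)) - \<Lambda> (ract2 (X n) (delta k))) \<le> ?C * nrm linf (\<lambda>p. F p - X n p)"
      "cmod (\<Lambda> (lact2 (delta k) F) - \<Lambda> (lact2 (delta k) (X n))) \<le> ?C * nrm linf (\<lambda>p. F p - X n p)" for k n
      using le[where n = n and k = k] linf.functional_sub[OF \<Lambda>, unfolded linf_simps] act_closed(1,2)[OF ell1_delta]
        F sigma_wcD(1)[OF X] by simp_all
    show ?thesis
    proof (intro conjI c0_uniform_limit)
      fix \<epsilon> :: real assume "\<epsilon> > 0"
      then obtain n where n: "?C * nrm linf (\<lambda>p. F p - X n p) \<le> \<epsilon>" using near by blast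
      show "\<exists>g\<in>c0. \<forall>k. cmod (\<Lambda> (ract2 F (delta k)) - g k) \<le> \<epsilon>"
        by (rule bexI[OF _ sigma_wcD(2)[OF X[of n] \<Lambda>]]) (use order_trans[OF le(1) n] in blast)
      show "\<exists>g\<in>c0. \<forall>k. cmod (\<Lambda> (lact2 (delta k) F) - g k) \<le> \<epsilon>"
        by (rule bexI[OF _ sigma_wcD(3)[OF X[of n] \<Lambda>]]) (use order_trans[OF le(2) n] in blast)
    qed
  qed
  then show "F \<in> sigma_wc" using F by (simp add: sigma_wc_def)
qed

text \<open>For the action on the same side as the translation, \<open>\<Lambda>(F \<cdot> a \<cdot> \<delta>\<^sub>k)\<close> is the value at \<open>a \<star> \<delta>\<^sub>k\<close>
  of a functional in the predual, and \<open>c0_translates\<close> applies; the action on the other side is moved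
  into \<open>\<Lambda>\<close>.\<close>

lemma sigma_wc_act:
  assumes F: "F \<in> sigma_wc" and a: "ell1 a"
  shows "ract2 F a \<in> sigma_wc" "lact2 a F \<in> sigma_wc"
proof -
  note F_linf = sigma_wcD(1)[OF F]
  have "(\<lambda>k. \<Lambda> (ract2 (ract2 F a) (delta k))) \<in> c0 \<and> (\<lambda>k. \<Lambda> (lact2 (delta k) (ract2 F a))) \<in> c0 \<and>
    (\<lambda>k. \<Lambda> (ract2 (lact2 a F) (delta k))) \<in> c0 \<and> (\<lambda>k. \<Lambda> (lact2 (delta k) (lact2 a F))) \<in> c0"
    if \<Lambda>: "\<Lambda> \<in> carr (dual_space linf)" for \<Lambda>
  proof -
    define r where "r = (\<lambda>k. \<Lambda> (ract2 F (delta k)))"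
    define l where "l = (\<lambda>k. \<Lambda> (lact2 (delta k) F))"
    have r: "r \<in> c0" and l: "l \<in> c0" using sigma_wcD(2,3)[OF F \<Lambda>] by (auto simp: r_def l_def)
    then have linf: "r \<in> carr linf" "l \<in> carr linf" using c0_subset_linf by blast+
    have "\<Lambda> (ract2 (ract2 F a) (delta k)) = pairing a (\<lambda>s. r (s * k) * \<Omega> s k)" for k
      using orbit_functional(1)[OF \<Lambda> F_linf ell1_conv[OF a ell1_delta], of k]
      by (simp add: ract2_conv[OF a ell1_delta F_linf] pairing_conv[OF a ell1_delta] linf
          pairing_delta flip: r_def)
    moreover have "\<Lambda> (lact2 (delta k) (lact2 a F)) = pairing a (\<lambda>s. l (k * s) * \<Omega> k s)" for k
      using orbit_functional(2)[OF \<Lambda> F_linf ell1_conv[OF ell1_delta a], of k]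
      by (simp add: lact2_conv[OF ell1_delta a F_linf] pairing_conv[OF ell1_delta a] linf
          pairing_delta flip: l_def)
    moreover have "(\<lambda>k. \<Lambda> (lact2 (delta k) (ract2 F a))) \<in> c0"
      using sigma_wcD(3)[OF F act_dual(1)[OF \<Lambda> a]] F_linf
      by (simp add: act_closed ell1_delta lact2_ract2 a)
    moreover have "(\<lambda>k. \<Lambda> (ract2 (lact2 a F) (delta k))) \<in> c0"
      using sigma_wcD(2)[OF F act_dual(2)[OF \<Lambda> a]] F_linf
      by (simp add: act_closed ell1_delta lact2_ract2 a)
    ultimately show ?thesis using c0_translates(1)[OF a r] c0_translates(2)[OF a l] by simp
  qed
  then show "ract2 F a \<in> sigma_wc" "lact2 a F \<in> sigma_wc"
    using act_closed[OF a F_linf] by (auto simp: sigma_wc_def)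
qed

definition sigma_wc_module :: "('s \<Rightarrow> complex, 's \<times> 's \<Rightarrow> complex) cbimodule" where
  "sigma_wc_module = \<lparr>carr = sigma_wc, zer = zer linf, add = add linf, scl = scl linf, nrm = nrm linf,
     lact = lact2, ract = ract2\<rparr>"

lemma sigma_wc_module_simps:
  "carr sigma_wc_module = sigma_wc" "zer sigma_wc_module = (\<lambda>_. 0)"
  "add sigma_wc_module F G = (\<lambda>p. F p + G p)" "scl sigma_wc_module c F = (\<lambda>p. c * F p)"
  "nrm sigma_wc_module = nrm linf" "lact sigma_wc_module = lact2" "ract sigma_wc_module = ract2"
  by (simp_all add: sigma_wc_module_def linf_simps)

lemma sigma_wc_bimodule: "banach_bimodule (beurling \<omega>) sigma_wc_module"
proof -
  have "complex_banach_space (linf\<lparr>carr := sigma_wc\<rparr>)"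
    by (rule linf.closed_subspace_banach[OF sigma_wc_subspace sigma_wc_closed])
  then have banach: "complex_banach_space sigma_wc_module"
    by (rule complex_banach_space_cong) (simp_all add: sigma_wc_module_def)
  show ?thesis
  proof (intro banach_bimodule.intro banach banach_bimodule_axioms.intro)
    show "\<exists>K. \<forall>a\<in>carr (beurling \<omega>). \<forall>F\<in>carr sigma_wc_module.
        nrm sigma_wc_module (lact sigma_wc_module a F) \<le> K * nrm (beurling \<omega>) a * nrm sigma_wc_module F \<and>
        nrm sigma_wc_module (ract sigma_wc_module F a) \<le> K * nrm (beurling \<omega>) a * nrm sigma_wc_module F"
      by (intro exI[of _ 1]) (auto simp: sigma_wc_module_simps beurling_simps sigma_wcD act_closed)
  qed (auto simp: sigma_wc_module_simps beurling_simps(1,3,4) sigma_wc_act sigma_wcD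
      act_add act_scl act_add_algebra act_scl_algebra ract2_conv lact2_conv lact2_ract2)
qed

end


section \<open>Annihilators in the dual of a bimodule\<close>

text \<open>The annihilator of \<open>N\<close> is the dual of the quotient of \<open>P\<close> by the closed span of \<open>N\<close>. Its predual
  is taken to be the norm closure of the evaluations rather than that quotient: then the identification
  of the annihilator with the dual of its predual needs no formula for the quotient norm.\<close>

definition annihilator_module ::
    "('a, 'e) cbimodule \<Rightarrow> 'e set \<Rightarrow> ('a, 'e \<Rightarrow> complex) cbimodule" where
  "annihilator_module P N =
     \<lparr>carr = {\<Lambda> \<in> carr (dual_space P). \<forall>x\<in>N. \<Lambda> x = 0}, zer = zer (dual_space P),
      add = add (dual_space P), scl = scl (dual_space P), nrm = nrm (dual_space P),
      lact = dual_lact P, ract = dual_ract P\<rparr>"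

definition annihilator_predual ::
    "('a, 'e) cbimodule \<Rightarrow> 'e set \<Rightarrow> (('e \<Rightarrow> complex) \<Rightarrow> complex) set" where
  "annihilator_predual P N =
     {\<psi> \<in> carr (dual_space (annihilator_module P N)). \<forall>\<epsilon>>0. \<exists>x\<in>carr P.
        \<forall>\<Lambda>\<in>carr (annihilator_module P N). cmod (\<psi> \<Lambda> - \<Lambda> x) \<le> \<epsilon> * nrm (dual_space P) \<Lambda>}"

locale invariant_subset = banach_bimodule A P
  for A :: "'a calgebra" and P :: "('a, 'e) cbimodule" +
  fixes N :: "'e set"
  assumes N_subset: "N \<subseteq> carr P"
    and N_lact: "\<lbrakk>a \<in> carr A; x \<in> N\<rbrakk> \<Longrightarrow> lact P a x \<in> N"
    and N_ract: "\<lbrakk>a \<in> carr A; x \<in> N\<rbrakk> \<Longrightarrow> ract P x a \<in> N"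
begin

abbreviation "E \<equiv> annihilator_module P N"
abbreviation "Es \<equiv> annihilator_predual P N"

lemma E_simps:
  "zer E = (\<lambda>_. 0)" "add E \<phi> \<psi> = (\<lambda>x. \<phi> x + \<psi> x)" "scl E c \<phi> = (\<lambda>x. c * \<phi> x)"
  "nrm E = nrm (dual_space P)" "lact E = dual_lact P" "ract E = dual_ract P"
  "sub E \<phi> \<psi> = (\<lambda>x. \<phi> x - \<psi> x)"
  by (simp_all add: annihilator_module_def dual_space_def sub_def)

lemma E_carr: "\<Lambda> \<in> carr E \<longleftrightarrow> \<Lambda> \<in> carr (dual_space P) \<and> (\<forall>x\<in>N. \<Lambda> x = 0)"
  by (simp add: annihilator_module_def)

text \<open>An annihilator is norm closed in the dual space.\<close>

lemma E_banach: "complex_banach_space E"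
proof -
  have "linear_subspace (dual_space P) (carr E)"
    by (auto simp: linear_subspace_def E_carr dual_space_add dual_space_scl dual_space_zer
        dual_add_closed dual_scl_closed intro: functionalI[where K = 0])
  moreover have "norm_closed (dual_space P) (carr E)"
    unfolding norm_closed_def
  proof (intro allI ballI impI)
    fix X :: "nat \<Rightarrow> 'e \<Rightarrow> complex" and \<Lambda>
    assume \<Lambda>: "\<Lambda> \<in> carr (dual_space P)" and X: "(\<forall>n. X n \<in> carr E) \<and> converges_to (dual_space P) X \<Lambda>"
    have "\<Lambda> x = 0" if "x \<in> N" for x
    proof -
      have x: "x \<in> carr P" using that N_subset by blast
      have "cmod (\<Lambda> x) \<le> nrm (dual_space P) (sub (dual_space P) (X n) \<Lambda>) * nrm P x" for n
      proof -
        have "X n \<in> carr (dual_space P)" "X n x = 0" using X that by (auto simp: E_carr)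
        then have "sub (dual_space P) (X n) \<Lambda> \<in> carr (dual_space P)"
          using complex_banach_space.sub_closed[OF dual_space_banach] \<Lambda> by blast
        from functional_le[OF this x] show ?thesis using \<open>X n x = 0\<close> by (simp add: dual_space_sub)
      qed
      moreover have "(\<lambda>n. nrm (dual_space P) (sub (dual_space P) (X n) \<Lambda>) * nrm P x) \<longlonglongrightarrow> 0"
        using X by (auto simp: converges_to_def intro: tendsto_mult_left_zero)
      ultimately have "cmod (\<Lambda> x) \<le> 0" by (intro LIMSEQ_le_const) auto
      then show ?thesis by simp
    qed
    then show "\<Lambda> \<in> carr E" using \<Lambda> by (simp add: E_carr)
  qed
  ultimately have "complex_banach_space ((dual_space P)\<lparr>carr := carr E\<rparr>)"
    using complex_banach_space.closed_subspace_banach[OF dual_space_banach] by blast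
  then show ?thesis
    by (rule complex_banach_space_cong) (simp_all add: annihilator_module_def)
qed

lemma dual_act_closed:
  obtains K where "K \<ge> 0"
    "\<And>a \<Lambda>. \<lbrakk>a \<in> carr A; 0 \<le> nrm A a; \<Lambda> \<in> carr E\<rbrakk> \<Longrightarrow> dual_lact P a \<Lambda> \<in> carr E \<and> dual_ract P \<Lambda> a \<in> carr E \<and>
       nrm (dual_space P) (dual_lact P a \<Lambda>) \<le> K * nrm A a * nrm (dual_space P) \<Lambda> \<and>
       nrm (dual_space P) (dual_ract P \<Lambda> a) \<le> K * nrm A a * nrm (dual_space P) \<Lambda>"
proof -
  obtain K0 where K0: "\<And>a x. \<lbrakk>a \<in> carr A; x \<in> carr P\<rbrakk> \<Longrightarrow>
      nrm P (lact P a x) \<le> K0 * nrm A a * nrm P x \<and> nrm P (ract P x a) \<le> K0 * nrm A a * nrm P x"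
    using actions_bounded by blast
  have main: "dual_lact P a \<Lambda> \<in> carr E \<and> dual_ract P \<Lambda> a \<in> carr E \<and>
       nrm (dual_space P) (dual_lact P a \<Lambda>) \<le> \<bar>K0\<bar> * nrm A a * nrm (dual_space P) \<Lambda> \<and>
       nrm (dual_space P) (dual_ract P \<Lambda> a) \<le> \<bar>K0\<bar> * nrm A a * nrm (dual_space P) \<Lambda>"
    if a: "a \<in> carr A" "0 \<le> nrm A a" and \<Lambda>: "\<Lambda> \<in> carr E" for a \<Lambda>
  proof -
    have \<Lambda>': "\<Lambda> \<in> carr (dual_space P)" using \<Lambda> by (simp add: E_carr)
    let ?K = "\<bar>K0\<bar> * nrm A a * nrm (dual_space P) \<Lambda>"
    have K: "0 \<le> ?K" using a dual_norm_nonneg[OF \<Lambda>'] by simp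
    have mono: "K0 * nrm A a * nrm P x \<le> \<bar>K0\<bar> * nrm A a * nrm P x" if "x \<in> carr P" for x
      using a norm_nonneg[OF that] by (intro mult_right_mono) auto
    have bound: "cmod (\<Lambda> y) \<le> ?K * nrm P x"
      if "x \<in> carr P" "y \<in> carr P" "nrm P y \<le> K0 * nrm A a * nrm P x" for x y
      using order_trans[OF functional_le[OF \<Lambda>' that(2)]
          mult_left_mono[OF order_trans[OF that(3) mono[OF that(1)]] dual_norm_nonneg[OF \<Lambda>']]]
      by (simp add: mult_ac)
    have l: "cmod (dual_lact P a \<Lambda> x) \<le> ?K * nrm P x" and r: "cmod (dual_ract P \<Lambda> a x) \<le> ?K * nrm P x"
      if "x \<in> carr P" for x
      using that bound[OF that ract_closed[OF a(1) that]] bound[OF that lact_closed[OF a(1) that]]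
        K0[OF a(1) that] by (auto simp: dual_lact_def dual_ract_def)
    have "dual_lact P a \<Lambda> \<in> carr (dual_space P)"
      by (rule functionalI[OF _ _ l]) (auto simp: dual_lact_def add_closed scl_closed ract_closed a
          ract_add_left ract_scl_left functional_add[OF \<Lambda>'] functional_scl[OF \<Lambda>'])
    moreover have "dual_ract P \<Lambda> a \<in> carr (dual_space P)"
      by (rule functionalI[OF _ _ r]) (auto simp: dual_ract_def add_closed scl_closed lact_closed a
          lact_add_right lact_scl_right functional_add[OF \<Lambda>'] functional_scl[OF \<Lambda>'])
    moreover have "dual_lact P a \<Lambda> x = 0" "dual_ract P \<Lambda> a x = 0" if "x \<in> N" for x
      using that \<Lambda> N_lact[OF a(1) that] N_ract[OF a(1) that] by (auto simp: dual_lact_def dual_ract_def E_carr)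
    ultimately show ?thesis using dual_norm_le[OF l K] dual_norm_le[OF r K] by (simp add: E_carr)
  qed
  show ?thesis by (rule that[OF abs_ge_zero main])
qed

lemma E_bimodule:
  assumes nonneg: "\<And>a. a \<in> carr A \<Longrightarrow> 0 \<le> nrm A a"
    and mul_closed: "\<And>a b. \<lbrakk>a \<in> carr A; b \<in> carr A\<rbrakk> \<Longrightarrow> mul A a b \<in> carr A"
  shows "banach_bimodule A E"
proof -
  obtain K where K: "\<And>a \<Lambda>. \<lbrakk>a \<in> carr A; \<Lambda> \<in> carr E\<rbrakk> \<Longrightarrow> dual_lact P a \<Lambda> \<in> carr E \<and> dual_ract P \<Lambda> a \<in> carr E \<and>
       nrm (dual_space P) (dual_lact P a \<Lambda>) \<le> K * nrm A a * nrm (dual_space P) \<Lambda> \<and>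
       nrm (dual_space P) (dual_ract P \<Lambda> a) \<le> K * nrm A a * nrm (dual_space P) \<Lambda>"
    using dual_act_closed nonneg by metis
  note [simp] = lact_closed ract_closed lact_add_left lact_scl_left ract_add_right ract_scl_right
    lact_mul ract_mul lact_ract functional_add functional_scl mul_closed
  show ?thesis
  proof (intro banach_bimodule.intro E_banach banach_bimodule_axioms.intro)
    show "\<exists>K. \<forall>a\<in>carr A. \<forall>x\<in>carr E. nrm E (lact E a x) \<le> K * nrm A a * nrm E x \<and>
        nrm E (ract E x a) \<le> K * nrm A a * nrm E x"
      using K by (intro exI[of _ K]) (simp add: E_simps)
  qed (use K in \<open>auto simp: E_simps E_carr dual_lact_def dual_ract_def fun_eq_iff\<close>)
qed

definition ev :: "'e \<Rightarrow> ('e \<Rightarrow> complex) \<Rightarrow> complex" where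
  "ev x = (\<lambda>\<Lambda>. if \<Lambda> \<in> carr E then \<Lambda> x else 0)"

lemma ev_dual:
  assumes x: "x \<in> carr P"
  shows "ev x \<in> carr (dual_space E)" "nrm (dual_space E) (ev x) \<le> nrm P x"
proof -
  interpret E: complex_banach_space E by (rule E_banach)
  have le: "cmod (ev x \<Lambda>) \<le> nrm P x * nrm E \<Lambda>" if "\<Lambda> \<in> carr E" for \<Lambda>
    using functional_le[OF _ x, of \<Lambda>] that by (simp add: ev_def E_carr E_simps mult.commute)
  show "ev x \<in> carr (dual_space E)"
    by (rule E.functionalI[OF _ _ le]) (auto simp: ev_def E.add_closed E.scl_closed, simp_all add: E_simps)
  show "nrm (dual_space E) (ev x) \<le> nrm P x"
    by (rule E.dual_norm_le[OF le norm_nonneg[OF x]])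
qed

lemma ev_predual: "x \<in> carr P \<Longrightarrow> ev x \<in> Es"
  using ev_dual dual_norm_nonneg by (auto simp: annihilator_predual_def ev_def E_carr intro!: bexI[of _ x])

lemma predual_approx:
  assumes "\<psi> \<in> Es" "\<epsilon> > 0"
  obtains x where "x \<in> carr P" "\<And>\<Lambda>. \<Lambda> \<in> carr E \<Longrightarrow> cmod (\<psi> \<Lambda> - \<Lambda> x) \<le> \<epsilon> * nrm (dual_space P) \<Lambda>"
  using assms by (auto simp: annihilator_predual_def)

lemma predual_subset: "\<psi> \<in> Es \<Longrightarrow> \<psi> \<in> carr (dual_space E)"
  by (simp add: annihilator_predual_def)

lemma predual_subspace: "linear_subspace (dual_space E) Es"
proof -
  interpret E: complex_banach_space E by (rule E_banach)
  have "(\<lambda>\<Lambda>. \<phi> \<Lambda> + \<psi> \<Lambda>) \<in> Es" if \<phi>: "\<phi> \<in> Es" and \<psi>: "\<psi> \<in> Es" for \<phi> \<psi>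
    unfolding annihilator_predual_def
  proof (intro CollectI conjI allI impI)
    show "(\<lambda>\<Lambda>. \<phi> \<Lambda> + \<psi> \<Lambda>) \<in> carr (dual_space E)"
      by (intro E.dual_add_closed predual_subset \<phi> \<psi>)
    fix \<epsilon> :: real assume "\<epsilon> > 0"
    then have "\<epsilon>/2 > 0" by simp
    obtain x where x: "x \<in> carr P" "\<And>\<Lambda>. \<Lambda> \<in> carr E \<Longrightarrow> cmod (\<phi> \<Lambda> - \<Lambda> x) \<le> \<epsilon>/2 * nrm (dual_space P) \<Lambda>"
      using predual_approx[OF \<phi> \<open>\<epsilon>/2 > 0\<close>] by blast
    obtain y where y: "y \<in> carr P" "\<And>\<Lambda>. \<Lambda> \<in> carr E \<Longrightarrow> cmod (\<psi> \<Lambda> - \<Lambda> y) \<le> \<epsilon>/2 * nrm (dual_space P) \<Lambda>"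
      using predual_approx[OF \<psi> \<open>\<epsilon>/2 > 0\<close>] by blast
    have "cmod (\<phi> \<Lambda> + \<psi> \<Lambda> - \<Lambda> (add P x y)) \<le> \<epsilon> * nrm (dual_space P) \<Lambda>" if \<Lambda>: "\<Lambda> \<in> carr E" for \<Lambda>
    proof -
      have "\<phi> \<Lambda> + \<psi> \<Lambda> - \<Lambda> (add P x y) = (\<phi> \<Lambda> - \<Lambda> x) + (\<psi> \<Lambda> - \<Lambda> y)"
        using \<Lambda> x(1) y(1) by (simp add: E_carr functional_add)
      then show ?thesis using norm_triangle_mono[OF x(2)[OF \<Lambda>] y(2)[OF \<Lambda>]] by (simp add: algebra_simps)
    qed
    then show "\<exists>z\<in>carr P. \<forall>\<Lambda>\<in>carr E. cmod (\<phi> \<Lambda> + \<psi> \<Lambda> - \<Lambda> z) \<le> \<epsilon> * nrm (dual_space P) \<Lambda>"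
      using add_closed[OF x(1) y(1)] by blast
  qed
  moreover have "(\<lambda>\<Lambda>. c * \<psi> \<Lambda>) \<in> Es" if \<psi>: "\<psi> \<in> Es" for c \<psi>
    unfolding annihilator_predual_def
  proof (intro CollectI conjI allI impI)
    show "(\<lambda>\<Lambda>. c * \<psi> \<Lambda>) \<in> carr (dual_space E)" by (intro E.dual_scl_closed predual_subset \<psi>)
    fix \<epsilon> :: real assume "\<epsilon> > 0"
    then have "\<epsilon> / (cmod c + 1) > 0" by (simp add: add_nonneg_pos)
    from predual_approx[OF \<psi> this]
    obtain y where y: "y \<in> carr P"
      "\<And>\<Lambda>. \<Lambda> \<in> carr E \<Longrightarrow> cmod (\<psi> \<Lambda> - \<Lambda> y) \<le> \<epsilon> / (cmod c + 1) * nrm (dual_space P) \<Lambda>" by blast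
    have "cmod (c * \<psi> \<Lambda> - \<Lambda> (scl P c y)) \<le> \<epsilon> * nrm (dual_space P) \<Lambda>" if \<Lambda>: "\<Lambda> \<in> carr E" for \<Lambda>
    proof -
      have "c * \<psi> \<Lambda> - \<Lambda> (scl P c y) = c * (\<psi> \<Lambda> - \<Lambda> y)"
        using \<Lambda> y(1) by (simp add: E_carr functional_scl algebra_simps)
      then have "cmod (c * \<psi> \<Lambda> - \<Lambda> (scl P c y)) \<le> cmod c * (\<epsilon> / (cmod c + 1) * nrm (dual_space P) \<Lambda>)"
        using mult_left_mono[OF y(2)[OF \<Lambda>], of "cmod c"] by (simp add: norm_mult)
      also have "\<dots> = (cmod c / (cmod c + 1)) * (\<epsilon> * nrm (dual_space P) \<Lambda>)" by simp
      also have "\<dots> \<le> 1 * (\<epsilon> * nrm (dual_space P) \<Lambda>)"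
        using \<Lambda> \<open>\<epsilon> > 0\<close> dual_norm_nonneg[of \<Lambda>] by (intro mult_right_mono) (auto simp: E_carr divide_le_eq add_nonneg_pos)
      finally show ?thesis by simp
    qed
    then show "\<exists>z\<in>carr P. \<forall>\<Lambda>\<in>carr E. cmod (c * \<psi> \<Lambda> - \<Lambda> z) \<le> \<epsilon> * nrm (dual_space P) \<Lambda>"
      using scl_closed[OF y(1)] by blast
  qed
  moreover have "ev (zer P) = (\<lambda>_. 0)" by (auto simp: ev_def E_carr functional_zero)
  then have "(\<lambda>_. 0) \<in> Es" using ev_predual[OF zero_closed] by simp
  ultimately show ?thesis
    by (auto simp: linear_subspace_def E.dual_space_add E.dual_space_scl E.dual_space_zer predual_subset)
qed

lemma predual_closed: "norm_closed (dual_space E) Es"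
  unfolding norm_closed_def
proof (intro allI ballI impI)
  interpret E: complex_banach_space E by (rule E_banach)
  fix X \<psi> assume \<psi>: "\<psi> \<in> carr (dual_space E)" and X: "(\<forall>n. X n \<in> Es) \<and> converges_to (dual_space E) X \<psi>"
  show "\<psi> \<in> Es"
    unfolding annihilator_predual_def
  proof (intro CollectI conjI allI impI \<psi>)
    fix \<epsilon> :: real assume "\<epsilon> > 0"
    then have "\<epsilon>/2 > 0" by simp
    then obtain n where "norm (nrm (dual_space E) (sub (dual_space E) (X n) \<psi>) - 0) < \<epsilon>/2"
      using X LIMSEQ_D unfolding converges_to_def by blast
    then have n: "nrm (dual_space E) (sub (dual_space E) (X n) \<psi>) \<le> \<epsilon>/2" by simp
    have Xn: "X n \<in> Es" using X by blast
    have diff: "sub (dual_space E) (X n) \<psi> \<in> carr (dual_space E)"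
      using complex_banach_space.sub_closed[OF E.dual_space_banach predual_subset[OF Xn] \<psi>] .
    obtain x where x: "x \<in> carr P" "\<And>\<Lambda>. \<Lambda> \<in> carr E \<Longrightarrow> cmod (X n \<Lambda> - \<Lambda> x) \<le> \<epsilon>/2 * nrm (dual_space P) \<Lambda>"
      using predual_approx[OF Xn \<open>\<epsilon>/2 > 0\<close>] by blast
    have "cmod (\<psi> \<Lambda> - \<Lambda> x) \<le> \<epsilon> * nrm (dual_space P) \<Lambda>" if \<Lambda>: "\<Lambda> \<in> carr E" for \<Lambda>
    proof -
      have "cmod (X n \<Lambda> - \<psi> \<Lambda>) \<le> nrm (dual_space E) (sub (dual_space E) (X n) \<psi>) * nrm E \<Lambda>"
        using E.functional_le[OF diff \<Lambda>] by (simp add: E.dual_space_sub)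
      also have "\<dots> \<le> \<epsilon>/2 * nrm (dual_space P) \<Lambda>"
        using mult_right_mono[OF n E.norm_nonneg[OF \<Lambda>]] by (simp add: E_simps)
      finally have "cmod (\<psi> \<Lambda> - X n \<Lambda>) \<le> \<epsilon>/2 * nrm (dual_space P) \<Lambda>" by (simp add: norm_minus_commute)
      from norm_triangle_mono[OF this x(2)[OF \<Lambda>]] show ?thesis by simp
    qed
    then show "\<exists>x\<in>carr P. \<forall>\<Lambda>\<in>carr E. cmod (\<psi> \<Lambda> - \<Lambda> x) \<le> \<epsilon> * nrm (dual_space P) \<Lambda>" using x(1) by blast
  qed
qed

text \<open>If \<open>\<psi>\<close> is close to the evaluation at \<open>x\<close>, then \<open>a \<cdot> \<psi>\<close> is close to the evaluation at
  \<open>a \<cdot> x\<close>, because the action of \<open>a\<close> on the annihilator is bounded.\<close>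

lemma predual_invariant:
  assumes nonneg: "\<And>a. a \<in> carr A \<Longrightarrow> 0 \<le> nrm A a"
    and mul_closed: "\<And>a b. \<lbrakk>a \<in> carr A; b \<in> carr A\<rbrakk> \<Longrightarrow> mul A a b \<in> carr A"
    and a: "a \<in> carr A" and \<psi>: "\<psi> \<in> Es"
  shows "dual_lact E a \<psi> \<in> Es" "dual_ract E \<psi> a \<in> Es"
proof -
  interpret E: complex_banach_space E by (rule E_banach)
  interpret EB: invariant_subset A E "{}"
    using E_bimodule[OF nonneg mul_closed] by (simp add: invariant_subset_def invariant_subset_axioms_def)
  obtain K where K: "K \<ge> 0" "\<And>\<Lambda>. \<Lambda> \<in> carr E \<Longrightarrow> dual_lact P a \<Lambda> \<in> carr E \<and> dual_ract P \<Lambda> a \<in> carr E \<and>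
       nrm (dual_space P) (dual_lact P a \<Lambda>) \<le> K * nrm A a * nrm (dual_space P) \<Lambda> \<and>
       nrm (dual_space P) (dual_ract P \<Lambda> a) \<le> K * nrm A a * nrm (dual_space P) \<Lambda>"
    using dual_act_closed nonneg[OF a] a by metis
  obtain K' where "\<And>\<psi>. \<psi> \<in> carr (dual_space E) \<Longrightarrow>
      dual_lact E a \<psi> \<in> carr (dual_space E) \<and> dual_ract E \<psi> a \<in> carr (dual_space E)"
    using EB.dual_act_closed nonneg[OF a] a by (metis EB.E_carr empty_iff)
  then have dual: "dual_lact E a \<psi> \<in> carr (dual_space E)" "dual_ract E \<psi> a \<in> carr (dual_space E)"
    using predual_subset[OF \<psi>] by auto
  define C where "C = K * nrm A a"
  have C: "C \<ge> 0" using K(1) nonneg[OF a] by (simp add: C_def)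
  have approx: "\<exists>x\<in>carr P. \<forall>\<Lambda>. \<Lambda> \<in> carr E \<longrightarrow> (\<forall>\<Lambda>'\<in>carr E. nrm (dual_space P) \<Lambda>' \<le> C * nrm (dual_space P) \<Lambda>
      \<longrightarrow> cmod (\<psi> \<Lambda>' - \<Lambda>' x) \<le> \<epsilon> * nrm (dual_space P) \<Lambda>)" if "\<epsilon> > 0" for \<epsilon>
  proof -
    have pos: "\<epsilon> / (C + 1) > 0" using that C by simp
    obtain x where x: "x \<in> carr P" "\<And>\<Lambda>. \<Lambda> \<in> carr E \<Longrightarrow> cmod (\<psi> \<Lambda> - \<Lambda> x) \<le> \<epsilon> / (C + 1) * nrm (dual_space P) \<Lambda>"
      using predual_approx[OF \<psi> pos] by blast
    have "cmod (\<psi> \<Lambda>' - \<Lambda>' x) \<le> \<epsilon> * nrm (dual_space P) \<Lambda>"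
      if "\<Lambda> \<in> carr E" "\<Lambda>' \<in> carr E" "nrm (dual_space P) \<Lambda>' \<le> C * nrm (dual_space P) \<Lambda>" for \<Lambda> \<Lambda>'
    proof -
      have nn: "0 \<le> nrm (dual_space P) \<Lambda>" using that dual_norm_nonneg by (simp add: E_carr)
      have "cmod (\<psi> \<Lambda>' - \<Lambda>' x) \<le> \<epsilon> / (C + 1) * nrm (dual_space P) \<Lambda>'" by (rule x(2)[OF that(2)])
      also have "\<dots> \<le> \<epsilon> / (C + 1) * (C * nrm (dual_space P) \<Lambda>)"
        using that(3) pos by (intro mult_left_mono) auto
      also have "\<dots> = (C / (C + 1)) * (\<epsilon> * nrm (dual_space P) \<Lambda>)" by simp
      also have "\<dots> \<le> 1 * (\<epsilon> * nrm (dual_space P) \<Lambda>)"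
        using nn C \<open>\<epsilon> > 0\<close> by (intro mult_right_mono) auto
      finally show ?thesis by simp
    qed
    then show ?thesis using x(1) by blast
  qed
  show "dual_lact E a \<psi> \<in> Es"
    unfolding annihilator_predual_def
  proof (intro CollectI conjI allI impI dual)
    fix \<epsilon> :: real assume "\<epsilon> > 0"
    from approx[OF this] obtain x where x: "x \<in> carr P"
      "\<And>\<Lambda> \<Lambda>'. \<lbrakk>\<Lambda> \<in> carr E; \<Lambda>' \<in> carr E; nrm (dual_space P) \<Lambda>' \<le> C * nrm (dual_space P) \<Lambda>\<rbrakk>
        \<Longrightarrow> cmod (\<psi> \<Lambda>' - \<Lambda>' x) \<le> \<epsilon> * nrm (dual_space P) \<Lambda>" by blast
    have "cmod (dual_lact E a \<psi> \<Lambda> - \<Lambda> (lact P a x)) \<le> \<epsilon> * nrm (dual_space P) \<Lambda>" if "\<Lambda> \<in> carr E" for \<Lambda>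
      using x(2)[OF that, of "dual_ract P \<Lambda> a"] K(2)[OF that] x(1) that
      by (simp add: dual_lact_def[of E] E_simps C_def) (simp add: dual_ract_def)
    then show "\<exists>x\<in>carr P. \<forall>\<Lambda>\<in>carr E. cmod (dual_lact E a \<psi> \<Lambda> - \<Lambda> x) \<le> \<epsilon> * nrm (dual_space P) \<Lambda>"
      using lact_closed[OF a x(1)] by blast
  qed
  show "dual_ract E \<psi> a \<in> Es"
    unfolding annihilator_predual_def
  proof (intro CollectI conjI allI impI dual)
    fix \<epsilon> :: real assume "\<epsilon> > 0"
    from approx[OF this] obtain x where x: "x \<in> carr P"
      "\<And>\<Lambda> \<Lambda>'. \<lbrakk>\<Lambda> \<in> carr E; \<Lambda>' \<in> carr E; nrm (dual_space P) \<Lambda>' \<le> C * nrm (dual_space P) \<Lambda>\<rbrakk>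
        \<Longrightarrow> cmod (\<psi> \<Lambda>' - \<Lambda>' x) \<le> \<epsilon> * nrm (dual_space P) \<Lambda>" by blast
    have "cmod (dual_ract E \<psi> a \<Lambda> - \<Lambda> (ract P x a)) \<le> \<epsilon> * nrm (dual_space P) \<Lambda>" if "\<Lambda> \<in> carr E" for \<Lambda>
      using x(2)[OF that, of "dual_lact P a \<Lambda>"] K(2)[OF that] x(1) that
      by (simp add: dual_ract_def[of E] E_simps C_def) (simp add: dual_lact_def)
    then show "\<exists>x\<in>carr P. \<forall>\<Lambda>\<in>carr E. cmod (dual_ract E \<psi> a \<Lambda> - \<Lambda> x) \<le> \<epsilon> * nrm (dual_space P) \<Lambda>"
      using ract_closed[OF a x(1)] by blast
  qed
qed

lemma canonical_isometry:
  assumes \<Lambda>: "\<Lambda> \<in> carr E"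
  shows "canonical_map Es \<Lambda> \<in> carr (dual_space (dual_space E\<lparr>carr := Es\<rparr>))"
    "nrm (dual_space (dual_space E\<lparr>carr := Es\<rparr>)) (canonical_map Es \<Lambda>) = nrm E \<Lambda>"
proof -
  interpret E: complex_banach_space E by (rule E_banach)
  interpret Es: complex_banach_space "dual_space E\<lparr>carr := Es\<rparr>"
    by (rule complex_banach_space.closed_subspace_banach[OF E.dual_space_banach predual_subspace predual_closed])
  have le: "cmod (canonical_map Es \<Lambda> \<psi>) \<le> nrm E \<Lambda> * nrm (dual_space E\<lparr>carr := Es\<rparr>) \<psi>"
    if "\<psi> \<in> carr (dual_space E\<lparr>carr := Es\<rparr>)" for \<psi>
    using that E.functional_le[OF predual_subset \<Lambda>, of \<psi>] by (simp add: canonical_map_def mult.commute)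
  show in_dual: "canonical_map Es \<Lambda> \<in> carr (dual_space (dual_space E\<lparr>carr := Es\<rparr>))"
    using Es.add_closed Es.scl_closed
    by (intro Es.functionalI[OF _ _ le]) (auto simp: canonical_map_def E.dual_space_add E.dual_space_scl)
  show "nrm (dual_space (dual_space E\<lparr>carr := Es\<rparr>)) (canonical_map Es \<Lambda>) = nrm E \<Lambda>" (is "?C = _")
  proof (rule antisym)
    show "?C \<le> nrm E \<Lambda>" by (rule Es.dual_norm_le[OF le E.norm_nonneg[OF \<Lambda>]])
    have "cmod (\<Lambda> x) \<le> ?C * nrm P x" if x: "x \<in> carr P" for x
    proof -
      have "cmod (\<Lambda> x) \<le> ?C * nrm (dual_space E) (ev x)"
        using Es.functional_le[OF in_dual, of "ev x"] ev_predual[OF x] \<Lambda>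
        by (simp add: canonical_map_def) (simp add: ev_def)
      also have "\<dots> \<le> ?C * nrm P x"
        by (rule mult_left_mono[OF ev_dual(2)[OF x] Es.dual_norm_nonneg[OF in_dual]])
      finally show ?thesis .
    qed
    then show "nrm E \<Lambda> \<le> ?C"
      unfolding E_simps by (rule dual_norm_le[OF _ Es.dual_norm_nonneg[OF in_dual]])
  qed
qed

text \<open>A functional \<open>\<Psi>\<close> on the predual is pulled back along \<open>ev\<close> to a functional on \<open>P\<close>. This kills \<open>N\<close>,
  because the evaluations at elements of \<open>N\<close> vanish on the annihilator, and it induces \<open>\<Psi>\<close> on the
  evaluations, hence by continuity on their closure.\<close>

lemma canonical_surjective:
  assumes \<Psi>: "\<Psi> \<in> carr (dual_space (dual_space E\<lparr>carr := Es\<rparr>))"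
  shows "\<exists>\<Lambda>\<in>carr E. canonical_map Es \<Lambda> = \<Psi>"
proof -
  interpret E: complex_banach_space E by (rule E_banach)
  interpret Es: complex_banach_space "dual_space E\<lparr>carr := Es\<rparr>"
    by (rule complex_banach_space.closed_subspace_banach[OF E.dual_space_banach predual_subspace predual_closed])
  let ?C = "nrm (dual_space (dual_space E\<lparr>carr := Es\<rparr>)) \<Psi>"
  have C: "0 \<le> ?C" by (rule Es.dual_norm_nonneg[OF \<Psi>])
  have \<Psi>_add: "\<Psi> (\<lambda>x. \<phi> x + \<psi> x) = \<Psi> \<phi> + \<Psi> \<psi>" if "\<phi> \<in> Es" "\<psi> \<in> Es" for \<phi> \<psi>
    using Es.functional_add[OF \<Psi>, of \<phi> \<psi>] that by (simp add: E.dual_space_add)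
  have \<Psi>_scl: "\<Psi> (\<lambda>x. c * \<psi> x) = c * \<Psi> \<psi>" if "\<psi> \<in> Es" for c \<psi>
    using Es.functional_scl[OF \<Psi>, of \<psi> c] that by (simp add: E.dual_space_scl)
  define \<Lambda> where "\<Lambda> x = (if x \<in> carr P then \<Psi> (ev x) else 0)" for x
  have \<Lambda>_dual: "\<Lambda> \<in> carr (dual_space P)"
  proof (rule functionalI)
    fix x y assume xy: "x \<in> carr P" "y \<in> carr P"
    have "ev (add P x y) = (\<lambda>\<Lambda>. ev x \<Lambda> + ev y \<Lambda>)"
      using xy by (auto simp: ev_def E_carr functional_add)
    then show "\<Lambda> (add P x y) = \<Lambda> x + \<Lambda> y"
      using xy by (simp add: \<Lambda>_def add_closed \<Psi>_add ev_predual)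
  next
    fix c x assume x: "x \<in> carr P"
    have "ev (scl P c x) = (\<lambda>\<Lambda>. c * ev x \<Lambda>)" using x by (auto simp: ev_def E_carr functional_scl)
    then show "\<Lambda> (scl P c x) = c * \<Lambda> x" using x by (simp add: \<Lambda>_def scl_closed \<Psi>_scl ev_predual)
  next
    fix x assume x: "x \<in> carr P"
    show "cmod (\<Lambda> x) \<le> ?C * nrm P x"
      using Es.functional_le[OF \<Psi>, of "ev x"] ev_predual[OF x] mult_left_mono[OF ev_dual(2)[OF x] C] x
      by (simp add: \<Lambda>_def)
  qed (simp add: \<Lambda>_def)
  have "\<Lambda> x = 0" if "x \<in> N" for x
  proof -
    have "ev x = (\<lambda>_. 0)" using that by (auto simp: ev_def E_carr)
    then show ?thesis using Es.functional_zero[OF \<Psi>] by (simp add: \<Lambda>_def E.dual_space_zer)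
  qed
  then have \<Lambda>: "\<Lambda> \<in> carr E" using \<Lambda>_dual by (simp add: E_carr)
  have "\<psi> \<Lambda> = \<Psi> \<psi>" if \<psi>: "\<psi> \<in> Es" for \<psi>
  proof -
    have small: "cmod (\<psi> \<Lambda> - \<Psi> \<psi>) \<le> \<epsilon> * (nrm E \<Lambda> + ?C)" if "\<epsilon> > 0" for \<epsilon>
    proof -
      obtain x where x: "x \<in> carr P" "\<And>\<Lambda>. \<Lambda> \<in> carr E \<Longrightarrow> cmod (\<psi> \<Lambda> - \<Lambda> x) \<le> \<epsilon> * nrm (dual_space P) \<Lambda>"
        using predual_approx[OF \<psi> \<open>\<epsilon> > 0\<close>] by blast
      have diff: "sub (dual_space E) \<psi> (ev x) \<in> Es"
        using Es.sub_closed[of \<psi> "ev x"] \<psi> ev_predual[OF x(1)] by (simp add: sub_def)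
      have "nrm (dual_space E) (sub (dual_space E) \<psi> (ev x)) \<le> \<epsilon>"
        by (rule E.dual_norm_le) (use x(2) \<open>\<epsilon> > 0\<close> in \<open>auto simp: E.dual_space_sub ev_def E_simps\<close>)
      then have "?C * nrm (dual_space E) (sub (dual_space E) \<psi> (ev x)) \<le> ?C * \<epsilon>"
        using C by (rule mult_left_mono)
      moreover have "cmod (\<Psi> (sub (dual_space E) \<psi> (ev x))) \<le> ?C * nrm (dual_space E) (sub (dual_space E) \<psi> (ev x))"
        using Es.functional_le[OF \<Psi>, of "sub (dual_space E) \<psi> (ev x)"] diff by simp
      moreover have "\<Psi> (sub (dual_space E) \<psi> (ev x)) = \<Psi> \<psi> - \<Lambda> x"
        using Es.functional_sub[OF \<Psi>, of \<psi> "ev x"] \<psi> ev_predual[OF x(1)] x(1)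
        by (simp add: sub_def \<Lambda>_def)
      ultimately have "cmod (\<Lambda> x - \<Psi> \<psi>) \<le> ?C * \<epsilon>" by (simp add: norm_minus_commute)
      from norm_triangle_mono[OF x(2)[OF \<Lambda>] this] show ?thesis by (simp add: E_simps algebra_simps)
    qed
    have pos: "nrm E \<Lambda> + ?C + 1 > 0" using C E.norm_nonneg[OF \<Lambda>] by simp
    have "cmod (\<psi> \<Lambda> - \<Psi> \<psi>) \<le> 0 + e" if "e > 0" for e
    proof -
      have "cmod (\<psi> \<Lambda> - \<Psi> \<psi>) \<le> e / (nrm E \<Lambda> + ?C + 1) * (nrm E \<Lambda> + ?C)"
        by (rule small) (use that pos in simp)
      also have "\<dots> \<le> e" using that pos by (simp add: divide_simps)
      finally show ?thesis by simp
    qed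
    then have "cmod (\<psi> \<Lambda> - \<Psi> \<psi>) \<le> 0" by (rule field_le_epsilon)
    then show ?thesis by simp
  qed
  then have "canonical_map Es \<Lambda> = \<Psi>"
    using Es.functional_off[OF \<Psi>] by (auto simp: canonical_map_def fun_eq_iff)
  then show ?thesis using \<Lambda> by blast
qed

theorem E_dual_bimodule:
  assumes nonneg: "\<And>a. a \<in> carr A \<Longrightarrow> 0 \<le> nrm A a"
    and mul_closed: "\<And>a b. \<lbrakk>a \<in> carr A; b \<in> carr A\<rbrakk> \<Longrightarrow> mul A a b \<in> carr A"
  shows "dual_banach_bimodule A E Es"
proof -
  have "inj_on (canonical_map Es) (carr E)"
  proof (rule inj_onI)
    fix \<Lambda> \<Lambda>' assume \<Lambda>: "\<Lambda> \<in> carr E" "\<Lambda>' \<in> carr E" and eq: "canonical_map Es \<Lambda> = canonical_map Es \<Lambda>'"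
    have "\<Lambda> x = \<Lambda>' x" if x: "x \<in> carr P" for x
      using fun_cong[OF eq, of "ev x"] ev_predual[OF x] \<Lambda> by (simp add: canonical_map_def) (simp add: ev_def)
    moreover have "\<Lambda> x = \<Lambda>' x" if "x \<notin> carr P" for x
      using \<Lambda> that functional_off[of \<Lambda> x] functional_off[of \<Lambda>' x] by (simp add: E_carr)
    ultimately show "\<Lambda> = \<Lambda>'" by blast
  qed
  then have "bij_betw (canonical_map Es) (carr E) (carr (dual_space (dual_space E\<lparr>carr := Es\<rparr>)))"
    unfolding bij_betw_def using canonical_isometry(1) canonical_surjective by blast
  then show ?thesis
    unfolding dual_banach_bimodule_def Let_def
    using E_bimodule[OF nonneg mul_closed] predual_subspace predual_closed canonical_isometry(2)
      predual_invariant[OF nonneg mul_closed] by blast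
qed

end


section \<open>Double limits\<close>

text \<open>The points \<open>i m\<close> may be taken distinct: along a constant subsequence the bounds would hold for all
  \<open>k j\<close> at a single point, where \<open>x\<close> vanishes at infinity.\<close>

lemma exists_injective_uniformly_large_values:
  fixes x :: "'s \<Rightarrow> 'i \<Rightarrow> complex"
  assumes \<Lambda>: "\<Lambda> \<in> carr (dual_space linf)"
    and bound: "\<And>k i. cmod (x k i) \<le> K"
    and pointwise: "\<And>i. (\<lambda>k. x k i) \<in> c0"
    and not_c0: "(\<lambda>k. \<Lambda> (x k)) \<notin> c0"
  obtains \<eta> and k :: "nat \<Rightarrow> 's" and i :: "nat \<Rightarrow> 'i"
  where "\<eta> > 0" "inj k" "inj i" "\<And>m j. j \<le> m \<Longrightarrow> \<eta> \<le> cmod (x (k j) (i m))"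
proof -
  obtain \<eta> and k :: "nat \<Rightarrow> 's" and i where \<eta>: "\<eta> > 0" and k: "inj k"
    and large: "\<And>m j. j \<le> m \<Longrightarrow> \<eta> \<le> cmod (x (k j) (i m))"
    using exists_uniformly_large_values[OF \<Lambda> bound not_c0] by blast
  obtain r :: "nat \<Rightarrow> nat" where r: "strict_mono r" "(\<exists>c. \<forall>n. i (r n) = c) \<or> inj (i \<circ> r)"
    using constant_or_injective_subsequence[of i] by blast
  have large': "\<eta> \<le> cmod (x (k j) (i (r m)))" if "j \<le> m" for j m
    by (rule large[OF order_trans[OF that strict_mono_imp_increasing[OF r(1)]]])
  have "\<not> (\<exists>c. \<forall>n. i (r n) = c)"
  proof
    assume "\<exists>c. \<forall>n. i (r n) = c"
    then obtain c where "\<And>n. i (r n) = c" by blast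
    then have ge: "\<eta> \<le> cmod (x (k j) c)" for j using large'[of j j] by simp
    obtain N where "\<And>n. n \<ge> N \<Longrightarrow> norm (x (k n) c - 0) < \<eta>"
      using LIMSEQ_D[OF c0_inj_tendsto[OF pointwise[of c] k] \<eta>] by blast
    then have "cmod (x (k N) c) < \<eta>" by simp
    then show False using ge[of N] by simp
  qed
  then have "inj (i \<circ> r)" using r(2) by blast
  then show ?thesis using that[OF \<eta> k, of "i \<circ> r"] large' by simp
qed

text \<open>The bound is only available for \<open>m\<close> large in terms of \<open>n\<close>, which is enough as the inner limit
  is over \<open>m\<close>.\<close>

lemma repeated_limit_product_bound:
  fixes x :: "nat \<Rightarrow> nat \<Rightarrow> complex" and w :: "nat \<Rightarrow> nat \<Rightarrow> real"
  assumes "repeated_limit x L" "repeated_limit w W"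
    and large: "\<And>n m. N n \<le> m \<Longrightarrow> \<eta> \<le> cmod (x n m * of_real (w n m))"
  shows "\<eta> \<le> cmod (L * of_real W)"
proof -
  obtain l where l: "\<And>n. (\<lambda>m. x n m) \<longlonglongrightarrow> l n" "l \<longlonglongrightarrow> L"
    using assms(1) unfolding repeated_limit_def by blast
  obtain v where v: "\<And>n. (\<lambda>m. w n m) \<longlonglongrightarrow> v n" "v \<longlonglongrightarrow> W"
    using assms(2) unfolding repeated_limit_def by blast
  have "\<eta> \<le> cmod (l n * of_real (v n))" for n
    by (rule LIMSEQ_le_const[OF tendsto_norm[OF tendsto_mult[OF l(1) tendsto_of_real[OF v(1)]]]])
      (use large in blast)
  then show ?thesis
    by (intro LIMSEQ_le_const[OF tendsto_norm[OF tendsto_mult[OF l(2) tendsto_of_real[OF v(2)]]]]) blast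
qed

lemma repeated_limit_continuous:
  assumes "repeated_limit u L" "\<And>x. isCont f x"
  shows "repeated_limit (\<lambda>n m. f (u n m)) (f L)"
  using assms unfolding repeated_limit_def by (metis isCont_tendsto_compose)

context weighted_weakly_cancellative_semigroup
begin

text \<open>Otherwise there are distinct \<open>k\<^sub>n\<close> and distinct points \<open>(g\<^sub>m, h\<^sub>m)\<close> such that the entries of one row
  of the condition have a product of modulus at least \<open>\<eta>\<close> for all \<open>n \<le> m\<close>. The points may be taken
  distinct because the first two parts of the condition make the orbits vanish at infinity pointwise.\<close>

lemma condition_D_imp_sigma_wc:
  assumes f: "f \<in> carr linf" and T: "\<And>g h. pairing (delta h) (T (delta g)) = f (g, h)"
    and T_linf: "\<And>g. T (delta g) \<in> carr linf" and D: "condition_D \<omega> T"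
  shows "(\<lambda>(g, h). f (h, g)) \<in> sigma_wc"
proof -
  let ?F = "\<lambda>(g, h). f (h, g)"
  have f_eq: "f (g, h) = T (delta g) h" for g h using T[of h g] by (simp add: pairing_delta)
  have f_le: "cmod (f p) \<le> nrm linf f" for p by (rule linf_le[OF f])
  have F: "?F \<in> carr linf" using f_le by (intro linfI[of _ "nrm linf f"]) auto
  have c0_right: "(\<lambda>s. f (h, s)) \<in> c0" for h
    using D by (force simp: condition_D_def f_eq beurling_simps ell1_delta)
  have c0_left: "(\<lambda>s. f (s, g)) \<in> c0" for g
  proof -
    have "adjoint_map T (bidual_embedding (delta g)) \<in> c0"
      using D by (force simp: condition_D_def beurling_simps ell1_delta)
    then show ?thesis
      by (simp add: adjoint_map_def bidual_embedding_def T_linf pairing_delta f_eq)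
  qed
  have double_limit: False
    if \<eta>: "\<eta> > 0" and k: "inj k" and i: "inj i"
      and large: "(\<forall>m. \<forall>j\<le>m. \<eta> \<le> cmod (f (snd (i m), k j * fst (i m)) * \<Omega> (k j) (fst (i m)))) \<or>
        (\<forall>m. \<forall>j\<le>m. \<eta> \<le> cmod (f (snd (i m) * k j, fst (i m)) * \<Omega> (snd (i m)) (k j)))"
    for \<eta> and k :: "nat \<Rightarrow> 's" and i :: "nat \<Rightarrow> 's \<times> 's"
  proof -
    \<comment> \<open>All four double sequences at once, so that common subsequences make all repeated limits exist.\<close>
    define u where "u n m = (f (snd (i m), k n * fst (i m)), Omega \<omega> (k n) (fst (i m)),
      f (snd (i m) * k n, fst (i m)), Omega \<omega> (snd (i m)) (k n))" for n m
    have "norm (u n m) \<le> nrm linf f + (1 + (nrm linf f + 1))" for n m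
      unfolding u_def using Omega_nonneg Omega_le_one
      by (intro order_trans[OF norm_Pair_le] add_mono f_le) auto
    then obtain p q :: "nat \<Rightarrow> nat" and L where pq: "strict_mono p" "strict_mono q"
      and L: "repeated_limit (\<lambda>n m. u (p n) (q m)) L"
      by (rule repeated_limit_subsequences)
    have pq_le: "p n \<le> q m" if "p n \<le> m" for n m
      using that strict_mono_imp_increasing[OF pq(2), of m] by simp
    have lim1: "repeated_limit (\<lambda>n m. f (snd (i (q m)), k (p n) * fst (i (q m)))) (fst L)"
      using repeated_limit_continuous[OF L, of fst] by (simp add: u_def)
    have lim2: "repeated_limit (\<lambda>n m. Omega \<omega> (k (p n)) (fst (i (q m)))) (fst (snd L))"
      using repeated_limit_continuous[OF L, of "\<lambda>v. fst (snd v)"] by (simp add: u_def)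
    have lim3: "repeated_limit (\<lambda>n m. f (snd (i (q m)) * k (p n), fst (i (q m)))) (fst (snd (snd L)))"
      using repeated_limit_continuous[OF L, of "\<lambda>v. fst (snd (snd v))"] by (simp add: u_def)
    have lim4: "repeated_limit (\<lambda>n m. Omega \<omega> (snd (i (q m))) (k (p n))) (snd (snd (snd L)))"
      using repeated_limit_continuous[OF L, of "\<lambda>v. snd (snd (snd v))"] by (simp add: u_def)
    have "inj (\<lambda>n. k (p n))" "inj (\<lambda>m. i (q m))"
      using inj_compose[OF k strict_mono_imp_inj_on[OF pq(1)]]
        inj_compose[OF i strict_mono_imp_inj_on[OF pq(2)]] by (simp_all add: o_def)
    then have zero: "fst L = 0 \<or> fst (snd L) = 0" "fst (snd (snd L)) = 0 \<or> snd (snd (snd L)) = 0"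
      using D lim1 lim2 lim3 lim4 unfolding condition_D_def pairing_delta f_eq by blast+
    from large show False
    proof
      assume large: "\<forall>m. \<forall>j\<le>m. \<eta> \<le> cmod (f (snd (i m), k j * fst (i m)) * \<Omega> (k j) (fst (i m)))"
      have "\<eta> \<le> cmod (fst L * of_real (fst (snd L)))"
        by (rule repeated_limit_product_bound[OF lim1 lim2, of p]) (use large pq_le in blast)
      then show False using zero(1) \<eta> by auto
    next
      assume large: "\<forall>m. \<forall>j\<le>m. \<eta> \<le> cmod (f (snd (i m) * k j, fst (i m)) * \<Omega> (snd (i m)) (k j))"
      have "\<eta> \<le> cmod (fst (snd (snd L)) * of_real (snd (snd (snd L))))"
        by (rule repeated_limit_product_bound[OF lim3 lim4, of p]) (use large pq_le in blast)
      then show False using zero(2) \<eta> by auto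
    qed
  qed
  have "(\<lambda>k. \<Lambda> (ract2 ?F (delta k))) \<in> c0" if \<Lambda>: "\<Lambda> \<in> carr (dual_space linf)" for \<Lambda>
  proof (rule ccontr)
    assume not_c0: "(\<lambda>k. \<Lambda> (ract2 ?F (delta k))) \<notin> c0"
    have pointwise: "(\<lambda>k. ract2 ?F (delta k) p) \<in> c0" for p
      unfolding act_delta case_prod_unfold
      by (rule c0_comp[of "\<lambda>s. f (snd p, s)" "\<lambda>k. k * fst p", OF c0_right right_fibres])
        (simp add: norm_mult mult_left_le Omega_nonneg Omega_le_one)
    show False
    proof (rule exists_injective_uniformly_large_values[where x = "\<lambda>k. ract2 ?F (delta k)", OF \<Lambda> _ pointwise not_c0])
      fix k p show "cmod (ract2 ?F (delta k) p) \<le> nrm linf f"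
        unfolding act_delta case_prod_unfold by (simp add: norm_Omega_mult f_le del: norm_mult)
    next
      fix \<eta> and k :: "nat \<Rightarrow> 's" and i :: "nat \<Rightarrow> 's \<times> 's"
      assume "\<eta> > 0" "inj k" "inj i" "\<And>m j. j \<le> m \<Longrightarrow> \<eta> \<le> cmod (ract2 ?F (delta (k j)) (i m))"
      then show False
        by (intro double_limit[of \<eta> k i]) (simp_all add: act_delta case_prod_unfold)
    qed
  qed
  moreover have "(\<lambda>k. \<Lambda> (lact2 (delta k) ?F)) \<in> c0" if \<Lambda>: "\<Lambda> \<in> carr (dual_space linf)" for \<Lambda>
  proof (rule ccontr)
    assume not_c0: "(\<lambda>k. \<Lambda> (lact2 (delta k) ?F)) \<notin> c0"
    have pointwise: "(\<lambda>k. lact2 (delta k) ?F p) \<in> c0" for p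
      unfolding act_delta case_prod_unfold
      by (rule c0_comp[of "\<lambda>s. f (s, fst p)" "\<lambda>k. snd p * k", OF c0_left left_fibres])
        (simp add: norm_mult mult_left_le Omega_nonneg Omega_le_one)
    show False
    proof (rule exists_injective_uniformly_large_values[where x = "\<lambda>k. lact2 (delta k) ?F", OF \<Lambda> _ pointwise not_c0])
      fix k p show "cmod (lact2 (delta k) ?F p) \<le> nrm linf f"
        unfolding act_delta case_prod_unfold by (simp add: norm_Omega_mult f_le del: norm_mult)
    next
      fix \<eta> and k :: "nat \<Rightarrow> 's" and i :: "nat \<Rightarrow> 's \<times> 's"
      assume "\<eta> > 0" "inj k" "inj i" "\<And>m j. j \<le> m \<Longrightarrow> \<eta> \<le> cmod (lact2 (delta (k j)) ?F (i m))"
      then show False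
        by (intro double_limit[of \<eta> k i]) (simp_all add: act_delta case_prod_unfold)
    qed
  qed
  ultimately show ?thesis using F by (simp add: sigma_wc_def)
qed


section \<open>The annihilator of the coproducts\<close>

text \<open>The adjoint of the multiplication, sending \<open>f\<close> to \<open>x \<otimes> y \<mapsto> \<langle>x y, f\<rangle>\<close>.\<close>

definition coproduct :: "('s \<Rightarrow> complex) \<Rightarrow> ('s \<times> 's \<Rightarrow> complex)" where
  "coproduct f = (\<lambda>(g, h). f (g * h) * \<Omega> g h)"

text \<open>The module actions on \<open>\<ell>\<^sup>\<infinity>(S)\<close> and on \<open>\<ell>\<^sup>\<infinity>(S \<times> S)\<close> are intertwined by the coproduct; this
  is the cocycle identity for \<open>\<Omega>\<close>.\<close>

lemma coproduct_act:
  "ract2 (coproduct f) a = coproduct (\<lambda>s. pairing a (\<lambda>k. f (k * s) * \<Omega> k s))"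
  "lact2 a (coproduct f) = coproduct (\<lambda>s. pairing a (\<lambda>k. f (s * k) * \<Omega> s k))"
proof -
  have "f (k * g * h) * \<Omega> (k * g) h * \<Omega> k g = \<Omega> g h * (f (k * (g * h)) * \<Omega> k (g * h))" for k g h
  proof -
    have "f (k * g * h) * \<Omega> (k * g) h * \<Omega> k g = f (k * (g * h)) * (\<Omega> k g * \<Omega> (k * g) h)"
      by (simp add: mult_ac)
    then show ?thesis unfolding Omega_cocycle by (simp add: mult_ac)
  qed
  then show "ract2 (coproduct f) a = coproduct (\<lambda>s. pairing a (\<lambda>k. f (k * s) * \<Omega> k s))"
    by (simp add: ract2_def coproduct_def pairing_scl_right mult.commute)
  have "f (g * (h * k)) * \<Omega> g (h * k) * \<Omega> h k = \<Omega> g h * (f (g * h * k) * \<Omega> (g * h) k)" for k g h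
  proof -
    have "f (g * (h * k)) * \<Omega> g (h * k) * \<Omega> h k = f (g * h * k) * (\<Omega> g (h * k) * \<Omega> h k)"
      by (simp add: mult_ac)
    then show ?thesis unfolding Omega_cocycle[symmetric] by (simp add: mult_ac)
  qed
  then show "lact2 a (coproduct f) = coproduct (\<lambda>s. pairing a (\<lambda>k. f (s * k) * \<Omega> s k))"
    by (simp add: lact2_def coproduct_def pairing_scl_right mult.commute)
qed

lemma coproduct_sigma_wc:
  assumes f: "f \<in> c0" shows "coproduct f \<in> sigma_wc"
proof -
  have f_linf: "f \<in> carr linf" using f c0_subset_linf by blast
  have "coproduct f \<in> carr linf"
    by (rule linfI[of _ "nrm linf f"])
      (auto simp: coproduct_def split: prod.split intro!: norm_Omega_mult linf_le f_linf)
  moreover have "(\<lambda>k. \<Lambda> (ract2 (coproduct f) (delta k))) \<in> c0 \<and> (\<lambda>k. \<Lambda> (lact2 (delta k) (coproduct f))) \<in> c0"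
    if \<Lambda>: "\<Lambda> \<in> carr (dual_space linf)" for \<Lambda>
  proof -
    have w: "cmod (\<Omega> a b * \<Omega> c d) \<le> 1" for a b c d by (rule norm_Omega_mult[OF norm_Omega])
    have "(\<lambda>k. \<Lambda> (\<lambda>p. f (k * (fst p * snd p)) * (\<Omega> k (fst p * snd p) * \<Omega> (fst p) (snd p)))) \<in> c0"
      using left_fibres right_fibres
      by (intro c0_orbit[where \<tau> = "\<lambda>s k. k * s" and \<sigma> = "\<lambda>p. fst p * snd p"] f w \<Lambda>)
    moreover have "(\<lambda>k. \<Lambda> (\<lambda>p. f ((fst p * snd p) * k) * (\<Omega> (fst p * snd p) k * \<Omega> (fst p) (snd p)))) \<in> c0"
      using left_fibres right_fibres
      by (intro c0_orbit[where \<tau> = "\<lambda>s k. s * k" and \<sigma> = "\<lambda>p. fst p * snd p"] f w \<Lambda>)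
    ultimately show ?thesis
      by (simp add: coproduct_act pairing_delta) (simp add: coproduct_def case_prod_unfold mult.assoc)
  qed
  ultimately show ?thesis by (simp add: sigma_wc_def)
qed

definition coproducts :: "('s \<times> 's \<Rightarrow> complex) set" where
  "coproducts = coproduct ` c0"

lemma invariant_coproducts: "invariant_subset (beurling \<omega>) sigma_wc_module coproducts"
proof (intro invariant_subset.intro sigma_wc_bimodule invariant_subset_axioms.intro)
  show "coproducts \<subseteq> carr sigma_wc_module"
    by (auto simp: coproducts_def sigma_wc_module_simps coproduct_sigma_wc)
next
  fix a F assume a: "a \<in> carr (beurling \<omega>)" and "F \<in> coproducts"
  then obtain f where f: "f \<in> c0" "F = coproduct f" by (auto simp: coproducts_def)
  have "ell1 a" using a by (simp add: beurling_simps)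
  from c0_translates[OF this f(1)]
  show "lact sigma_wc_module a F \<in> coproducts" "ract sigma_wc_module F a \<in> coproducts"
    by (simp_all add: f sigma_wc_module_simps coproduct_act coproducts_def)
qed

interpretation diag: invariant_subset "beurling \<omega>" sigma_wc_module coproducts
  by (rule invariant_coproducts)

lemma dual_sigma_wc_module: "dual_space sigma_wc_module = dual_space (linf\<lparr>carr := sigma_wc\<rparr>)"
  by (simp add: dual_space_def bounded_linear_map_def sigma_wc_module_def)

lemma extend_functional:
  assumes "\<Lambda> \<in> carr (dual_space sigma_wc_module)"
  obtains \<Lambda>' where "\<Lambda>' \<in> carr (dual_space linf)" "\<And>F. F \<in> sigma_wc \<Longrightarrow> \<Lambda>' F = \<Lambda> F"
  using Hahn_Banach_linf[OF sigma_wc_subspace] assms unfolding dual_sigma_wc_module by blast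

text \<open>It suffices to test continuity on evaluations: a general element of the predual is a uniform
  limit of evaluations on bounded sets, and functions vanishing at infinity are closed under uniform
  limits.\<close>

lemma weak_star_continuous_into_annihilator:
  assumes B: "\<And>a. ell1 a \<Longrightarrow> B a \<in> carr diag.E"
    and add: "\<And>a b. \<lbrakk>ell1 a; ell1 b\<rbrakk> \<Longrightarrow> B (\<lambda>s. a s + b s) = (\<lambda>F. B a F + B b F)"
    and scl: "\<And>c a. ell1 a \<Longrightarrow> B (\<lambda>s. c * a s) = (\<lambda>F. c * B a F)"
    and bound: "\<And>a. ell1 a \<Longrightarrow> nrm (dual_space sigma_wc_module) (B a) \<le> K * norm1 a"
    and c0: "\<And>F. F \<in> sigma_wc \<Longrightarrow> (\<lambda>k. B (delta k) F) \<in> c0"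
  shows "continuous_map (weak_star (beurling \<omega>) (beurling_predual \<omega>)) (weak_star diag.E diag.Es) B"
proof (rule continuous_map_into_weak_star)
  fix a assume "a \<in> topspace (weak_star (beurling \<omega>) (beurling_predual \<omega>))"
  then show "B a \<in> carr diag.E" using B by (simp add: topspace_weak_star beurling_simps)
next
  fix \<psi> assume \<psi>: "\<psi> \<in> diag.Es"
  interpret E: complex_banach_space diag.E by (rule diag.E_banach)
  note \<psi>' = diag.predual_subset[OF \<psi>]
  show "continuous_map (weak_star (beurling \<omega>) (beurling_predual \<omega>)) euclidean (\<lambda>a. \<psi> (B a))"
  proof (rule weak_star_continuous_functional[where f = "\<lambda>k. \<psi> (B (delta k))"])
    fix a :: "'s \<Rightarrow> complex" assume a: "ell1 a"
    show "\<psi> (B a) = pairing a (\<lambda>k. \<psi> (B (delta k)))"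
    proof (rule pairing_functional[OF _ _ _ a])
      fix a :: "'s \<Rightarrow> complex" assume a: "ell1 a"
      show "cmod (\<psi> (B a)) \<le> nrm (dual_space diag.E) \<psi> * K * norm1 a"
        using order_trans[OF E.functional_le[OF \<psi>' B[OF a]] mult_left_mono[OF _ E.dual_norm_nonneg[OF \<psi>']]]
          bound[OF a] by (simp add: diag.E_simps mult.assoc)
    qed (use E.functional_add[OF \<psi>'] E.functional_scl[OF \<psi>'] B in \<open>simp_all add: add scl diag.E_simps\<close>)
  next
    show "(\<lambda>k. \<psi> (B (delta k))) \<in> c0"
    proof (rule c0_uniform_limit)
      fix \<epsilon> :: real assume "\<epsilon> > 0"
      then have "\<epsilon> / (\<bar>K\<bar> + 1) > 0" by simp
      from diag.predual_approx[OF \<psi> this] obtain F where F: "F \<in> sigma_wc"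
        "\<And>\<Lambda>. \<Lambda> \<in> carr diag.E \<Longrightarrow> cmod (\<psi> \<Lambda> - \<Lambda> F) \<le> \<epsilon> / (\<bar>K\<bar> + 1) * nrm (dual_space sigma_wc_module) \<Lambda>"
        by (auto simp: sigma_wc_module_simps)
      have "cmod (\<psi> (B (delta k)) - B (delta k) F) \<le> \<epsilon>" for k
      proof -
        have "nrm (dual_space sigma_wc_module) (B (delta k)) \<le> \<bar>K\<bar> + 1"
          using bound[OF ell1_delta, of k] by (simp add: norm1_delta)
        then have "\<epsilon> / (\<bar>K\<bar> + 1) * nrm (dual_space sigma_wc_module) (B (delta k)) \<le> \<epsilon> / (\<bar>K\<bar> + 1) * (\<bar>K\<bar> + 1)"
          using \<open>\<epsilon> > 0\<close> by (intro mult_left_mono) auto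
        moreover have "\<epsilon> / (\<bar>K\<bar> + 1) * (\<bar>K\<bar> + 1) = \<epsilon>" by simp
        ultimately show ?thesis using F(2)[OF B[OF ell1_delta], of k] by linarith
      qed
      then show "\<exists>g\<in>c0. \<forall>k. cmod (\<psi> (B (delta k)) - g k) \<le> \<epsilon>"
        by (intro bexI[OF _ c0[OF F(1)]] allI)
    qed
  qed
qed

lemma annihilator_dual_bimodule: "dual_banach_bimodule (beurling \<omega>) diag.E diag.Es"
  by (rule diag.E_dual_bimodule) (auto simp: beurling_simps norm1_nonneg ell1_conv)

text \<open>A functional on \<open>sigma_wc\<close> is the restriction of a functional on all bounded functions, for which
  the orbits of elements of \<open>sigma_wc\<close> vanish at infinity by definition.\<close>

lemma annihilator_normal: "normal_bimodule (beurling \<omega>) (beurling_predual \<omega>) diag.E diag.Es"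
  unfolding normal_bimodule_def
proof (intro ballI conjI)
  fix \<Lambda> assume \<Lambda>: "\<Lambda> \<in> carr diag.E"
  have \<Lambda>': "\<Lambda> \<in> carr (dual_space sigma_wc_module)" using \<Lambda> by (simp add: diag.E_carr)
  obtain \<Phi> where \<Phi>: "\<Phi> \<in> carr (dual_space linf)" "\<And>F. F \<in> sigma_wc \<Longrightarrow> \<Phi> F = \<Lambda> F"
    using extend_functional[OF \<Lambda>'] by blast
  obtain K where K: "\<And>a. ell1 a \<Longrightarrow> dual_lact sigma_wc_module a \<Lambda> \<in> carr diag.E \<and>
      dual_ract sigma_wc_module \<Lambda> a \<in> carr diag.E \<and>
      nrm (dual_space sigma_wc_module) (dual_lact sigma_wc_module a \<Lambda>)
        \<le> K * norm1 a * nrm (dual_space sigma_wc_module) \<Lambda> \<and>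
      nrm (dual_space sigma_wc_module) (dual_ract sigma_wc_module \<Lambda> a)
        \<le> K * norm1 a * nrm (dual_space sigma_wc_module) \<Lambda>"
    using diag.dual_act_closed \<Lambda> norm1_nonneg by (metis beurling_simps(1,5) mem_Collect_eq)
  have bound: "K * norm1 a * nrm (dual_space sigma_wc_module) \<Lambda>
      = (K * nrm (dual_space sigma_wc_module) \<Lambda>) * norm1 a" for a :: "'s \<Rightarrow> complex" by simp
  note lin = diag.functional_add[OF \<Lambda>', unfolded sigma_wc_module_simps]
    diag.functional_scl[OF \<Lambda>', unfolded sigma_wc_module_simps]
  show "continuous_map (weak_star (beurling \<omega>) (beurling_predual \<omega>)) (weak_star diag.E diag.Es) (\<lambda>a. lact diag.E a \<Lambda>)"
    unfolding diag.E_simps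
    by (rule weak_star_continuous_into_annihilator[where K = "K * nrm (dual_space sigma_wc_module) \<Lambda>"])
      (use K bound \<Phi>(2) sigma_wcD(2)[OF _ \<Phi>(1)] in
        \<open>auto simp: dual_lact_def sigma_wc_module_simps fun_eq_iff act_add_algebra act_scl_algebra
          sigma_wcD sigma_wc_act lin ell1_delta\<close>)
  show "continuous_map (weak_star (beurling \<omega>) (beurling_predual \<omega>)) (weak_star diag.E diag.Es) (\<lambda>a. ract diag.E \<Lambda> a)"
    unfolding diag.E_simps
    by (rule weak_star_continuous_into_annihilator[where K = "K * nrm (dual_space sigma_wc_module) \<Lambda>"])
      (use K bound \<Phi>(2) sigma_wcD(3)[OF _ \<Phi>(1)] in
        \<open>auto simp: dual_ract_def sigma_wc_module_simps fun_eq_iff act_add_algebra act_scl_algebra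
          sigma_wcD sigma_wc_act lin ell1_delta\<close>)
qed

end


section \<open>From amenability to a virtual diagonal\<close>

locale unital_beurling_algebra = weighted_weakly_cancellative_semigroup \<omega>
  for \<omega> :: "'s::semigroup_mult \<Rightarrow> real" +
  fixes e :: "'s \<Rightarrow> complex"
  assumes ell1_unit: "ell1 e"
    and left_unit: "ell1 a \<Longrightarrow> e \<star> a = a"
    and right_unit: "ell1 a \<Longrightarrow> a \<star> e = a"
begin

interpretation diag: invariant_subset "beurling \<omega>" sigma_wc_module coproducts
  by (rule invariant_coproducts)

text \<open>The functional \<open>e \<otimes> e\<close>.\<close>

definition unit_tensor :: "('s \<times> 's \<Rightarrow> complex) \<Rightarrow> complex" where
  "unit_tensor F = (if F \<in> carr linf then pairing e (\<lambda>g. pairing e (\<lambda>h. F (g, h))) else 0)"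

lemma unit_tensor_dual: "unit_tensor \<in> carr (dual_space linf)"
proof -
  have row: "(\<lambda>h. F (g, h)) \<in> carr linf" and row_le: "cmod (pairing e (\<lambda>h. F (g, h))) \<le> norm1 e * nrm linf F"
    and rows: "(\<lambda>g. pairing e (\<lambda>h. F (g, h))) \<in> carr linf"
    if F: "F \<in> carr linf" for F :: "'s \<times> 's \<Rightarrow> complex" and g
  proof -
    show "(\<lambda>h. F (g, h)) \<in> carr linf" by (rule linfI) (rule linf_le[OF F])
    have le: "cmod (pairing e (\<lambda>h. F (g, h))) \<le> norm1 e * nrm linf F" for g
      by (rule pairing_le[OF ell1_unit]) (rule linf_le[OF F])
    show "cmod (pairing e (\<lambda>h. F (g, h))) \<le> norm1 e * nrm linf F" by (rule le)
    show "(\<lambda>g. pairing e (\<lambda>h. F (g, h))) \<in> carr linf" by (rule linfI) (rule le)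
  qed
  show ?thesis
  proof (rule linf.functionalI)
    fix F :: "'s \<times> 's \<Rightarrow> complex" assume F: "F \<in> carr linf"
    have "cmod (pairing e (\<lambda>g. pairing e (\<lambda>h. F (g, h)))) \<le> norm1 e * (norm1 e * nrm linf F)"
      by (rule pairing_le[OF ell1_unit row_le[OF F]])
    then show "cmod (unit_tensor F) \<le> norm1 e * norm1 e * nrm linf F"
      using F by (simp add: unit_tensor_def mult.assoc)
  qed (auto simp: unit_tensor_def linf_simps linf_add linf_scl pairing_add_right pairing_scl_right
      ell1_unit row rows)
qed

lemma unit_tensor_coproduct:
  assumes f: "f \<in> carr linf" shows "unit_tensor (coproduct f) = pairing e f"
proof -
  have "coproduct f \<in> carr linf"
    by (rule linfI[of _ "nrm linf f"])
      (auto simp: coproduct_def split: prod.split intro!: norm_Omega_mult linf_le f)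
  then have "unit_tensor (coproduct f) = pairing (e \<star> e) f"
    by (simp add: unit_tensor_def pairing_conv ell1_unit f) (simp add: coproduct_def)
  then show ?thesis by (simp add: left_unit ell1_unit)
qed

lemma unit_tensor_coproduct_act:
  assumes f: "f \<in> c0" and a: "ell1 a"
  shows "unit_tensor (ract2 (coproduct f) a) = pairing a f"
    "unit_tensor (lact2 a (coproduct f)) = pairing a f"
proof -
  have f_linf: "f \<in> carr linf" using f c0_subset_linf by blast
  have r: "(\<lambda>s. pairing a (\<lambda>k. f (k * s) * \<Omega> k s)) \<in> carr linf"
    and l: "(\<lambda>s. pairing a (\<lambda>k. f (s * k) * \<Omega> s k)) \<in> carr linf"
    using c0_translates[OF a f] c0_subset_linf by auto
  have "unit_tensor (ract2 (coproduct f) a) = pairing e (\<lambda>s. pairing a (\<lambda>k. f (k * s) * \<Omega> k s))"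
    by (simp only: coproduct_act unit_tensor_coproduct[OF r])
  also have "\<dots> = pairing a (\<lambda>k. pairing e (\<lambda>s. f (k * s) * \<Omega> k s))"
    by (rule pairing_swap[OF ell1_unit a]) (rule norm_Omega_mult, rule linf_le[OF f_linf])
  also have "\<dots> = pairing (a \<star> e) f" by (simp add: pairing_conv a ell1_unit f_linf)
  finally show "unit_tensor (ract2 (coproduct f) a) = pairing a f" by (simp add: right_unit a)
  have "unit_tensor (lact2 a (coproduct f)) = pairing e (\<lambda>s. pairing a (\<lambda>k. f (s * k) * \<Omega> s k))"
    by (simp only: coproduct_act unit_tensor_coproduct[OF l])
  also have "\<dots> = pairing (e \<star> a) f" by (simp add: pairing_conv a ell1_unit f_linf)
  finally show "unit_tensor (lact2 a (coproduct f)) = pairing a f" by (simp add: left_unit a)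
qed

text \<open>The map \<open>a \<mapsto> a \<cdot> (e \<otimes> e) - (e \<otimes> e) \<cdot> a\<close>, restricted to \<open>sigma_wc\<close>. It vanishes on coproducts
  because \<open>a \<star> e = a = e \<star> a\<close>, so that its values lie in the annihilator although \<open>e \<otimes> e\<close> does not.\<close>

definition commutator :: "('s \<Rightarrow> complex) \<Rightarrow> ('s \<times> 's \<Rightarrow> complex) \<Rightarrow> complex" where
  "commutator a F = (if F \<in> sigma_wc then unit_tensor (ract2 F a) - unit_tensor (lact2 a F) else 0)"

lemma unit_tensor_lin:
  "\<lbrakk>F \<in> carr linf; G \<in> carr linf\<rbrakk> \<Longrightarrow> unit_tensor (\<lambda>p. F p + G p) = unit_tensor F + unit_tensor G"
  "F \<in> carr linf \<Longrightarrow> unit_tensor (\<lambda>p. c * F p) = c * unit_tensor F"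
  using linf.functional_add[OF unit_tensor_dual] linf.functional_scl[OF unit_tensor_dual]
  by (simp_all add: linf_simps)

lemma commutator_annihilator:
  assumes a: "ell1 a"
  shows "commutator a \<in> carr diag.E"
    "nrm (dual_space sigma_wc_module) (commutator a) \<le> 2 * nrm (dual_space linf) unit_tensor * norm1 a"
proof -
  let ?U = "nrm (dual_space linf) unit_tensor"
  have U: "0 \<le> ?U" by (rule linf.dual_norm_nonneg[OF unit_tensor_dual])
  have le: "cmod (commutator a F) \<le> (2 * ?U * norm1 a) * nrm linf F" if F: "F \<in> sigma_wc" for F
  proof -
    have F': "F \<in> carr linf" using F by (rule sigma_wcD)
    have "cmod (unit_tensor (ract2 F a)) \<le> ?U * (norm1 a * nrm linf F)"
      "cmod (unit_tensor (lact2 a F)) \<le> ?U * (norm1 a * nrm linf F)"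
      using order_trans[OF linf.functional_le[OF unit_tensor_dual] mult_left_mono[OF _ U]] act_closed[OF a F']
      by blast+
    then show ?thesis
      using F norm_triangle_ineq4[of "unit_tensor (ract2 F a)" "unit_tensor (lact2 a F)"]
      by (simp add: commutator_def)
  qed
  have "commutator a \<in> carr (dual_space sigma_wc_module)"
    using diag.add_closed diag.scl_closed le
    by (intro diag.functionalI[where K = "2 * ?U * norm1 a"])
      (auto simp: sigma_wc_module_simps commutator_def sigma_wcD act_add act_scl a act_closed
        unit_tensor_lin algebra_simps)
  moreover have "commutator a F = 0" if "F \<in> coproducts" for F
    using that unit_tensor_coproduct_act[OF _ a] by (auto simp: coproducts_def commutator_def)
  ultimately show "commutator a \<in> carr diag.E" by (simp add: diag.E_carr)
  show "nrm (dual_space sigma_wc_module) (commutator a) \<le> 2 * ?U * norm1 a"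
    using le U norm1_nonneg[of a] by (intro diag.dual_norm_le) (auto simp: sigma_wc_module_simps)
qed

lemma commutator_lin:
  "\<lbrakk>ell1 a; ell1 b\<rbrakk> \<Longrightarrow> commutator (\<lambda>s. a s + b s) = (\<lambda>F. commutator a F + commutator b F)"
  "ell1 a \<Longrightarrow> commutator (\<lambda>s. c * a s) = (\<lambda>F. c * commutator a F)"
  by (auto simp: commutator_def fun_eq_iff act_add_algebra act_scl_algebra sigma_wcD act_closed
      unit_tensor_lin algebra_simps)

lemma commutator_derivation: "derivation (beurling \<omega>) diag.E commutator"
proof -
  have "commutator (a \<star> b) = (\<lambda>F. dual_ract sigma_wc_module (commutator a) b F +
      dual_lact sigma_wc_module a (commutator b) F)" if "ell1 a" "ell1 b" for a b
    using that
    by (auto simp: commutator_def dual_ract_def dual_lact_def sigma_wc_module_simps sigma_wc_act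
        ract2_conv lact2_conv lact2_ract2 sigma_wcD fun_eq_iff)
  then show ?thesis
    using commutator_annihilator
    by (auto simp: derivation_def bounded_linear_map_def diag.E_simps beurling_simps commutator_lin)
qed

lemma commutator_continuous:
  "continuous_map (weak_star (beurling \<omega>) (beurling_predual \<omega>)) (weak_star diag.E diag.Es) commutator"
proof (rule weak_star_continuous_into_annihilator[OF _ _ _ commutator_annihilator(2)])
  fix F assume F: "F \<in> sigma_wc"
  show "(\<lambda>k. commutator (delta k) F) \<in> c0"
    using F c0_add[OF sigma_wcD(2)[OF F unit_tensor_dual] c0_scl[OF sigma_wcD(3)[OF F unit_tensor_dual], of "-1"]]
    by (simp add: commutator_def)
qed (simp_all add: commutator_annihilator commutator_lin)

text \<open>If \<open>\<Lambda>\<close> in the annihilator implements the commutator at \<open>\<delta>\<^sub>k\<close>, then \<open>e \<otimes> e - \<Lambda>\<close> commutes with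
  \<open>\<delta>\<^sub>k\<close> on \<open>sigma_wc\<close> and takes the same values as \<open>e \<otimes> e\<close> on coproducts. Extending \<open>\<Lambda>\<close>
  to all bounded functions gives \<open>M\<close>.\<close>

theorem pointwise_connes_amenable_imp_condition_2:
  assumes "pointwise_connes_amenable TYPE(('s \<times> 's \<Rightarrow> complex) \<Rightarrow> complex)
    (beurling \<omega>) (beurling_predual \<omega>)"
  shows "condition_2 \<omega> e"
  unfolding condition_2_def
proof
  fix k :: 's
  have "delta k \<in> carr (beurling \<omega>)" by (simp add: beurling_simps ell1_delta)
  then obtain \<Lambda> where \<Lambda>: "\<Lambda> \<in> carr diag.E"
    and inner: "commutator (delta k) = sub diag.E (lact diag.E (delta k) \<Lambda>) (ract diag.E \<Lambda> (delta k))"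
    using assms annihilator_dual_bimodule annihilator_normal commutator_derivation commutator_continuous
    unfolding pointwise_connes_amenable_def pointwise_connes_amenable_at_def by blast
  obtain \<Phi> where \<Phi>: "\<Phi> \<in> carr (dual_space linf)" "\<And>F. F \<in> sigma_wc \<Longrightarrow> \<Phi> F = \<Lambda> F"
    using extend_functional \<Lambda> by (auto simp: diag.E_carr)
  define M where "M F = unit_tensor F - \<Phi> F" for F
  have M: "M \<in> carr (dual_space linf)"
    using complex_banach_space.sub_closed[OF linf.dual_space_banach unit_tensor_dual \<Phi>(1)]
    by (simp add: linf.dual_space_sub M_def[abs_def])
  moreover have "M (\<lambda>(g, h). f (h * k, g) * \<Omega> h k - f (h, k * g) * \<Omega> k g) = 0"
    if f: "f \<in> carr linf" and T: "bounded_linear_map (beurling \<omega>) linf T"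
      "\<forall>g h. pairing (delta h) (T (delta g)) = f (g, h)" "condition_D \<omega> T" for f T
  proof -
    let ?F = "\<lambda>(g, h). f (h, g)"
    have "T (delta g) \<in> carr linf" for g
      using T(1) by (simp add: bounded_linear_map_def beurling_simps ell1_delta)
    then have F: "?F \<in> sigma_wc" using condition_D_imp_sigma_wc[OF f] T by blast
    then have F': "?F \<in> carr linf" by (rule sigma_wcD)
    have eq: "(\<lambda>(g, h). f (h * k, g) * \<Omega> h k - f (h, k * g) * \<Omega> k g)
        = sub linf (lact2 (delta k) ?F) (ract2 ?F (delta k))"
      by (auto simp: act_delta linf_simps)
    have "M (\<lambda>(g, h). f (h * k, g) * \<Omega> h k - f (h, k * g) * \<Omega> k g)
        = M (lact2 (delta k) ?F) - M (ract2 ?F (delta k))"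
      unfolding eq
      by (rule linf.functional_sub[OF M act_closed(2,1)[OF ell1_delta F']])
    also have "\<dots> = (unit_tensor (lact2 (delta k) ?F) - \<Lambda> (lact2 (delta k) ?F))
        - (unit_tensor (ract2 ?F (delta k)) - \<Lambda> (ract2 ?F (delta k)))"
      by (simp add: M_def \<Phi>(2) sigma_wc_act[OF F ell1_delta])
    also have "\<dots> = 0"
    proof -
      have "commutator (delta k) ?F = \<Lambda> (ract2 ?F (delta k)) - \<Lambda> (lact2 (delta k) ?F)"
        using F inner by (simp add: diag.E_simps dual_lact_def dual_ract_def sigma_wc_module_simps)
      then show ?thesis using F by (simp add: commutator_def algebra_simps)
    qed
    finally show ?thesis .
  qed
  moreover have "M (\<lambda>(g, h). f (g * h) * \<Omega> g h) = pairing e f" if f: "f \<in> c0" for f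
  proof -
    have "\<Phi> (coproduct f) = 0"
    proof -
      have "coproduct f \<in> coproducts" using f by (simp add: coproducts_def)
      then show ?thesis using \<Phi>(2)[OF coproduct_sigma_wc[OF f]] \<Lambda> by (simp add: diag.E_carr)
    qed
    moreover have "f \<in> carr linf" using f c0_subset_linf by blast
    ultimately have "M (coproduct f) = pairing e f" by (simp add: M_def unit_tensor_coproduct)
    then show ?thesis by (simp add: coproduct_def)
  qed
  ultimately show "\<exists>M\<in>carr (dual_space linf).
      (\<forall>f\<in>carr linf. \<forall>T. bounded_linear_map (beurling \<omega>) linf T \<and>
         (\<forall>g h. pairing (delta h) (T (delta g)) = f (g, h)) \<and> condition_D \<omega> T \<longrightarrow>
         M (\<lambda>(g, h). f (h * k, g) * \<Omega> h k - f (h, k * g) * \<Omega> k g) = 0) \<and>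
      (\<forall>f\<in>c0. M (\<lambda>(g, h). f (g * h) * \<Omega> g h) = pairing e f)"
    by blast
qed

end


section \<open>From a virtual diagonal to amenability at point masses\<close>

locale weak_star_derivation = unital_beurling_algebra \<omega> e
  for \<omega> :: "'s::semigroup_mult \<Rightarrow> real" and e :: "'s \<Rightarrow> complex" +
  fixes E :: "('s \<Rightarrow> complex, 'e) cbimodule" and Es :: "('e \<Rightarrow> complex) set"
    and D :: "('s \<Rightarrow> complex) \<Rightarrow> 'e"
  assumes dual: "dual_banach_bimodule (beurling \<omega>) E Es"
    and normal: "normal_bimodule (beurling \<omega>) (beurling_predual \<omega>) E Es"
    and derivation: "derivation (beurling \<omega>) E D"
    and continuous:
      "continuous_map (weak_star (beurling \<omega>) (beurling_predual \<omega>)) (weak_star E Es) D"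
begin

sublocale E: banach_bimodule "beurling \<omega>" E
  using dual by (simp add: dual_banach_bimodule_def)

sublocale Es: complex_banach_space "dual_space E\<lparr>carr := Es\<rparr>"
  using dual complex_banach_space.closed_subspace_banach[OF E.dual_space_banach]
  by (simp add: dual_banach_bimodule_def)

abbreviation lact_E (infixr "\<rhd>" 75) where "a \<rhd> x \<equiv> lact E a x"
abbreviation ract_E (infixl "\<lhd>" 75) where "x \<lhd> a \<equiv> ract E x a"

lemma Es_dual: "\<phi> \<in> Es \<Longrightarrow> \<phi> \<in> carr (dual_space E)"
  using dual by (auto simp: dual_banach_bimodule_def linear_subspace_def)

lemma Es_act: "\<lbrakk>\<phi> \<in> Es; ell1 a\<rbrakk> \<Longrightarrow> dual_lact E a \<phi> \<in> Es" "\<lbrakk>\<phi> \<in> Es; ell1 a\<rbrakk> \<Longrightarrow> dual_ract E \<phi> a \<in> Es"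
  using dual by (auto simp: dual_banach_bimodule_def beurling_simps)

lemma act_in_E [simp]: "\<lbrakk>ell1 a; x \<in> carr E\<rbrakk> \<Longrightarrow> a \<rhd> x \<in> carr E" "\<lbrakk>ell1 a; x \<in> carr E\<rbrakk> \<Longrightarrow> x \<lhd> a \<in> carr E"
  by (simp_all add: E.lact_closed E.ract_closed beurling_simps)

lemma D_in_E [simp]: "ell1 a \<Longrightarrow> D a \<in> carr E"
  using derivation by (simp add: derivation_def bounded_linear_map_def beurling_simps)

lemma D_lin:
  "\<lbrakk>ell1 a; ell1 b\<rbrakk> \<Longrightarrow> D (\<lambda>s. a s + b s) = add E (D a) (D b)"
  "ell1 a \<Longrightarrow> D (\<lambda>s. c * a s) = scl E c (D a)"
  using derivation by (simp_all add: derivation_def bounded_linear_map_def beurling_simps)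

lemma D_conv: "\<lbrakk>ell1 a; ell1 b\<rbrakk> \<Longrightarrow> D (a \<star> b) = add E (D a \<lhd> b) (a \<rhd> D b)"
  using derivation by (simp add: derivation_def beurling_simps)

lemma E_separated:
  assumes "x \<in> carr E" "y \<in> carr E" "\<And>\<phi>. \<phi> \<in> Es \<Longrightarrow> \<phi> x = \<phi> y"
  shows "x = y"
proof -
  have "inj_on (canonical_map Es) (carr E)"
    using dual by (simp add: dual_banach_bimodule_def Let_def bij_betw_def)
  moreover have "canonical_map Es x = canonical_map Es y"
    using assms(3) by (simp add: canonical_map_def fun_eq_iff)
  ultimately show ?thesis using assms(1,2) by (simp add: inj_on_eq_iff)
qed

text \<open>The integral of a bounded family with respect to \<open>\<Lambda>\<close> exists in a dual space, since
  \<open>\<phi> \<mapsto> \<Lambda> (\<lambda>i. \<phi> (y i))\<close> is a bounded functional on the predual. It is used both for \<open>M\<close> and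
  for weak* cluster points of sequences.\<close>

lemma weak_star_integral:
  fixes y :: "'i \<Rightarrow> 'e"
  assumes \<Lambda>: "\<Lambda> \<in> carr (dual_space linf)" and y: "\<And>i. y i \<in> carr E" and bound: "\<And>i. nrm E (y i) \<le> C"
  obtains z where "z \<in> carr E" "\<And>\<phi>. \<phi> \<in> Es \<Longrightarrow> \<phi> z = \<Lambda> (\<lambda>i. \<phi> (y i))"
proof -
  have C: "0 \<le> C" using order_trans[OF E.norm_nonneg[OF y] bound] .
  have le: "cmod (\<phi> (y i)) \<le> nrm (dual_space E) \<phi> * C" if "\<phi> \<in> Es" for \<phi> i
    using order_trans[OF E.functional_le[OF Es_dual[OF that] y]
        mult_left_mono[OF bound E.dual_norm_nonneg[OF Es_dual[OF that]]]] .
  have in_linf: "(\<lambda>i. \<phi> (y i)) \<in> carr linf" if "\<phi> \<in> Es" for \<phi>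
    by (rule linfI[OF le[OF that]])
  define \<Psi> where "\<Psi> \<phi> = (if \<phi> \<in> Es then \<Lambda> (\<lambda>i. \<phi> (y i)) else 0)" for \<phi>
  have "\<Psi> \<in> carr (dual_space (dual_space E\<lparr>carr := Es\<rparr>))"
  proof (rule Es.functionalI)
    fix \<phi> assume "\<phi> \<in> carr (dual_space E\<lparr>carr := Es\<rparr>)"
    then have \<phi>: "\<phi> \<in> Es" by simp
    have "cmod (\<Lambda> (\<lambda>i. \<phi> (y i))) \<le> nrm (dual_space linf) \<Lambda> * (nrm (dual_space E) \<phi> * C)"
      using order_trans[OF linf.functional_le[OF \<Lambda> in_linf[OF \<phi>]]
          mult_left_mono[OF linf_norm_le[OF le[OF \<phi>]] linf.dual_norm_nonneg[OF \<Lambda>]]] .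
    then show "cmod (\<Psi> \<phi>) \<le> (nrm (dual_space linf) \<Lambda> * C) * nrm (dual_space E\<lparr>carr := Es\<rparr>) \<phi>"
      using \<phi> by (simp add: \<Psi>_def mult_ac)
  next
    fix \<phi> \<psi> assume "\<phi> \<in> carr (dual_space E\<lparr>carr := Es\<rparr>)" "\<psi> \<in> carr (dual_space E\<lparr>carr := Es\<rparr>)"
    then show "\<Psi> (add (dual_space E\<lparr>carr := Es\<rparr>) \<phi> \<psi>) = \<Psi> \<phi> + \<Psi> \<psi>"
      using Es.add_closed[of \<phi> \<psi>] linf.functional_add[OF \<Lambda> in_linf[of \<phi>] in_linf[of \<psi>]]
      by (simp add: \<Psi>_def E.dual_space_add linf_simps)
  next
    fix c \<phi> assume "\<phi> \<in> carr (dual_space E\<lparr>carr := Es\<rparr>)"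
    then show "\<Psi> (scl (dual_space E\<lparr>carr := Es\<rparr>) c \<phi>) = c * \<Psi> \<phi>"
      using Es.scl_closed[of \<phi> c] linf.functional_scl[OF \<Lambda> in_linf[of \<phi>], of c]
      by (simp add: \<Psi>_def E.dual_space_scl linf_simps)
  qed (simp add: \<Psi>_def)
  moreover have "bij_betw (canonical_map Es) (carr E) (carr (dual_space (dual_space E\<lparr>carr := Es\<rparr>)))"
    using dual by (simp add: dual_banach_bimodule_def Let_def)
  ultimately obtain z where z: "z \<in> carr E" "canonical_map Es z = \<Psi>"
    unfolding bij_betw_def by (metis imageE)
  have "\<phi> z = \<Lambda> (\<lambda>i. \<phi> (y i))" if "\<phi> \<in> Es" for \<phi>
    using fun_cong[OF z(2), of \<phi>] that by (simp add: canonical_map_def \<Psi>_def)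
  then show ?thesis using that z(1) by blast
qed

lemma c0_functional_of_map:
  assumes "continuous_map (weak_star (beurling \<omega>) (beurling_predual \<omega>)) (weak_star E Es) B"
    and "B (\<lambda>_. 0) = zer E" and \<phi>: "\<phi> \<in> Es"
  shows "(\<lambda>s. \<phi> (B (delta s))) \<in> c0"
proof -
  have "continuous_map (weak_star (beurling \<omega>) (beurling_predual \<omega>)) euclidean (\<lambda>a. \<phi> (B a))"
    using continuous_map_compose[OF assms(1) continuous_map_weak_star_functional[OF \<phi>]] by (simp add: o_def)
  then show ?thesis
    by (rule weak_star_continuous_imp_c0) (simp add: assms(2) E.functional_zero[OF Es_dual[OF \<phi>]])
qed

lemma act_zero: "x \<in> carr E \<Longrightarrow> (\<lambda>_. 0) \<rhd> x = zer E" "x \<in> carr E \<Longrightarrow> x \<lhd> (\<lambda>_. 0) = zer E"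
  using E.lact_scl_left[of "\<lambda>_. 0" x 0] E.ract_scl_right[of "\<lambda>_. 0" x 0] E.scl_zero_left
  by (auto simp: beurling_simps)

lemma D_zero: "D (\<lambda>_. 0) = zer E"
  using D_lin(2)[of "\<lambda>_. 0" 0] E.scl_zero_left by simp

lemma c0_coefficients:
  assumes \<phi>: "\<phi> \<in> Es"
  shows "x \<in> carr E \<Longrightarrow> (\<lambda>s. \<phi> (delta s \<rhd> x)) \<in> c0"
    "x \<in> carr E \<Longrightarrow> (\<lambda>s. \<phi> (x \<lhd> delta s)) \<in> c0"
    "(\<lambda>s. \<phi> (D (delta s))) \<in> c0"
  using normal continuous
  by (auto intro!: c0_functional_of_map[OF _ _ \<phi>, of "\<lambda>a. a \<rhd> x"]
      c0_functional_of_map[OF _ _ \<phi>, of "\<lambda>a. x \<lhd> a"] c0_functional_of_map[OF _ _ \<phi>]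
      simp: normal_bimodule_def act_zero D_zero)

lemma lact_delta_D_bounded:
  obtains C where "\<And>a g. ell1 a \<Longrightarrow> nrm E (delta g \<rhd> D a) \<le> C * norm1 a"
proof -
  obtain K where K: "\<And>a. a \<in> carr (beurling \<omega>) \<Longrightarrow> nrm E (D a) \<le> K * nrm (beurling \<omega>) a"
    using derivation unfolding derivation_def bounded_linear_map_def by blast
  obtain L where L: "\<And>a x. \<lbrakk>a \<in> carr (beurling \<omega>); x \<in> carr E\<rbrakk> \<Longrightarrow> nrm E (a \<rhd> x) \<le> L * nrm (beurling \<omega>) a * nrm E x"
    using E.actions_bounded by blast
  have "nrm E (delta g \<rhd> D a) \<le> \<bar>L\<bar> * K * norm1 a" if a: "ell1 a" for a g
  proof -
    have "nrm E (delta g \<rhd> D a) \<le> L * nrm E (D a)"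
      using L[of "delta g" "D a"] a by (simp add: beurling_simps ell1_delta norm1_delta)
    also have "\<dots> \<le> \<bar>L\<bar> * nrm E (D a)"
      by (intro mult_right_mono) (simp_all add: E.norm_nonneg a)
    also have "\<dots> \<le> \<bar>L\<bar> * (K * norm1 a)"
      using K[of a] a by (intro mult_left_mono) (simp_all add: beurling_simps)
    finally show ?thesis by (simp add: mult.assoc)
  qed
  then show ?thesis using that by blast
qed

lemma orbit_bounded:
  obtains C where "\<And>g h. nrm E (delta g \<rhd> D (delta h)) \<le> C"
proof -
  obtain C where "\<And>a g. ell1 a \<Longrightarrow> nrm E (delta g \<rhd> D a) \<le> C * norm1 a"
    using lact_delta_D_bounded by blast
  from this[OF ell1_delta] show ?thesis by (intro that[of C]) (simp add: norm1_delta)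
qed

lemma lact_conv: "\<lbrakk>ell1 a; ell1 b; x \<in> carr E\<rbrakk> \<Longrightarrow> (a \<star> b) \<rhd> x = a \<rhd> (b \<rhd> x)"
  by (simp add: E.lact_mul beurling_simps)

lemma functional_delta_delta:
  assumes \<phi>: "\<phi> \<in> Es" and x: "x \<in> carr E"
  shows "\<phi> (delta g \<rhd> (delta h \<rhd> x)) = \<phi> (delta (g * h) \<rhd> x) * \<Omega> g h"
proof -
  have "delta g \<rhd> (delta h \<rhd> x) = (\<lambda>s. \<Omega> g h * delta (g * h) s) \<rhd> x"
    using lact_conv[OF ell1_delta ell1_delta x, of g h] by (simp add: conv_delta)
  also have "\<dots> = scl E (\<Omega> g h) (delta (g * h) \<rhd> x)"
    using E.lact_scl_left[of "delta (g * h)" x "\<Omega> g h"] x by (simp add: beurling_simps ell1_delta)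
  finally show ?thesis using E.functional_scl[OF Es_dual[OF \<phi>]] x by (simp add: ell1_delta mult.commute)
qed

text \<open>The derivation rule for \<open>\<delta>\<^sub>h \<star> \<delta>\<^sub>k\<close>, multiplied by \<open>\<delta>\<^sub>g\<close> from the left.\<close>

lemma functional_D_delta:
  assumes \<phi>: "\<phi> \<in> Es"
  shows "\<phi> (delta g \<rhd> D (delta (h * k))) * \<Omega> h k
    = \<phi> ((delta g \<rhd> D (delta h)) \<lhd> delta k) + \<phi> (delta (g * h) \<rhd> D (delta k)) * \<Omega> g h"
proof -
  have "scl E (\<Omega> h k) (D (delta (h * k))) = add E (D (delta h) \<lhd> delta k) (delta h \<rhd> D (delta k))"
    using D_conv[OF ell1_delta ell1_delta, of h k] by (simp add: conv_delta D_lin ell1_delta)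
  then have "delta g \<rhd> scl E (\<Omega> h k) (D (delta (h * k)))
      = add E (delta g \<rhd> (D (delta h) \<lhd> delta k)) (delta g \<rhd> (delta h \<rhd> D (delta k)))"
    by (simp add: E.lact_add_right beurling_simps ell1_delta)
  then have "scl E (\<Omega> h k) (delta g \<rhd> D (delta (h * k)))
      = add E ((delta g \<rhd> D (delta h)) \<lhd> delta k) (delta g \<rhd> (delta h \<rhd> D (delta k)))"
    by (simp add: E.lact_scl_right E.lact_ract beurling_simps ell1_delta)
  from arg_cong[OF this, of \<phi>] show ?thesis
    using \<phi> by (simp add: E.functional_add[OF Es_dual] E.functional_scl[OF Es_dual] ell1_delta
        functional_delta_delta mult.commute)
qed

text \<open>The operator with \<open>\<langle>\<delta>\<^sub>h, T \<delta>\<^sub>g\<rangle> = \<phi>(\<delta>\<^sub>h \<rhd> D \<delta>\<^sub>g)\<close>.\<close>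

definition orbit_operator :: "('e \<Rightarrow> complex) \<Rightarrow> ('s \<Rightarrow> complex) \<Rightarrow> ('s \<Rightarrow> complex)" where
  "orbit_operator \<phi> a = (\<lambda>g. \<phi> (delta g \<rhd> D a))"

lemma orbit_operator_bounded:
  assumes \<phi>: "\<phi> \<in> Es"
  shows "bounded_linear_map (beurling \<omega>) linf (orbit_operator \<phi>)"
proof -
  note \<phi>' = Es_dual[OF \<phi>]
  obtain C where C: "\<And>a g. ell1 a \<Longrightarrow> nrm E (delta g \<rhd> D a) \<le> C * norm1 a"
    using lact_delta_D_bounded by blast
  let ?C = "nrm (dual_space E) \<phi> * C"
  have le: "cmod (orbit_operator \<phi> a g) \<le> ?C * norm1 a" if a: "ell1 a" for a g
  proof -
    have "cmod (orbit_operator \<phi> a g) \<le> nrm (dual_space E) \<phi> * nrm E (delta g \<rhd> D a)"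
      unfolding orbit_operator_def by (intro E.functional_le[OF \<phi>'] act_in_E ell1_delta D_in_E a)
    also have "\<dots> \<le> nrm (dual_space E) \<phi> * (C * norm1 a)"
      by (rule mult_left_mono[OF C[OF a] E.dual_norm_nonneg[OF \<phi>']])
    finally show ?thesis by (simp add: mult.assoc)
  qed
  have "\<forall>a\<in>carr (beurling \<omega>). nrm linf (orbit_operator \<phi> a) \<le> ?C * nrm (beurling \<omega>) a"
    using le by (auto simp: beurling_simps intro: linf_norm_le)
  moreover have "\<forall>a\<in>carr (beurling \<omega>). orbit_operator \<phi> a \<in> carr linf"
    using le by (auto simp: beurling_simps intro: linfI)
  ultimately show ?thesis
    unfolding bounded_linear_map_def
    by (auto simp: orbit_operator_def linf_simps beurling_simps(1,3,4) D_lin E.lact_add_right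
        E.lact_scl_right ell1_delta E.functional_add[OF \<phi>'] E.functional_scl[OF \<phi>'])
qed

lemma pairing_orbit:
  assumes \<phi>: "\<phi> \<in> Es" and a: "ell1 a" and x: "x \<in> carr E"
  shows "pairing a (\<lambda>g. \<phi> (delta g \<rhd> x)) = \<phi> (a \<rhd> x)"
proof -
  note \<phi>' = Es_dual[OF \<phi>]
  obtain L where L: "\<And>a x. \<lbrakk>a \<in> carr (beurling \<omega>); x \<in> carr E\<rbrakk> \<Longrightarrow> nrm E (a \<rhd> x) \<le> L * nrm (beurling \<omega>) a * nrm E x"
    using E.actions_bounded by blast
  have "\<phi> (a \<rhd> x) = pairing a (\<lambda>g. \<phi> (delta g \<rhd> x))"
  proof (rule pairing_functional[where \<theta> = "\<lambda>a. \<phi> (a \<rhd> x)", OF _ _ _ a])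
    fix a :: "'s \<Rightarrow> complex" assume a: "ell1 a"
    have "cmod (\<phi> (a \<rhd> x)) \<le> nrm (dual_space E) \<phi> * (L * norm1 a * nrm E x)"
      using order_trans[OF E.functional_le[OF \<phi>'] mult_left_mono[OF _ E.dual_norm_nonneg[OF \<phi>']]]
        L[of a x] a x by (simp add: beurling_simps)
    then show "cmod (\<phi> (a \<rhd> x)) \<le> (nrm (dual_space E) \<phi> * L * nrm E x) * norm1 a" by (simp add: mult_ac)
  next
    fix a b :: "'s \<Rightarrow> complex" assume "ell1 a" "ell1 b"
    then show "\<phi> ((\<lambda>s. a s + b s) \<rhd> x) = \<phi> (a \<rhd> x) + \<phi> (b \<rhd> x)"
      using E.lact_add_left[of a b x] x by (simp add: beurling_simps E.functional_add[OF \<phi>'])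
  next
    fix c and a :: "'s \<Rightarrow> complex" assume "ell1 a"
    then show "\<phi> ((\<lambda>s. c * a s) \<rhd> x) = c * \<phi> (a \<rhd> x)"
      using E.lact_scl_left[of a x c] x by (simp add: beurling_simps E.functional_scl[OF \<phi>'])
  qed
  then show ?thesis ..
qed

end


context weak_star_derivation
begin

lemma functional_shift:
  assumes "\<phi> \<in> Es" "ell1 a"
  shows "x \<in> carr E \<Longrightarrow> dual_ract E \<phi> a x = \<phi> (a \<rhd> x)" "x \<in> carr E \<Longrightarrow> dual_lact E a \<phi> x = \<phi> (x \<lhd> a)"
  by (simp_all add: dual_ract_def dual_lact_def)

lemma bounded_family_linf:
  assumes \<phi>: "\<phi> \<in> Es" and y: "\<And>i. y i \<in> carr E" and bound: "\<And>i. nrm E (y i) \<le> C"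
  shows "(\<lambda>i. \<phi> (y i)) \<in> carr linf"
  using order_trans[OF E.functional_le[OF Es_dual[OF \<phi>] y]
      mult_left_mono[OF bound E.dual_norm_nonneg[OF Es_dual[OF \<phi>]]]]
  by (rule linfI)

lemma functional_act_sub:
  assumes \<phi>: "\<phi> \<in> Es" and a: "ell1 a" and x: "x \<in> carr E" and y: "y \<in> carr E"
  shows "\<phi> (a \<rhd> sub E x y) = \<phi> (a \<rhd> x) - \<phi> (a \<rhd> y)"
    "\<phi> (sub E x y \<lhd> a) = \<phi> (x \<lhd> a) - \<phi> (y \<lhd> a)"
  using E.functional_sub[OF Es_dual[OF Es_act(2)[OF \<phi> a]] x y]
    E.functional_sub[OF Es_dual[OF Es_act(1)[OF \<phi> a]] x y] x y
  by (simp_all add: functional_shift[OF \<phi> a] E.sub_closed)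

text \<open>With \<open>z\<close> a weak* cluster point of \<open>\<delta>\<^bsub>g\<^sub>m\<^esub> \<rhd> D \<delta>\<^bsub>h\<^sub>m\<^esub>\<close>, the inner limit of the product of
  the two double sequences is \<open>\<phi> (\<delta>\<^bsub>k\<^sub>n\<^esub> \<rhd> z)\<close>, which tends to zero because the \<open>k\<^sub>n\<close> are
  distinct and the action is weak*-continuous.\<close>

lemma left_double_limit:
  assumes \<phi>: "\<phi> \<in> Es" and k: "inj k"
    and lim: "repeated_limit (\<lambda>n m. \<phi> (delta (k n * g m) \<rhd> D (delta (h m)))) L"
    and lim_\<Omega>: "repeated_limit (\<lambda>n m. Omega \<omega> (k n) (g m)) W"
  shows "L = 0 \<or> W = 0"
proof -
  obtain l where l: "\<And>n. (\<lambda>m. \<phi> (delta (k n * g m) \<rhd> D (delta (h m)))) \<longlonglongrightarrow> l n" "l \<longlonglongrightarrow> L"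
    using lim unfolding repeated_limit_def by blast
  obtain w where w: "\<And>n. (\<lambda>m. Omega \<omega> (k n) (g m)) \<longlonglongrightarrow> w n" "w \<longlonglongrightarrow> W"
    using lim_\<Omega> unfolding repeated_limit_def by blast
  obtain \<Theta> :: "(nat \<Rightarrow> complex) \<Rightarrow> complex" where \<Theta>: "\<Theta> \<in> carr (dual_space linf)"
    "\<And>x l. x \<longlonglongrightarrow> l \<Longrightarrow> \<Theta> x = l"
    using exists_limit_functional by blast
  obtain C where C: "\<And>g h. nrm E (delta g \<rhd> D (delta h)) \<le> C" using orbit_bounded by blast
  obtain z where z: "z \<in> carr E" "\<And>\<phi>. \<phi> \<in> Es \<Longrightarrow> \<phi> z = \<Theta> (\<lambda>m. \<phi> (delta (g m) \<rhd> D (delta (h m))))"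
    using weak_star_integral[OF \<Theta>(1), of "\<lambda>m. delta (g m) \<rhd> D (delta (h m))" C] C by (auto simp: ell1_delta)
  have "l n * of_real (w n) = \<phi> (delta (k n) \<rhd> z)" for n
  proof -
    have "(\<lambda>m. \<phi> (delta (k n) \<rhd> (delta (g m) \<rhd> D (delta (h m))))) \<longlonglongrightarrow> l n * of_real (w n)"
      using tendsto_mult[OF l(1) tendsto_of_real[OF w(1)], of n]
      by (simp add: functional_delta_delta[OF \<phi>] ell1_delta)
    from \<Theta>(2)[OF this] show ?thesis
      using z(2)[OF Es_act(2)[OF \<phi> ell1_delta], of "k n"]
      by (simp add: functional_shift[OF \<phi> ell1_delta] z(1) ell1_delta)
  qed
  then have "(\<lambda>n. l n * of_real (w n)) \<longlonglongrightarrow> 0"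
    using c0_inj_tendsto[OF c0_coefficients(1)[OF \<phi> z(1)] k] by simp
  moreover have "(\<lambda>n. l n * of_real (w n)) \<longlonglongrightarrow> L * of_real W"
    by (intro tendsto_mult l(2) tendsto_of_real w(2))
  ultimately have "L * of_real W = 0" using LIMSEQ_unique by blast
  then show ?thesis by simp
qed

text \<open>The derivation rule splits the product of the two double sequences into a term as in the previous
  lemma, for the right action, and \<open>\<phi> (\<delta>\<^bsub>g\<^sub>m h\<^sub>m\<^esub> \<rhd> D \<delta>\<^bsub>k\<^sub>n\<^esub>)\<close> up to a weight. Along a
  subsequence the products \<open>g\<^sub>m h\<^sub>m\<close> are distinct, and then the inner limit is zero by normality, or
  they are constant, and then the outer limit is zero by the weak* continuity of \<open>D\<close>.\<close>

lemma right_double_limit: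
  assumes \<phi>: "\<phi> \<in> Es" and k: "inj k"
    and lim: "repeated_limit (\<lambda>n m. \<phi> (delta (g m) \<rhd> D (delta (h m * k n)))) L"
    and lim_\<Omega>: "repeated_limit (\<lambda>n m. Omega \<omega> (h m) (k n)) W"
  shows "L = 0 \<or> W = 0"
proof -
  obtain r :: "nat \<Rightarrow> nat" where r: "strict_mono r"
    "(\<exists>c. \<forall>m. g (r m) * h (r m) = c) \<or> inj ((\<lambda>m. g m * h m) \<circ> r)"
    using constant_or_injective_subsequence[of "\<lambda>m. g m * h m"] by blast
  obtain l where l: "\<And>n. (\<lambda>m. \<phi> (delta (g m) \<rhd> D (delta (h m * k n)))) \<longlonglongrightarrow> l n" "l \<longlonglongrightarrow> L"
    using lim unfolding repeated_limit_def by blast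
  obtain w where w: "\<And>n. (\<lambda>m. Omega \<omega> (h m) (k n)) \<longlonglongrightarrow> w n" "w \<longlonglongrightarrow> W"
    using lim_\<Omega> unfolding repeated_limit_def by blast
  obtain \<Theta> :: "(nat \<Rightarrow> complex) \<Rightarrow> complex" where \<Theta>: "\<Theta> \<in> carr (dual_space linf)"
    "\<And>x l. x \<longlonglongrightarrow> l \<Longrightarrow> \<Theta> x = l"
    using exists_limit_functional by blast
  obtain C where C: "\<And>g h. nrm E (delta g \<rhd> D (delta h)) \<le> C" using orbit_bounded by blast
  define y where "y m = delta (g (r m)) \<rhd> D (delta (h (r m)))" for m
  have y: "y m \<in> carr E" for m by (simp add: y_def ell1_delta)
  obtain z where z: "z \<in> carr E" "\<And>\<phi>. \<phi> \<in> Es \<Longrightarrow> \<phi> z = \<Theta> (\<lambda>m. \<phi> (y m))"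
    using weak_star_integral[OF \<Theta>(1), of y C] C y by (auto simp: y_def)
  define v where "v n m = \<phi> (delta (g (r m) * h (r m)) \<rhd> D (delta (k n))) * \<Omega> (g (r m)) (h (r m))" for n m
  have v_le: "cmod (v n m) \<le> cmod (\<phi> (delta (g (r m) * h (r m)) \<rhd> D (delta (k n))))" for n m
    unfolding v_def by (rule norm_Omega_mult) simp
  have bounded: "(\<lambda>s. \<phi> (delta s \<rhd> D (delta (k n)))) \<in> carr linf" for n
    using c0_coefficients(1)[OF \<phi>, of "D (delta (k n))"] c0_subset_linf by (auto simp: ell1_delta)
  have v_linf: "v n \<in> carr linf" for n
    using order_trans[OF v_le linf_le[OF bounded]] by (rule linfI)
  have y_linf: "(\<lambda>m. \<phi> (y m \<lhd> delta (k n))) \<in> carr linf" for n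
  proof -
    have "(\<lambda>m. dual_lact E (delta (k n)) \<phi> (y m)) \<in> carr linf"
      by (rule bounded_family_linf[OF Es_act(1)[OF \<phi> ell1_delta] y]) (use C in \<open>simp add: y_def\<close>)
    then show ?thesis by (simp add: functional_shift[OF \<phi> ell1_delta] y)
  qed
  have split: "l n * of_real (w n) = \<phi> (z \<lhd> delta (k n)) + \<Theta> (v n)" for n
  proof -
    have "(\<lambda>m. \<phi> (delta (g (r m)) \<rhd> D (delta (h (r m) * k n))) * \<Omega> (h (r m)) (k n)) \<longlonglongrightarrow> l n * of_real (w n)"
      using LIMSEQ_subseq_LIMSEQ[OF tendsto_mult[OF l(1) tendsto_of_real[OF w(1)]] r(1), of n n] by (simp add: o_def)
    then have "\<Theta> (\<lambda>m. \<phi> (y m \<lhd> delta (k n)) + v n m) = l n * of_real (w n)"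
      by (intro \<Theta>(2)) (simp only: functional_D_delta[OF \<phi>] y_def v_def)
    then show ?thesis
      using linf.functional_add[OF \<Theta>(1) y_linf v_linf, of n n] z(2)[OF Es_act(1)[OF \<phi> ell1_delta], of "k n"]
      by (simp add: linf_simps functional_shift[OF \<phi> ell1_delta] y z(1))
  qed
  have "(\<lambda>n. \<Theta> (v n)) \<longlonglongrightarrow> 0"
    using r(2)
  proof
    assume "\<exists>c. \<forall>m. g (r m) * h (r m) = c"
    then obtain c where c: "\<And>m. g (r m) * h (r m) = c" by blast
    have le: "cmod (\<Theta> (v n)) \<le> nrm (dual_space linf) \<Theta> * cmod (\<phi> (delta c \<rhd> D (delta (k n))))" for n
      using order_trans[OF linf.functional_le[OF \<Theta>(1) v_linf]
          mult_left_mono[OF linf_norm_le[of "v n", OF v_le[unfolded c]] linf.dual_norm_nonneg[OF \<Theta>(1)]]] .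
    have "(\<lambda>n. \<phi> (delta c \<rhd> D (delta (k n)))) \<longlonglongrightarrow> 0"
      using c0_inj_tendsto[OF c0_coefficients(3)[OF Es_act(2)[OF \<phi> ell1_delta]] k, of c]
      by (simp add: functional_shift[OF \<phi> ell1_delta] ell1_delta)
    then have lim: "(\<lambda>n. nrm (dual_space linf) \<Theta> * cmod (\<phi> (delta c \<rhd> D (delta (k n))))) \<longlonglongrightarrow> 0"
      by (intro tendsto_mult_right_zero tendsto_norm_zero)
    show ?thesis by (rule Lim_null_comparison[OF always_eventually lim]) (use le in blast)
  next
    assume inj: "inj ((\<lambda>m. g m * h m) \<circ> r)"
    have "v n \<longlonglongrightarrow> 0" for n
    proof (rule Lim_null_comparison[OF always_eventually])
      show "\<forall>m. norm (v n m) \<le> cmod (\<phi> (delta (g (r m) * h (r m)) \<rhd> D (delta (k n))))" using v_le by blast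
      show "(\<lambda>m. cmod (\<phi> (delta (g (r m) * h (r m)) \<rhd> D (delta (k n))))) \<longlonglongrightarrow> 0"
        using c0_inj_tendsto[OF c0_coefficients(1)[OF \<phi>] inj, of "D (delta (k n))"]
        by (intro tendsto_norm_zero) (simp add: ell1_delta)
    qed
    then have "\<Theta> (v n) = 0" for n by (rule \<Theta>(2))
    then show ?thesis by simp
  qed
  then have "(\<lambda>n. l n * of_real (w n)) \<longlonglongrightarrow> 0 + 0"
    unfolding split using c0_inj_tendsto[OF c0_coefficients(2)[OF \<phi> z(1)] k] by (intro tendsto_add)
  moreover have "(\<lambda>n. l n * of_real (w n)) \<longlonglongrightarrow> L * of_real W"
    by (intro tendsto_mult l(2) tendsto_of_real w(2))
  ultimately have "L * of_real W = 0 + 0" using LIMSEQ_unique by blast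
  then show ?thesis by simp
qed

lemma orbit_operator_condition_D:
  assumes \<phi>: "\<phi> \<in> Es" shows "condition_D \<omega> (orbit_operator \<phi>)"
  unfolding condition_D_def
proof (intro conjI subsetI allI impI)
  fix f assume "f \<in> orbit_operator \<phi> ` carr (beurling \<omega>)"
  then show "f \<in> c0" using c0_coefficients(1)[OF \<phi>] by (auto simp: orbit_operator_def beurling_simps)
next
  fix f assume "f \<in> adjoint_map (orbit_operator \<phi>) ` bidual_embedding ` carr (beurling \<omega>)"
  then obtain a where a: "ell1 a" "f = adjoint_map (orbit_operator \<phi>) (bidual_embedding a)"
    by (auto simp: beurling_simps)
  have "orbit_operator \<phi> (delta s) \<in> carr linf" for s
    using orbit_operator_bounded[OF \<phi>] by (simp add: bounded_linear_map_def beurling_simps ell1_delta)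
  then have "f = (\<lambda>s. dual_ract E \<phi> a (D (delta s)))"
    using pairing_orbit[OF \<phi> a(1)]
    by (simp add: a(2) adjoint_map_def bidual_embedding_def functional_shift[OF \<phi> a(1)] ell1_delta)
      (simp add: orbit_operator_def ell1_delta)
  then show "f \<in> c0" using c0_coefficients(3)[OF Es_act(2)[OF \<phi> a(1)]] by simp
next
  fix k :: "nat \<Rightarrow> 's" and gh L\<^sub>1 W\<^sub>1 L\<^sub>2 W\<^sub>2
  assume "inj k \<and> inj gh \<and>
    repeated_limit (\<lambda>n m. pairing (delta (k n * fst (gh m))) (orbit_operator \<phi> (delta (snd (gh m))))) L\<^sub>1 \<and>
    repeated_limit (\<lambda>n m. Omega \<omega> (k n) (fst (gh m))) W\<^sub>1 \<and>
    repeated_limit (\<lambda>n m. pairing (delta (fst (gh m))) (orbit_operator \<phi> (delta (snd (gh m) * k n)))) L\<^sub>2 \<and>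
    repeated_limit (\<lambda>n m. Omega \<omega> (snd (gh m)) (k n)) W\<^sub>2"
  then show "L\<^sub>1 = 0 \<or> W\<^sub>1 = 0" "L\<^sub>2 = 0 \<or> W\<^sub>2 = 0"
    using left_double_limit[OF \<phi>, of k "\<lambda>m. fst (gh m)" "\<lambda>m. snd (gh m)" L\<^sub>1 W\<^sub>1]
      right_double_limit[OF \<phi>, of k "\<lambda>m. fst (gh m)" "\<lambda>m. snd (gh m)" L\<^sub>2 W\<^sub>2]
    by (simp_all add: pairing_delta orbit_operator_def)
qed

text \<open>The weak* integral \<open>x0\<close> of \<open>\<delta>\<^sub>g \<rhd> D \<delta>\<^sub>h\<close> with respect to \<open>M\<close> implements \<open>e \<rhd> D \<delta>\<^sub>k\<close>. For
  \<open>z = D e - e \<rhd> D e\<close> the derivation rule gives \<open>\<delta>\<^sub>k \<rhd> z = 0\<close> and \<open>z \<lhd> \<delta>\<^sub>k = D e \<lhd> \<delta>\<^sub>k\<close>, which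
  is what is missing from \<open>D \<delta>\<^sub>k\<close>.\<close>

theorem inner_at_delta:
  assumes "condition_2 \<omega> e"
  shows "\<exists>x\<in>carr E. D (delta k) = sub E (delta k \<rhd> x) (x \<lhd> delta k)"
proof -
  obtain M where M: "M \<in> carr (dual_space linf)"
    and M_module: "\<forall>f\<in>carr linf. \<forall>T. bounded_linear_map (beurling \<omega>) linf T \<and>
        (\<forall>g h. pairing (delta h) (T (delta g)) = f (g, h)) \<and> condition_D \<omega> T \<longrightarrow>
      M (\<lambda>(g, h). f (h * k, g) * \<Omega> h k - f (h, k * g) * \<Omega> k g) = 0"
    and M_diag: "\<forall>f\<in>c0. M (\<lambda>(g, h). f (g * h) * \<Omega> g h) = pairing e f"
    using spec[OF assms[unfolded condition_2_def], of k] by (elim bexE conjE)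
  note [simp] = ell1_delta ell1_unit
  obtain C where C: "\<And>g h. nrm E (delta g \<rhd> D (delta h)) \<le> C" using orbit_bounded by blast
  define y where "y p = delta (fst p) \<rhd> D (delta (snd p))" for p
  have y: "y p \<in> carr E" for p by (simp add: y_def)
  obtain x0 where x0: "x0 \<in> carr E" "\<And>\<phi>. \<phi> \<in> Es \<Longrightarrow> \<phi> x0 = M (\<lambda>p. \<phi> (y p))"
    using weak_star_integral[OF M, of y C] C y by (auto simp: y_def)
  have e_part: "\<phi> (e \<rhd> D (delta k)) = \<phi> (delta k \<rhd> x0) - \<phi> (x0 \<lhd> delta k)" if \<phi>: "\<phi> \<in> Es" for \<phi>
  proof -
    have in_linf: "(\<lambda>p. \<psi> (y p)) \<in> carr linf" if "\<psi> \<in> Es" for \<psi>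
      by (rule bounded_family_linf[OF that y]) (use C in \<open>simp add: y_def\<close>)
    \<comment> \<open>By the derivation rule \<open>P + Q - R\<close> is the function on which \<open>M\<close> is assumed to vanish.\<close>
    define P where "P p = \<phi> (y p \<lhd> delta k)" for p
    define Q where "Q = (\<lambda>(g, h). \<phi> (delta (g * h) \<rhd> D (delta k)) * \<Omega> g h)"
    define R where "R p = \<phi> (delta k \<rhd> y p)" for p
    have P: "P \<in> carr linf" "M P = \<phi> (x0 \<lhd> delta k)"
      using in_linf[OF Es_act(1)[OF \<phi>], of "delta k"] x0(2)[OF Es_act(1)[OF \<phi>], of "delta k"] x0(1) y
      by (simp_all add: functional_shift[OF \<phi>] P_def[abs_def])
    have R: "R \<in> carr linf" "M R = \<phi> (delta k \<rhd> x0)"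
      using in_linf[OF Es_act(2)[OF \<phi>], of "delta k"] x0(2)[OF Es_act(2)[OF \<phi>], of "delta k"] x0(1) y
      by (simp_all add: functional_shift[OF \<phi>] R_def[abs_def])
    have q: "(\<lambda>s. \<phi> (delta s \<rhd> D (delta k))) \<in> c0" using c0_coefficients(1)[OF \<phi>] by simp
    have Q: "Q \<in> carr linf" "M Q = \<phi> (e \<rhd> D (delta k))"
    proof -
      have "(\<lambda>s. \<phi> (delta s \<rhd> D (delta k))) \<in> carr linf" using q c0_subset_linf by blast
      from linf_le[OF this] show "Q \<in> carr linf"
        unfolding Q_def by (intro linfI) (auto split: prod.split intro: norm_Omega_mult)
      show "M Q = \<phi> (e \<rhd> D (delta k))"
        using bspec[OF M_diag q] pairing_orbit[OF \<phi> ell1_unit, of "D (delta k)"] by (simp add: Q_def)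
    qed
    define f where "f = (\<lambda>(h, g). \<phi> (delta g \<rhd> D (delta h)))"
    have f: "f \<in> carr linf"
    proof -
      have "f = (\<lambda>p. \<phi> (y (snd p, fst p)))" by (auto simp: f_def y_def)
      then show ?thesis using linf_le[OF in_linf[OF \<phi>]] by (auto intro: linfI)
    qed
    have "(\<lambda>(g, h). f (h * k, g) * \<Omega> h k - f (h, k * g) * \<Omega> k g) = (\<lambda>p. (P p + Q p) - R p)"
      by (auto simp: f_def P_def Q_def R_def y_def functional_D_delta[OF \<phi>] functional_delta_delta[OF \<phi>])
    moreover have "M (\<lambda>(g, h). f (h * k, g) * \<Omega> h k - f (h, k * g) * \<Omega> k g) = 0"
      by (rule M_module[rule_format, OF f, of "orbit_operator \<phi>"])
        (simp add: orbit_operator_bounded[OF \<phi>] orbit_operator_condition_D[OF \<phi>]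
          pairing_delta orbit_operator_def f_def)
    ultimately have "M P + M Q - M R = 0"
      using linf.functional_add[OF M P(1) Q(1)] linf.functional_sub[OF M linf_add(1)[OF P(1) Q(1)] R(1)]
      by (simp add: linf_simps)
    then show ?thesis by (simp add: P(2) Q(2) R(2) algebra_simps)
  qed
  define z where "z = sub E (D e) (e \<rhd> D e)"
  define x where "x = sub E x0 z"
  have z: "z \<in> carr E" by (simp add: z_def E.sub_closed)
  have x: "x \<in> carr E" by (simp add: x_def E.sub_closed x0(1) z)
  have "D (delta k) = sub E (delta k \<rhd> x) (x \<lhd> delta k)"
  proof (rule E_separated)
    fix \<phi> assume \<phi>: "\<phi> \<in> Es"
    note \<phi>' = Es_dual[OF \<phi>]
    have D_k: "D (delta k) = add E (D e \<lhd> delta k) (e \<rhd> D (delta k))"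
      using D_conv[OF ell1_unit ell1_delta, of k] unfolding left_unit[OF ell1_delta] .
    \<comment> \<open>Multiplying the derivation rule for \<open>e \<star> \<delta>\<^sub>k\<close> by \<open>e\<close> from the left cancels the other term.\<close>
    have "\<phi> (e \<rhd> (D e \<lhd> delta k)) = 0"
    proof -
      have "e \<rhd> D (delta k) = e \<rhd> add E (D e \<lhd> delta k) (e \<rhd> D (delta k))"
        by (rule arg_cong[OF D_k])
      also have "\<dots> = add E (e \<rhd> (D e \<lhd> delta k)) (e \<rhd> (e \<rhd> D (delta k)))"
        by (simp add: E.lact_add_right beurling_simps)
      also have "e \<rhd> (e \<rhd> D (delta k)) = e \<rhd> D (delta k)"
        using lact_conv[OF ell1_unit ell1_unit, of "D (delta k)"] by (simp add: left_unit)
      finally have "\<phi> (e \<rhd> D (delta k)) = \<phi> (add E (e \<rhd> (D e \<lhd> delta k)) (e \<rhd> D (delta k)))"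
        by (rule arg_cong)
      also have "\<dots> = \<phi> (e \<rhd> (D e \<lhd> delta k)) + \<phi> (e \<rhd> D (delta k))"
        by (simp add: E.functional_add[OF \<phi>'])
      finally show ?thesis by simp
    qed
    moreover have "(e \<rhd> D e) \<lhd> delta k = e \<rhd> (D e \<lhd> delta k)"
      using E.lact_ract[of e "delta k" "D e"] by (simp add: beurling_simps)
    ultimately have z_right: "\<phi> (z \<lhd> delta k) = \<phi> (D e \<lhd> delta k)"
      by (simp add: z_def functional_act_sub(2)[OF \<phi>])
    have z_left: "\<phi> (delta k \<rhd> z) = 0"
      using lact_conv[OF ell1_delta ell1_unit, of "D e" k]
      by (simp add: z_def functional_act_sub(1)[OF \<phi>] right_unit)
    have "\<phi> (D (delta k)) = \<phi> (D e \<lhd> delta k) + \<phi> (e \<rhd> D (delta k))"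
      by (subst D_k) (simp add: E.functional_add[OF \<phi>'])
    then show "\<phi> (D (delta k)) = \<phi> (sub E (delta k \<rhd> x) (x \<lhd> delta k))"
      using x x0(1) z by (simp add: E.functional_sub[OF \<phi>'] x_def functional_act_sub[OF \<phi>]
          e_part[OF \<phi>] z_left z_right)
  qed (simp_all add: E.sub_closed x)
  then show ?thesis using x by blast
qed

end

theorem theorem4p5:
  fixes \<omega> :: "'s::semigroup_mult \<Rightarrow> real" and e :: "'s \<Rightarrow> complex"
  assumes weakly_cancellative: "\<forall>s u :: 's. finite {t. s * t = u} \<and> finite {t. t * s = u}"
    and weight: "weight \<omega>"
    and identity: "e \<in> carr (beurling \<omega>)"
      "\<forall>a\<in>carr (beurling \<omega>). mul (beurling \<omega>) e a = a \<and> mul (beurling \<omega>) a e = a"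
  shows
    "(pointwise_connes_amenable TYPE(('s \<times> 's \<Rightarrow> complex) \<Rightarrow> complex)
        (beurling \<omega>) (beurling_predual \<omega>) \<longrightarrow> condition_2 \<omega> e) \<and>
     (condition_2 \<omega> e \<longrightarrow>
        (\<forall>k. pointwise_connes_amenable_at TYPE('e)
               (beurling \<omega>) (beurling_predual \<omega>) (delta k)))"
proof -
  interpret unital_beurling_algebra \<omega> e
    using assms by unfold_locales (auto simp: beurling_simps)
  show ?thesis
  proof (intro conjI impI allI)
    assume "pointwise_connes_amenable TYPE(('s \<times> 's \<Rightarrow> complex) \<Rightarrow> complex)
      (beurling \<omega>) (beurling_predual \<omega>)"
    then show "condition_2 \<omega> e" by (rule pointwise_connes_amenable_imp_condition_2)
  next
    fix k assume c2: "condition_2 \<omega> e"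
    show "pointwise_connes_amenable_at TYPE('e) (beurling \<omega>) (beurling_predual \<omega>) (delta k)"
      unfolding pointwise_connes_amenable_at_def
    proof (intro allI impI)
      fix E :: "('s \<Rightarrow> complex, 'e) cbimodule" and Es D
      assume "dual_banach_bimodule (beurling \<omega>) E Es \<and> normal_bimodule (beurling \<omega>) (beurling_predual \<omega>) E Es \<and>
        derivation (beurling \<omega>) E D \<and>
        continuous_map (weak_star (beurling \<omega>) (beurling_predual \<omega>)) (weak_star E Es) D"
      then interpret weak_star_derivation \<omega> e E Es D
        by unfold_locales auto
      show "\<exists>x\<in>carr E. D (delta k) = sub E (lact E (delta k) x) (ract E x (delta k))"
        by (rule inner_at_delta[OF c2])
    qed
  qed
qed

end
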